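(* Let $G$ be a polygon in the Euclidean plane that generates an edge tessellation, i.e. a tiling of the plane obtained by reflecting $G$ in its edges. Then $G$ is one of the following eight types: (1) a rectangle; (2) an equilateral triangle; (3) a $60$-right triangle; (4) an isosceles right triangle; (5) a $120$-isosceles triangle; (6) a $120$-rhombus; (7) a $60$-$90$-$120$ kite; (8) a regular hexagon.
   Context: A polygon means the closed region bounded by a simple closed polygonal curve; two consecutive edges are never collinear, so no interior angle equals $180^\circ$. A tessellation (tiling) of the plane is a collection of plane figures (tiles) that fills the plane with no overlaps and no gaps: the union of the tiles is the whole plane and distinct tiles have disjoint interiors. Edge tessellation generated by $G$: let $\mathcal{T}$ be the smallest collection of polygons that contains $G$ and is such that, whenever $Q\in\mathcal{T}$ and $e$ is an edge of $Q$, the mirror image of $Q$ in the line containing $e$ is also in $\mathcal{T}$. (Members of $\mathcal{T}$ are regarded as subsets of the plane, so images that coincide as sets count as the same tile.) The polygon $G$ generates an edge tessellation (a tiling of the plane when reflected in its edges) if $\mathcal{T}$ is a tessellation of the plane. Terminology for shapes: a rectangle may be a square; a $60$-right triangle has interior angles $30^\circ,60^\circ,90^\circ$; an isosceles right triangle has interior angles $45^\circ,45^\circ,90^\circ$; a $120$-isosceles triangle has interior angles $30^\circ,30^\circ,120^\circ$; a $120$-rhombus is a rhombus with an interior angle of $120^\circ$; a $60$-$90$-$120$ kite is a quadrilateral that is symmetric about one of its diagonals and has consecutive interior angles $60^\circ,90^\circ,120^\circ,90^\circ$. *)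

theory Defs
  imports "HOL-Analysis.Analysis"
begin

text \<open>The Euclidean plane is \<^typ>\<open>complex\<close> with its usual norm and inner product. A polygon is a
  set of points; a list of vertices (in cyclic order, up to rotation and reversal) describes it.\<close>

fun polygonal_path :: "complex list \<Rightarrow> real \<Rightarrow> complex" where
  "polygonal_path [] = linepath 0 0"
| "polygonal_path [a] = linepath a a"
| "polygonal_path [a, b] = linepath a b"
| "polygonal_path (a # b # c # vs) = linepath a b +++ polygonal_path (b # c # vs)"

definition boundary_path :: "complex list \<Rightarrow> real \<Rightarrow> complex" where
  "boundary_path vs = polygonal_path (vs @ [hd vs])"

definition next_vertex :: "complex list \<Rightarrow> nat \<Rightarrow> complex" where
  "next_vertex vs i = vs ! (Suc i mod length vs)"

definition prev_vertex :: "complex list \<Rightarrow> nat \<Rightarrow> complex" where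
  "prev_vertex vs i = vs ! ((i + length vs - 1) mod length vs)"

definition region :: "complex list \<Rightarrow> complex set" where
  "region vs = path_image (boundary_path vs) \<union> inside (path_image (boundary_path vs))"

definition polygon_vertices :: "complex set \<Rightarrow> complex list \<Rightarrow> bool" where
  "polygon_vertices P vs \<longleftrightarrow>
     3 \<le> length vs \<and> simple_path (boundary_path vs) \<and>
     (\<forall>i<length vs. \<not> collinear {prev_vertex vs i, vs ! i, next_vertex vs i}) \<and>
     P = region vs"

definition polygon :: "complex set \<Rightarrow> bool" where
  "polygon P \<longleftrightarrow> (\<exists>vs. polygon_vertices P vs)"

text \<open>The edge with end points \<open>a\<close> and \<open>b\<close>. The vertex lists of a polygon differ only by rotation and
  reversal, so the edges depend on the set \<open>P\<close> only.\<close>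

definition polygon_edge :: "complex set \<Rightarrow> complex \<Rightarrow> complex \<Rightarrow> bool" where
  "polygon_edge P a b \<longleftrightarrow>
     (\<exists>vs i. polygon_vertices P vs \<and> i < length vs \<and> a = vs ! i \<and> b = next_vertex vs i)"

text \<open>The mirror image in the line through \<open>a \<noteq> b\<close>: complex conjugation in the coordinate that sends
  \<open>a\<close> to 0 and \<open>b\<close> to 1.\<close>

definition reflect :: "complex \<Rightarrow> complex \<Rightarrow> complex \<Rightarrow> complex" where
  "reflect a b z = a + (b - a) * cnj ((z - a) / (b - a))"

inductive_set edge_tiles :: "complex set \<Rightarrow> complex set set" for G :: "complex set" where
  base: "G \<in> edge_tiles G"
| step: "Q \<in> edge_tiles G \<Longrightarrow> polygon_edge Q a b \<Longrightarrow> reflect a b ` Q \<in> edge_tiles G"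

definition tessellation :: "complex set set \<Rightarrow> bool" where
  "tessellation T \<longleftrightarrow> \<Union>T = UNIV \<and> pairwise (\<lambda>A B. disjnt (interior A) (interior B)) T"

definition generates_edge_tessellation :: "complex set \<Rightarrow> bool" where
  "generates_edge_tessellation G \<longleftrightarrow> tessellation (edge_tiles G)"

text \<open>The unoriented angle at \<open>b\<close>, between 0 and \<open>pi\<close>, for \<open>a \<noteq> b\<close> and \<open>c \<noteq> b\<close>.\<close>

definition angle :: "complex \<Rightarrow> complex \<Rightarrow> complex \<Rightarrow> real" where
  "angle a b c = arccos (((a - b) \<bullet> (c - b)) / (norm (a - b) * norm (c - b)))"

text \<open>The interior angle is the unoriented angle if the convex sector spanned by the two edges at the
  vertex lies locally in the polygon; otherwise it is the complementary reflex angle.\<close>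

definition interior_angle :: "complex list \<Rightarrow> nat \<Rightarrow> real" where
  "interior_angle vs i =
     (let u = prev_vertex vs i; v = vs ! i; w = next_vertex vs i in
      if \<exists>r>0. convex hull {v, v + r *\<^sub>R (u - v), v + r *\<^sub>R (w - v)} \<subseteq> region vs
      then angle u v w else 2 * pi - angle u v w)"

definition interior_angles :: "complex list \<Rightarrow> real list" where
  "interior_angles vs = map (interior_angle vs) [0..<length vs]"

definition equilateral :: "complex list \<Rightarrow> bool" where
  "equilateral vs \<longleftrightarrow>
     (\<forall>i<length vs. \<forall>j<length vs. dist (vs ! i) (next_vertex vs i) = dist (vs ! j) (next_vertex vs j))"

definition equiangular :: "complex list \<Rightarrow> bool" where
  "equiangular vs \<longleftrightarrow>
     (\<forall>i<length vs. \<forall>j<length vs. interior_angle vs i = interior_angle vs j)"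

definition rectangle :: "complex set \<Rightarrow> bool" where
  "rectangle P \<longleftrightarrow> (\<exists>vs. polygon_vertices P vs \<and> interior_angles vs = [pi/2, pi/2, pi/2, pi/2])"

definition equilateral_triangle :: "complex set \<Rightarrow> bool" where
  "equilateral_triangle P \<longleftrightarrow> (\<exists>vs. polygon_vertices P vs \<and> length vs = 3 \<and> equilateral vs)"

definition right_triangle_60 :: "complex set \<Rightarrow> bool" where
  "right_triangle_60 P \<longleftrightarrow> (\<exists>vs. polygon_vertices P vs \<and> interior_angles vs = [pi/6, pi/3, pi/2])"

definition isosceles_right_triangle :: "complex set \<Rightarrow> bool" where
  "isosceles_right_triangle P \<longleftrightarrow>
     (\<exists>vs. polygon_vertices P vs \<and> interior_angles vs = [pi/4, pi/4, pi/2])"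

definition isosceles_triangle_120 :: "complex set \<Rightarrow> bool" where
  "isosceles_triangle_120 P \<longleftrightarrow>
     (\<exists>vs. polygon_vertices P vs \<and> interior_angles vs = [pi/6, pi/6, 2*pi/3])"

definition rhombus_120 :: "complex set \<Rightarrow> bool" where
  "rhombus_120 P \<longleftrightarrow>
     (\<exists>vs. polygon_vertices P vs \<and> length vs = 4 \<and> equilateral vs \<and> 2*pi/3 \<in> set (interior_angles vs))"

definition kite_60_90_120 :: "complex set \<Rightarrow> bool" where
  "kite_60_90_120 P \<longleftrightarrow>
     (\<exists>vs. polygon_vertices P vs \<and> interior_angles vs = [pi/3, pi/2, 2*pi/3, pi/2] \<and>
       (reflect (vs ! 0) (vs ! 2) ` P = P \<or> reflect (vs ! 1) (vs ! 3) ` P = P))"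

definition regular_hexagon :: "complex set \<Rightarrow> bool" where
  "regular_hexagon P \<longleftrightarrow>
     (\<exists>vs. polygon_vertices P vs \<and> length vs = 6 \<and> equilateral vs \<and> equiangular vs)"

end

theory Submission
  imports Defs
begin

text \<open>Only the disjointness of the tiles is used. At a reflex vertex the backward prolongation of an edge is
  interior both to \<open>G\<close> and to its mirror image in that edge, so all vertices are locally convex and \<open>G\<close> is
  convex. Reflecting \<open>G\<close> successively around a vertex with angle \<open>c\<close> produces copies in consecutive sectors of
  angle \<open>c\<close>; the copies can only close up if \<open>c = 2 \<pi> / k\<close> with \<open>k \<ge> 3\<close>, and for odd \<open>k\<close> the last copy
  shows that \<open>G\<close> is symmetric in the bisector of the angle. Since the angles add up to \<open>(n - 2) \<pi>\<close>, the
  orders satisfy \<open>\<Sum> 1 / k = (n - 2) / 2\<close>, hence \<open>n \<le> 6\<close>, and the symmetries at the vertices of odd order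
  leave the eight types.\<close>

section \<open>Polygonal curves\<close>

text \<open>A vertex list only gives a Jordan curve, so which side of an edge belongs to
  \<open>G\<close> is not known in advance. Near a boundary point the curve cuts a disc into two
  connected pieces, one inside and one outside; the undecided sign is carried along until convexity
  makes it the same for all edges. The angle sum has to be exact, whereas the closing up of the
  polygon determines the total turning only modulo \<open>2 * pi\<close>. Each angle is less than
  \<open>pi\<close>, hence \<open>k \<ge> 3\<close>. Alternate copies around a vertex are placed by
  rotations and by reflections. For odd \<open>k\<close>, the copy reached after a full turn is
  placed by a reflection and fills the sector of \<open>G\<close> itself; it must be
  \<open>G\<close>, and that reflection has the bisector as its axis. The symmetry equates the two
  edges at the vertex and the orders of the two neighbouring vertices. This excludes, for example,
  the triangle of orders 3, 7, 42 and all pentagons. Where a shape is defined by its sides, ratios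
  of lengths not fixed by such symmetries follow from the fact that the edge vectors add up to
  zero.\<close>

definition vert :: "complex list \<Rightarrow> nat \<Rightarrow> complex" where
  "vert vs i = vs ! (i mod length vs)"

definition side :: "complex list \<Rightarrow> nat \<Rightarrow> complex set" where
  "side vs i = closed_segment (vert vs i) (vert vs (Suc i))"

lemma pathstart_polygonal_path: "ws \<noteq> [] \<Longrightarrow> pathstart (polygonal_path ws) = hd ws"
  by (induction ws rule: polygonal_path.induct) auto

lemma pathfinish_polygonal_path: "ws \<noteq> [] \<Longrightarrow> pathfinish (polygonal_path ws) = last ws"
  by (induction ws rule: polygonal_path.induct) auto

lemma UN_lessThan_Suc_shift: "(\<Union>i<Suc m. A i) = A 0 \<union> (\<Union>i<m. A (Suc i))"
  by (auto simp: less_Suc_eq_0_disj)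

lemma path_image_polygonal_path:
  assumes "2 \<le> length ws"
  shows "path_image (polygonal_path ws) =
    (\<Union>i<length ws - 1. closed_segment (ws ! i) (ws ! Suc i))"
  using assms
proof (induction ws rule: polygonal_path.induct)
  case (4 a b c vs)
  have "path_image (polygonal_path (a # b # c # vs)) =
      closed_segment a b \<union> path_image (polygonal_path (b # c # vs))"
    by (simp add: path_image_join pathstart_polygonal_path)
  with 4 show ?case
    by (simp add: UN_lessThan_Suc_shift del: lessThan_Suc)
qed (auto simp: lessThan_Suc)

text \<open>Propositional glue for the next two characterisations: the intersection condition
  \<open>X\<close> can be split into pairwise conditions \<open>S1\<close> only when the rest of the
  path is already known to be an arc (\<open>R\<close>).\<close>

lemma arc_split_iff:
  "\<lbrakk>L \<longleftrightarrow> p \<and> R \<and> X; R \<longleftrightarrow> U \<and> W; R \<Longrightarrow> X \<longleftrightarrow> S1; N \<longleftrightarrow> p \<and> U; S \<longleftrightarrow> S1 \<and> W\<rbrakk>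
    \<Longrightarrow> L \<longleftrightarrow> N \<and> S"
  by blast

text \<open>Peeling off the first segment leaves the condition that it meets the rest only in
  \<open>b\<close>. Within an arc, \<open>b\<close> lies on no segment of the rest but the first
  one, so this condition splits into one condition for each segment.\<close>

lemma arc_polygonal_path_iff:
  assumes "2 \<le> length ws"
  shows "arc (polygonal_path ws) \<longleftrightarrow>
    (\<forall>i<length ws - 1. ws ! i \<noteq> ws ! Suc i) \<and>
    (\<forall>i j. i < j \<longrightarrow> j < length ws - 1 \<longrightarrow>
      closed_segment (ws ! i) (ws ! Suc i) \<inter> closed_segment (ws ! j) (ws ! Suc j)
        \<subseteq> (if j = Suc i then {ws ! j} else {}))"
  using assms
proof (induction ws rule: polygonal_path.induct)
  case (4 a b c vs)
  define ws where "ws = b # c # vs"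
  define m where "m = length ws - 1"
  define seg where "seg i = closed_segment (ws ! i) (ws ! Suc i)" for i
  define T where "T i j = (if j = Suc i then {ws ! j} else {})" for i j
  have m: "length (a # ws) - 1 = Suc m" "m = Suc (length vs)" by (auto simp: m_def ws_def)
  have IH: "arc (polygonal_path ws) \<longleftrightarrow> (\<forall>i<m. ws ! i \<noteq> ws ! Suc i) \<and>
     (\<forall>i j. i < j \<longrightarrow> j < m \<longrightarrow> seg i \<inter> seg j \<subseteq> T i j)"
    using 4 by (simp add: ws_def m_def seg_def T_def)
  have pi: "path_image (polygonal_path ws) = (\<Union>i<m. seg i)"
    by (subst path_image_polygonal_path) (auto simp: ws_def m_def seg_def)
  have A: "arc (polygonal_path (a # ws)) \<longleftrightarrow> a \<noteq> b \<and> arc (polygonal_path ws) \<and>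
      closed_segment a b \<inter> (\<Union>i<m. seg i) \<subseteq> {b}"
    by (simp add: ws_def arc_join_eq pathstart_polygonal_path arc_linepath pi[unfolded ws_def])
      (use arc_linepath arc_distinct_ends in fastforce)
  have key: "closed_segment a b \<inter> (\<Union>i<m. seg i) \<subseteq> {b} \<longleftrightarrow>
      (\<forall>j<m. closed_segment a b \<inter> seg j \<subseteq> (if j = 0 then {b} else {}))"
    if arcw: "arc (polygonal_path ws)"
  proof
    assume L: "closed_segment a b \<inter> (\<Union>i<m. seg i) \<subseteq> {b}"
    show "\<forall>j<m. closed_segment a b \<inter> seg j \<subseteq> (if j = 0 then {b} else {})"
    proof (intro allI impI)
      fix j assume j: "j < m"
      have 1: "closed_segment a b \<inter> seg j \<subseteq> {b}" using L j by blast
      have "b \<notin> seg j" if "j \<noteq> 0"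
      proof
        assume "b \<in> seg j"
        moreover have "b \<in> seg 0" by (simp add: seg_def ws_def)
        moreover have "seg 0 \<inter> seg j \<subseteq> T 0 j" using IH arcw that j by blast
        ultimately have "b \<in> T 0 j" by blast
        then have "j = 1" "b = ws ! 1" by (auto simp: T_def split: if_splits)
        moreover have "ws ! 0 \<noteq> ws ! Suc 0" using IH arcw m by blast
        ultimately show False by (simp add: ws_def)
      qed
      with 1 show "closed_segment a b \<inter> seg j \<subseteq> (if j = 0 then {b} else {})" by auto
    qed
  next
    assume R: "\<forall>j<m. closed_segment a b \<inter> seg j \<subseteq> (if j = 0 then {b} else {})"
    show "closed_segment a b \<inter> (\<Union>i<m. seg i) \<subseteq> {b}"
    proof clarify
      fix x j assume "x \<in> closed_segment a b" "j < m" "x \<in> seg j"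
      then have "x \<in> (if j = 0 then {b} else {})" using R by blast
      then show "x = b" by (auto split: if_splits)
    qed
  qed
  have "arc (polygonal_path (a # ws)) \<longleftrightarrow> (\<forall>i<Suc m. (a # ws) ! i \<noteq> (a # ws) ! Suc i) \<and>
    (\<forall>i j. i < j \<longrightarrow> j < Suc m \<longrightarrow>
      closed_segment ((a # ws) ! i) ((a # ws) ! Suc i) \<inter> closed_segment ((a # ws) ! j) ((a # ws) ! Suc j)
        \<subseteq> (if j = Suc i then {(a # ws) ! j} else {}))" (is "_ \<longleftrightarrow> ?N \<and> ?S")
  proof -
    have N: "?N \<longleftrightarrow> a \<noteq> b \<and> (\<forall>i<m. ws ! i \<noteq> ws ! Suc i)"
      by (subst All_less_Suc2) (simp add: ws_def)
    have S: "?S \<longleftrightarrow> (\<forall>j<m. closed_segment a b \<inter> seg j \<subseteq> (if j = 0 then {b} else {})) \<and>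
        (\<forall>i j. i < j \<longrightarrow> j < m \<longrightarrow> seg i \<inter> seg j \<subseteq> T i j)" (is "_ \<longleftrightarrow> ?S1 \<and> ?S2")
    proof
      assume S: ?S
      have ?S1
      proof (intro allI impI)
        fix j assume "j < m"
        then show "closed_segment a b \<inter> seg j \<subseteq> (if j = 0 then {b} else {})"
          using S[rule_format, of 0 "Suc j"] by (auto simp: ws_def seg_def split: if_splits)
      qed
      moreover have ?S2
      proof (intro allI impI)
        fix i j assume "i < j" "j < m"
        then show "seg i \<inter> seg j \<subseteq> T i j"
          using S[rule_format, of "Suc i" "Suc j"] by (auto simp add: seg_def T_def split: if_splits)
      qed
      ultimately show "?S1 \<and> ?S2" by blast
    next
      assume S: "?S1 \<and> ?S2"
      show ?S
      proof (intro allI impI)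
        fix i j assume ij: "i < j" "j < Suc m"
        then obtain j' where j': "j = Suc j'" "j' < m" by (cases j) auto
        show "closed_segment ((a # ws) ! i) ((a # ws) ! Suc i) \<inter>
           closed_segment ((a # ws) ! j) ((a # ws) ! Suc j)
        \<subseteq> (if j = Suc i then {(a # ws) ! j} else {})"
        proof (cases i)
          case 0
          have "closed_segment a b \<inter> seg j' \<subseteq> (if j' = 0 then {b} else {})"
            using S j' by blast
          then show ?thesis using 0 j' by (auto simp: ws_def seg_def split: if_splits)
        next
          case (Suc i')
          then have "seg i' \<inter> seg j' \<subseteq> T i' j'" using S j' ij by auto
          then show ?thesis using Suc j' by (auto simp add: T_def seg_def split: if_splits)
        qed
      qed
    qed
    show ?thesis by (rule arc_split_iff[OF A IH key N S])
  qed
  then show ?case using m by (simp only: ws_def)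
next
  case (3 a b)
  then show ?case using arc_linepath[of a b] arc_distinct_ends[of "linepath a b"] by auto
qed auto

text \<open>Simplicity in periodic indices, without a distinguished first edge, so that it is
  visibly stable under rotation and reversal. The range of \<open>k\<close> describes exactly the
  pairs of sides that are neither equal nor cyclically adjacent.\<close>

definition simple_polygon :: "complex list \<Rightarrow> bool" where
  "simple_polygon vs \<longleftrightarrow> (\<forall>i. vert vs i \<noteq> vert vs (Suc i) \<and>
     side vs i \<inter> side vs (Suc i) = {vert vs (Suc i)} \<and>
     (\<forall>k. 2 \<le> k \<longrightarrow> k + 2 \<le> length vs \<longrightarrow> side vs i \<inter> side vs (i + k) = {}))"

text \<open>A closed path is its first segment followed by an arc from \<open>b\<close> back to
  \<open>a\<close>; the segment may meet the arc in both end points. Compared with arcs, this adds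
  the one exceptional pair formed by the first and the closing segment.\<close>

lemma simple_loop_iff:
  assumes "4 \<le> length ws" "hd ws = last ws"
  shows "simple_path (polygonal_path ws) \<longleftrightarrow>
    (\<forall>i<length ws - 1. ws ! i \<noteq> ws ! Suc i) \<and>
    (\<forall>i j. i < j \<longrightarrow> j < length ws - 1 \<longrightarrow>
      closed_segment (ws ! i) (ws ! Suc i) \<inter> closed_segment (ws ! j) (ws ! Suc j)
        \<subseteq> (if j = Suc i then {ws ! j} else if i = 0 \<and> j = length ws - 2 then {ws ! 0} else {}))"
proof -
  obtain a b c d us where ws0: "ws = a # b # c # d # us"
    using assms(1) by (auto simp: numeral_eq_Suc Suc_le_length_iff)
  define vs where "vs = b # c # d # us"
  have ws: "ws = a # vs" by (simp add: ws0 vs_def)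
  define m where "m = length vs - 1"
  have m: "length ws - 1 = Suc m" "m = Suc (Suc (length us))" by (auto simp: m_def ws vs_def)
  define seg where "seg i = closed_segment (vs ! i) (vs ! Suc i)" for i
  define T where "T i j = (if j = Suc i then {vs ! j} else {})" for i j
  have la: "last vs = a" using assms(2) by (simp add: ws vs_def)
  have am: "vs ! m = a"
    using la by (metis last_conv_nth m_def list.distinct(1) vs_def)
  have IH: "arc (polygonal_path vs) \<longleftrightarrow> (\<forall>i<m. vs ! i \<noteq> vs ! Suc i) \<and>
     (\<forall>i j. i < j \<longrightarrow> j < m \<longrightarrow> seg i \<inter> seg j \<subseteq> T i j)"
    by (subst arc_polygonal_path_iff) (auto simp add: vs_def m_def seg_def T_def)
  have pi: "path_image (polygonal_path vs) = (\<Union>i<m. seg i)"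
    by (subst path_image_polygonal_path) (auto simp: vs_def m_def seg_def)
  have st: "pathstart (polygonal_path vs) = b" "pathfinish (polygonal_path vs) = a"
    using la by (auto simp: pathstart_polygonal_path pathfinish_polygonal_path vs_def)
  have "polygonal_path ws = linepath a b +++ polygonal_path vs" by (simp add: ws vs_def)
  then have A: "simple_path (polygonal_path ws) \<longleftrightarrow> a \<noteq> b \<and> arc (polygonal_path vs) \<and>
      closed_segment a b \<inter> (\<Union>i<m. seg i) \<subseteq> {a, b}"
    using arc_linepath[of a b] arc_distinct_ends[of "linepath a b"]
    by (auto simp add: simple_path_join_loop_eq st pi)
  have key: "closed_segment a b \<inter> (\<Union>i<m. seg i) \<subseteq> {a, b} \<longleftrightarrow>
      (\<forall>j<m. closed_segment a b \<inter> seg j \<subseteq> (if j = 0 then {b} else if j = m - 1 then {a} else {}))"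
    if arcw: "arc (polygonal_path vs)"
  proof
    assume L: "closed_segment a b \<inter> (\<Union>i<m. seg i) \<subseteq> {a, b}"
    show "\<forall>j<m. closed_segment a b \<inter> seg j \<subseteq> (if j = 0 then {b} else if j = m - 1 then {a} else {})"
    proof (intro allI impI)
      fix j assume j: "j < m"
      have 1: "closed_segment a b \<inter> seg j \<subseteq> {a, b}" using L j by blast
      have "b \<notin> seg j" if "j \<noteq> 0"
      proof
        assume "b \<in> seg j"
        moreover have "b \<in> seg 0" by (simp add: seg_def vs_def)
        moreover have "seg 0 \<inter> seg j \<subseteq> T 0 j" using IH arcw that j by blast
        ultimately have "b \<in> T 0 j" by blast
        then have "j = 1" "b = vs ! 1" by (auto simp: T_def split: if_splits)
        moreover have "vs ! 0 \<noteq> vs ! Suc 0" using IH arcw m by blast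
        ultimately show False by (simp add: vs_def)
      qed
      moreover have "a \<notin> seg j" if "j \<noteq> m - 1"
      proof
        assume "a \<in> seg j"
        moreover have "Suc (m - 1) = m" using m by simp
        then have "a \<in> seg (m - 1)" using am by (simp add: seg_def)
        moreover have "seg j \<inter> seg (m - 1) \<subseteq> T j (m - 1)" using IH arcw that j by auto
        ultimately have "a \<in> T j (m - 1)" by blast
        then have "a = vs ! (m - 1)" by (auto simp: T_def split: if_splits)
        moreover have "vs ! (m - 1) \<noteq> vs ! Suc (m - 1)" using IH arcw m by simp
        ultimately show False using am m by simp
      qed
      ultimately
      show "closed_segment a b \<inter> seg j \<subseteq> (if j = 0 then {b} else if j = m - 1 then {a} else {})"
        using 1 m by auto
    qed
  next
    assume R: "\<forall>j<m. closed_segment a b \<inter> seg j \<subseteq> (if j = 0 then {b} else if j = m - 1 then {a} else {})"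
    show "closed_segment a b \<inter> (\<Union>i<m. seg i) \<subseteq> {a, b}"
    proof
      fix x assume "x \<in> closed_segment a b \<inter> (\<Union>i<m. seg i)"
      then obtain j where "x \<in> closed_segment a b" "j < m" "x \<in> seg j" by blast
      then have "x \<in> (if j = 0 then {b} else if j = m - 1 then {a} else {})" using R by blast
      then show "x \<in> {a, b}" by (auto split: if_splits)
    qed
  qed
  have "simple_path (polygonal_path ws) \<longleftrightarrow> (\<forall>i<Suc m. ws ! i \<noteq> ws ! Suc i) \<and>
    (\<forall>i j. i < j \<longrightarrow> j < Suc m \<longrightarrow>
      closed_segment (ws ! i) (ws ! Suc i) \<inter> closed_segment (ws ! j) (ws ! Suc j)
        \<subseteq> (if j = Suc i then {ws ! j} else if i = 0 \<and> j = m then {ws ! 0} else {}))" (is "_ \<longleftrightarrow> ?N \<and> ?S")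
  proof -
    have N: "?N \<longleftrightarrow> a \<noteq> b \<and> (\<forall>i<m. vs ! i \<noteq> vs ! Suc i)"
      by (subst All_less_Suc2) (simp add: vs_def ws)
    have S: "?S \<longleftrightarrow> (\<forall>j<m. closed_segment a b \<inter> seg j \<subseteq> (if j = 0 then {b} else if j = m - 1 then {a} else {})) \<and>
        (\<forall>i j. i < j \<longrightarrow> j < m \<longrightarrow> seg i \<inter> seg j \<subseteq> T i j)" (is "_ \<longleftrightarrow> ?S1 \<and> ?S2")
    proof
      assume S: ?S
      have ?S1
      proof (intro allI impI)
        fix j assume j: "j < m"
        have e: "(Suc j = m) = (j = m - 1)" using m by auto
        show "closed_segment a b \<inter> seg j \<subseteq> (if j = 0 then {b} else if j = m - 1 then {a} else {})"
          using S[rule_format, of 0 "Suc j"] j e by (auto simp: ws vs_def seg_def split: if_splits)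
      qed
      moreover have ?S2
      proof (intro allI impI)
        fix i j assume "i < j" "j < m"
        then show "seg i \<inter> seg j \<subseteq> T i j"
          using S[rule_format, of "Suc i" "Suc j"] by (auto simp add: seg_def T_def ws split: if_splits)
      qed
      ultimately show "?S1 \<and> ?S2" by blast
    next
      assume S: "?S1 \<and> ?S2"
      show ?S
      proof (intro allI impI)
        fix i j assume ij: "i < j" "j < Suc m"
        then obtain j' where j': "j = Suc j'" "j' < m" by (cases j) auto
        show "closed_segment (ws ! i) (ws ! Suc i) \<inter> closed_segment (ws ! j) (ws ! Suc j)
        \<subseteq> (if j = Suc i then {ws ! j} else if i = 0 \<and> j = m then {ws ! 0} else {})"
        proof (cases i)
          case 0
          have "closed_segment a b \<inter> seg j' \<subseteq> (if j' = 0 then {b} else if j' = m - 1 then {a} else {})"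
            using S j' by blast
          then show ?thesis using 0 j' m by (auto simp: ws vs_def seg_def split: if_splits)
        next
          case (Suc i')
          then have "seg i' \<inter> seg j' \<subseteq> T i' j'" using S j' ij by auto
          then show ?thesis using Suc j' by (auto simp add: T_def seg_def ws split: if_splits)
        qed
      qed
    qed
    show ?thesis by (rule arc_split_iff[OF A IH key N S])
  qed
  moreover have "length ws - 2 = m" using m by linarith
  ultimately show ?thesis using m by simp
qed

lemma vert_mod [simp]: "vert vs (i mod length vs) = vert vs i"
  by (simp add: vert_def)

lemma vert_add_length [simp]: "vert vs (i + length vs) = vert vs i"
  by (simp add: vert_def)

lemma vert_Suc_mod [simp]: "vert vs (Suc (i mod length vs)) = vert vs (Suc i)"
  by (simp add: vert_def mod_Suc_eq)

lemma side_mod [simp]: "side vs (i mod length vs) = side vs i"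
  by (simp add: side_def)

lemma nth_boundary:
  assumes "vs \<noteq> []" "i \<le> length vs"
  shows "(vs @ [hd vs]) ! i = vert vs i"
  using assms by (cases "i = length vs") (auto simp: vert_def nth_append hd_conv_nth)

lemma path_image_boundary_path:
  assumes "vs \<noteq> []"
  shows "path_image (boundary_path vs) = (\<Union>i<length vs. side vs i)"
proof -
  have "(\<Union>i<length vs. closed_segment ((vs @ [hd vs]) ! i) ((vs @ [hd vs]) ! Suc i)) =
      (\<Union>i<length vs. side vs i)"
    by (intro SUP_cong) (use assms in \<open>auto simp: side_def nth_boundary Suc_le_eq\<close>)
  moreover have "2 \<le> length (vs @ [hd vs])" using assms by (cases vs) auto
  ultimately show ?thesis
    unfolding boundary_path_def using path_image_polygonal_path[of "vs @ [hd vs]"] by simp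
qed

lemma simple_path_boundary_path:
  assumes n: "3 \<le> length vs"
  shows "simple_path (boundary_path vs) \<longleftrightarrow> simple_polygon vs"
proof -
  define n where "n = length vs"
  define ws where "ws = vs @ [hd vs]"
  have ne: "vs \<noteq> []" using assms by auto
  have len: "length ws - 1 = n" "length ws - 2 = n - 1" "length ws = Suc n" by (auto simp: ws_def n_def)
  have nth: "ws ! i = vert vs i" if "i \<le> n" for i
    using that ne by (simp add: ws_def n_def nth_boundary)
  have seg: "closed_segment (ws ! i) (ws ! Suc i) = side vs i" if "i < n" for i
    using that by (simp add: nth side_def)
  define T where "T i j = (if j = Suc i then {vert vs j} else if i = 0 \<and> j = n - 1 then {vert vs 0} else {})" for i j
  have "simple_path (boundary_path vs) \<longleftrightarrow> (\<forall>i<n. ws ! i \<noteq> ws ! Suc i) \<and>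
    (\<forall>i j. i < j \<longrightarrow> j < n \<longrightarrow>
      closed_segment (ws ! i) (ws ! Suc i) \<inter> closed_segment (ws ! j) (ws ! Suc j)
        \<subseteq> (if j = Suc i then {ws ! j} else if i = 0 \<and> j = n - 1 then {ws ! 0} else {}))"
    unfolding boundary_path_def ws_def[symmetric]
    by (subst simple_loop_iff) (use assms ne len in \<open>auto simp: ws_def\<close>)
  also have "\<dots> \<longleftrightarrow> (\<forall>i<n. vert vs i \<noteq> vert vs (Suc i)) \<and>
      (\<forall>i j. i < j \<longrightarrow> j < n \<longrightarrow> side vs i \<inter> side vs j \<subseteq> T i j)"
    using nth seg by (auto simp: T_def)
  also have "\<dots> \<longleftrightarrow> simple_polygon vs"
  proof
    assume L: "(\<forall>i<n. vert vs i \<noteq> vert vs (Suc i)) \<and>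
      (\<forall>i j. i < j \<longrightarrow> j < n \<longrightarrow> side vs i \<inter> side vs j \<subseteq> T i j)"
    show "simple_polygon vs"
      unfolding simple_polygon_def
    proof (intro allI conjI impI)
      fix i
      have im: "i mod n < n" using n unfolding n_def by (intro mod_less_divisor) linarith
      have "vert vs (i mod n) \<noteq> vert vs (Suc (i mod n))" using L im by blast
      then show "vert vs i \<noteq> vert vs (Suc i)" by (simp add: n_def)
      have "side vs (i mod n) \<inter> side vs (Suc (i mod n)) \<subseteq> {vert vs (Suc (i mod n))}"
      proof (cases "Suc (i mod n) < n")
        case True
        then have "side vs (i mod n) \<inter> side vs (Suc (i mod n)) \<subseteq> T (i mod n) (Suc (i mod n))"
          using L by blast
        then show ?thesis by (simp add: T_def)
      next
        case False
        then have eq: "Suc (i mod n) = n" using im by linarith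
        then have "i mod n = n - 1" by linarith
        moreover have "side vs 0 \<inter> side vs (n - 1) \<subseteq> T 0 (n - 1)" using L n by (auto simp: n_def)
        then have "side vs 0 \<inter> side vs (n - 1) \<subseteq> {vert vs 0}" using n by (auto simp: T_def n_def split: if_splits)
        moreover have "side vs n = side vs 0" "vert vs n = vert vs 0"
          using side_mod[of vs n] vert_mod[of vs n] by (simp_all add: n_def)
        ultimately show ?thesis using eq by (auto simp: Int_commute)
      qed
      moreover have "vert vs (Suc (i mod n)) \<in> side vs (i mod n) \<inter> side vs (Suc (i mod n))"
        by (simp add: side_def)
      moreover have "side vs (Suc (i mod n)) = side vs (Suc i)"
        by (metis n_def mod_Suc_eq side_mod)
      ultimately show "side vs i \<inter> side vs (Suc i) = {vert vs (Suc i)}"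
        by (auto simp: n_def)
    next
      fix i k assume k: "2 \<le> k" "k + 2 \<le> length vs"
      have im: "i mod n < n" using n unfolding n_def by (intro mod_less_divisor) linarith
      have "side vs (i mod n) \<inter> side vs (i mod n + k) = {}"
      proof (cases "i mod n + k < n")
        case True
        then have "side vs (i mod n) \<inter> side vs (i mod n + k) \<subseteq> T (i mod n) (i mod n + k)"
          using L k by auto
        also have "T (i mod n) (i mod n + k) = {}" using k n by (auto simp: T_def n_def)
        finally show ?thesis by blast
      next
        case False
        \<comment> \<open>The second index wraps around, so the pair is read in the opposite order.
          Here \<open>k + 2 \<le> n\<close> excludes adjacent sides and \<open>2 \<le> k\<close>
          excludes the closing pair.\<close>
        define j where "j = i mod n + k - n"
        have j: "j < i mod n" "i mod n + k = j + n" using False k im by (auto simp: j_def n_def)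
        have "side vs j \<inter> side vs (i mod n) \<subseteq> T j (i mod n)"
          using L j im by auto
        also have "T j (i mod n) = {}" using k n im j by (auto simp: T_def n_def)
        finally show ?thesis using j side_mod[of vs "j + n"] side_mod[of vs j] by (auto simp: n_def)
      qed
      moreover have "side vs (i mod n + k) = side vs (i + k)"
        by (metis n_def mod_add_left_eq side_mod)
      ultimately show "side vs i \<inter> side vs (i + k) = {}" by (simp add: n_def)
    qed
  next
    assume R: "simple_polygon vs"
    show "(\<forall>i<n. vert vs i \<noteq> vert vs (Suc i)) \<and>
      (\<forall>i j. i < j \<longrightarrow> j < n \<longrightarrow> side vs i \<inter> side vs j \<subseteq> T i j)"
    proof (intro conjI allI impI)
      fix i j assume ij: "i < j" "j < n"
      consider "j = Suc i" | "i = 0" "j = n - 1" "j \<noteq> Suc i" | "i + 2 \<le> j" "j + 2 \<le> n + i" using ij by linarith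
      then show "side vs i \<inter> side vs j \<subseteq> T i j"
      proof cases
        case 1 then show ?thesis using R by (simp add: simple_polygon_def T_def)
      next
        case 2
        have "side vs (n - 1) \<inter> side vs (Suc (n - 1)) = {vert vs (Suc (n - 1))}"
          using R by (simp add: simple_polygon_def)
        moreover have "Suc (n - 1) = n" using n by (simp add: n_def)
        moreover have "side vs n = side vs 0" "vert vs n = vert vs 0"
          using side_mod[of vs n] vert_mod[of vs n] by (simp_all add: n_def)
        ultimately show ?thesis using 2 by (auto simp: T_def)
      next
        case 3
        then have "side vs i \<inter> side vs (i + (j - i)) = {}"
          using R unfolding simple_polygon_def n_def by (metis (no_types, lifting) Nat.add_diff_assoc2 add.commute diff_le_mono le_add_diff_inverse nat_le_linear diff_add_inverse ij(1) less_imp_le le_diff_conv)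
        then show ?thesis using 3 by auto
      qed
    qed (use R in \<open>simp add: simple_polygon_def\<close>)
  qed
  finally show ?thesis .
qed

section \<open>Rotations, reversals and isometric images of polygons\<close>

lemma path_image_boundary_path_UN:
  assumes "vs \<noteq> []"
  shows "path_image (boundary_path vs) = (\<Union>i. side vs i)"
proof -
  have "(\<Union>i<length vs. side vs i) = (\<Union>i. side vs i)"
  proof (intro equalityI UN_least)
    fix i
    have "side vs (i mod length vs) \<subseteq> (\<Union>i<length vs. side vs i)"
      using assms by (intro UN_upper) auto
    then show "side vs i \<subseteq> (\<Union>i<length vs. side vs i)" by simp
  qed auto
  with assms show ?thesis by (simp add: path_image_boundary_path)
qed

text \<open>Passes from triples centred at \<open>i\<close> to triples starting at \<open>i\<close>.
  In natural numbers the predecessor of \<open>i\<close> is written \<open>i + n - 1\<close>, which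
  also covers \<open>i = 0\<close>.\<close>

lemma all_vert_iff:
  assumes "0 < length vs"
  shows "(\<forall>i<length vs. Q (vert vs (i + length vs - 1)) (vert vs i) (vert vs (Suc i))) \<longleftrightarrow>
    (\<forall>i. Q (vert vs i) (vert vs (Suc i)) (vert vs (Suc (Suc i))))" (is "?L \<longleftrightarrow> ?R")
proof
  assume L: ?L
  show ?R
  proof
    fix i
    define j where "j = Suc i mod length vs"
    have j: "j < length vs" using assms by (simp add: j_def)
    have "(j + length vs - 1) mod length vs = i mod length vs"
    proof -
      have "j + length vs - 1 = j + (length vs - 1)" using assms by linarith
      then have "(j + length vs - 1) mod length vs = (j + (length vs - 1)) mod length vs" by simp
      also have "\<dots> = (Suc i + (length vs - 1)) mod length vs" by (simp add: j_def mod_add_left_eq)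
      also have "Suc i + (length vs - 1) = i + length vs" using assms by simp
      finally show ?thesis by simp
    qed
    then have "vert vs (j + length vs - 1) = vert vs i" by (metis vert_mod)
    moreover have "vert vs j = vert vs (Suc i)" "vert vs (Suc j) = vert vs (Suc (Suc i))"
      by (simp_all add: j_def)
    ultimately show "Q (vert vs i) (vert vs (Suc i)) (vert vs (Suc (Suc i)))"
      using L[rule_format, OF j] by simp
  qed
next
  assume R: ?R
  show ?L
  proof (intro allI impI)
    fix i assume "i < length vs"
    have "Suc (i + length vs - 1) = i + length vs" using assms by simp
    then show "Q (vert vs (i + length vs - 1)) (vert vs i) (vert vs (Suc i))"
      using R[rule_format, of "i + length vs - 1"] vert_add_length[of vs "Suc i"] by simp
  qed
qed

lemma prev_vertex_vert: "prev_vertex vs i = vert vs (i + length vs - 1)"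
  by (simp add: prev_vertex_def vert_def)

lemma next_vertex_vert: "next_vertex vs i = vert vs (Suc i)"
  by (simp add: next_vertex_def vert_def)

lemma nth_vert: "i < length vs \<Longrightarrow> vs ! i = vert vs i"
  by (simp add: vert_def)

lemma polygon_vertices_iff:
  "polygon_vertices P vs \<longleftrightarrow> 3 \<le> length vs \<and> simple_polygon vs \<and>
    (\<forall>i. \<not> collinear {vert vs i, vert vs (Suc i), vert vs (Suc (Suc i))}) \<and> P = region vs"
proof (cases "3 \<le> length vs")
  case True
  then have "0 < length vs" by linarith
  then have "(\<forall>i<length vs. \<not> collinear {prev_vertex vs i, vs ! i, next_vertex vs i}) \<longleftrightarrow>
      (\<forall>i. \<not> collinear {vert vs i, vert vs (Suc i), vert vs (Suc (Suc i))})"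
    using all_vert_iff[of vs "\<lambda>a b c. \<not> collinear {a, b, c}"]
    by (simp add: prev_vertex_vert next_vertex_vert nth_vert cong: conj_cong)
  with True show ?thesis by (auto simp: polygon_vertices_def simple_path_boundary_path)
qed (simp add: polygon_vertices_def)

lemma region_cong:
  assumes "vs \<noteq> []" "ws \<noteq> []" "(\<Union>i. side vs i) = (\<Union>i. side ws i)"
  shows "region vs = region ws"
  using assms by (simp add: region_def path_image_boundary_path_UN)

lemma vert_rotate: "vs \<noteq> [] \<Longrightarrow> vert (rotate m vs) i = vert vs (i + m)"
  by (simp add: vert_def nth_rotate mod_add_right_eq add.commute)

lemma polygon_vertices_rotate:
  assumes "polygon_vertices P vs"
  shows "polygon_vertices P (rotate m vs)"
proof -
  have ne: "vs \<noteq> []" using assms by (auto simp: polygon_vertices_def)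
  have v: "vert (rotate m vs) i = vert vs (i + m)" for i using ne by (rule vert_rotate)
  have s: "side (rotate m vs) i = side vs (i + m)" for i by (simp add: side_def v)
  have "(\<Union>i. side (rotate m vs) i) = (\<Union>i. side vs i)"
  proof (intro equalityI UN_least)
    fix i
    \<comment> \<open>A multiple of the period that is at least \<open>m\<close> allows the shift by
      \<open>m\<close> to be undone without a negative index.\<close>
    obtain k where k: "m \<le> k * length vs"
      using ne by (metis One_nat_def Suc_leI length_greater_0_conv mult.right_neutral mult_le_mono2)
    have "side vs (i + (k * length vs - m) + m) = side vs (i + k * length vs)" using k by simp
    also have "\<dots> = side vs i" by (metis mod_mult_self1 mult.commute side_mod)
    finally have "side vs i = side (rotate m vs) (i + (k * length vs - m))" by (simp add: s)
    then show "side vs i \<subseteq> (\<Union>i. side (rotate m vs) i)" by blast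
  qed (auto simp: s)
  then have "region (rotate m vs) = region vs" using ne by (intro region_cong) auto
  then show ?thesis
    using assms unfolding polygon_vertices_iff simple_polygon_def
    by (simp add: v s) (metis add.assoc add.commute)
qed

lemma ex_add_dvd: "0 < n \<Longrightarrow> \<exists>j. n dvd m + (j::nat)"
proof
  assume "0 < n"
  then have "m + m * (n - 1) = m * n" by (cases n) auto
  then show "n dvd m + m * (n - 1)" by simp
qed

text \<open>Divisibility of \<open>i + j + 1\<close> expresses that \<open>i\<close> and
  \<open>j\<close> correspond under reversal, for all indices and without subtraction. For the
  residues the sum plus one is a positive multiple of the length below twice the length, hence the
  length itself.\<close>

lemma vert_rev:
  assumes "vs \<noteq> []" "length vs dvd Suc (i + j)"
  shows "vert (rev vs) i = vert vs j"
proof -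
  let ?n = "length vs"
  have n: "0 < ?n" using assms by simp
  have "Suc (i mod ?n + j mod ?n) mod ?n = Suc (i + j) mod ?n"
    by (metis mod_Suc_eq mod_add_eq)
  then have "?n dvd Suc (i mod ?n + j mod ?n)" using assms(2) unfolding dvd_eq_mod_eq_0 by (rule trans)
  moreover have "i mod ?n < ?n" "j mod ?n < ?n" using n by auto
  ultimately obtain k where k: "Suc (i mod ?n + j mod ?n) = ?n * k" "i mod ?n < ?n" "j mod ?n < ?n"
    by (auto elim: dvdE)
  have "0 < ?n * k" using k(1) by linarith
  moreover have "Suc (i mod ?n + j mod ?n) < ?n + ?n" using k(2,3) by linarith
  then have "?n * k < ?n * 2" unfolding k(1) by (simp add: mult_2_right)
  ultimately have "k = 1" by simp
  then have "Suc (i mod ?n + j mod ?n) = ?n" using k by simp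
  then have "j mod ?n = ?n - Suc (i mod ?n)" by linarith
  then show ?thesis using n by (simp add: vert_def rev_nth)
qed

lemma polygon_vertices_rev:
  assumes "polygon_vertices P vs"
  shows "polygon_vertices P (rev vs)"
proof -
  have ne: "vs \<noteq> []" and n: "0 < length vs" using assms by (auto simp: polygon_vertices_def)
  have v: "vert (rev vs) i = vert vs j" if "length vs dvd Suc (i + j)" for i j
    using ne that by (rule vert_rev)
  \<comment> \<open>A side is indexed by its initial vertex, which reversal turns into the final
    one; hence one more \<open>Suc\<close> than for vertices.\<close>
  have s: "side (rev vs) i = side vs j" if "length vs dvd Suc (Suc (i + j))" for i j
    using that v[of i "Suc j"] v[of "Suc i" j] by (simp add: side_def closed_segment_commute)
  have sp: "simple_polygon vs" using assms by (simp add: polygon_vertices_iff)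
  have "simple_polygon (rev vs)"
    unfolding simple_polygon_def
  proof (intro allI conjI impI)
    fix i
    obtain j where j: "length vs dvd Suc (Suc i) + j" using ex_add_dvd n by blast
    then have "vert (rev vs) i = vert vs (Suc j)" "vert (rev vs) (Suc i) = vert vs j"
      by (simp_all add: v)
    then show "vert (rev vs) i \<noteq> vert (rev vs) (Suc i)"
      using sp unfolding simple_polygon_def by metis
    obtain j where j: "length vs dvd Suc (Suc (Suc i)) + j" using ex_add_dvd n by blast
    then have "side (rev vs) i = side vs (Suc j)" "side (rev vs) (Suc i) = side vs j"
       "vert (rev vs) (Suc i) = vert vs (Suc j)"
      by (simp_all add: v s)
    then show "side (rev vs) i \<inter> side (rev vs) (Suc i) = {vert (rev vs) (Suc i)}"
      using sp unfolding simple_polygon_def by (metis Int_commute)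
  next
    fix i k assume k: "2 \<le> k" "k + 2 \<le> length (rev vs)"
    obtain j where j: "length vs dvd Suc (Suc (i + k)) + j" using ex_add_dvd n by blast
    then have "side (rev vs) i = side vs (j + k)" "side (rev vs) (i + k) = side vs j"
      by (simp_all add: s ac_simps)
    then show "side (rev vs) i \<inter> side (rev vs) (i + k) = {}"
      using sp k unfolding simple_polygon_def by (metis Int_commute length_rev)
  qed
  moreover have "\<not> collinear {vert (rev vs) i, vert (rev vs) (Suc i), vert (rev vs) (Suc (Suc i))}" for i
  proof -
    obtain j where j: "length vs dvd Suc (Suc (Suc i)) + j" using ex_add_dvd n by blast
    then have "vert (rev vs) i = vert vs (Suc (Suc j))" "vert (rev vs) (Suc i) = vert vs (Suc j)"
       "vert (rev vs) (Suc (Suc i)) = vert vs j"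
      by (simp_all add: v)
    then show ?thesis using assms by (simp add: polygon_vertices_iff insert_commute)
  qed
  moreover have "(\<Union>i. side (rev vs) i) = (\<Union>i. side vs i)"
  proof (intro equalityI UN_least)
    fix i
    obtain j where j: "length vs dvd Suc (Suc i) + j" using ex_add_dvd n by blast
    then have "side (rev vs) i = side vs j" by (simp add: s)
    then show "side (rev vs) i \<subseteq> (\<Union>i. side vs i)" by blast
    have "side (rev vs) j = side vs i" using j by (intro s) (simp add: ac_simps)
    then show "side vs i \<subseteq> (\<Union>i. side (rev vs) i)" by blast
  qed
  then have "region (rev vs) = region vs" using ne by (intro region_cong) auto
  ultimately show ?thesis using assms by (simp add: polygon_vertices_iff)
qed

text \<open>The explicit form covers motions with and without change of orientation; compositions
  and inverses stay in this form by direct computation.\<close>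

definition plane_isometry :: "(complex \<Rightarrow> complex) \<Rightarrow> bool" where
  "plane_isometry f \<longleftrightarrow>
    (\<exists>A B. norm B = 1 \<and> (f = (\<lambda>z. A + B * z) \<or> f = (\<lambda>z. A + B * cnj z)))"

lemma plane_isometry_linear:
  assumes "plane_isometry f"
  obtains A g where "f = (\<lambda>z. A + g z)" "linear g" "\<And>z. norm (g z) = norm z"
proof -
  obtain A B where B: "norm B = 1" "f = (\<lambda>z. A + B * z) \<or> f = (\<lambda>z. A + B * cnj z)"
    using assms by (auto simp: plane_isometry_def)
  have "linear (\<lambda>z. B * z)" "linear (\<lambda>z. B * cnj z)"
    by (auto intro!: linearI simp: algebra_simps)
  moreover have "norm (B * z) = norm z" "norm (B * cnj z) = norm z" for z
    using B by (simp_all add: norm_mult)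
  ultimately show thesis
    using B(2) that[of A "\<lambda>z. B * z"] that[of A "\<lambda>z. B * cnj z"] by blast
qed

lemma plane_isometry_dist:
  assumes "plane_isometry f" shows "dist (f x) (f y) = dist x y"
proof -
  obtain A g where g: "f = (\<lambda>z. A + g z)" "linear g" "\<And>z. norm (g z) = norm z"
    using plane_isometry_linear[OF assms] by blast
  then have "f x - f y = g (x - y)" by (simp add: linear_diff)
  then show ?thesis by (metis dist_norm g(3))
qed

lemma plane_isometry_inj: "plane_isometry f \<Longrightarrow> inj f"
  by (metis injI dist_eq_0_iff plane_isometry_dist)

lemma plane_isometry_id: "plane_isometry (\<lambda>z. z)"
  unfolding plane_isometry_def by (rule exI[of _ 0], rule exI[of _ 1]) auto

lemma plane_isometry_comp:
  assumes "plane_isometry f" "plane_isometry g"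
  shows "plane_isometry (f \<circ> g)"
proof -
  obtain A B where B: "norm B = 1" "f = (\<lambda>z. A + B * z) \<or> f = (\<lambda>z. A + B * cnj z)"
    using assms by (auto simp: plane_isometry_def)
  obtain C D where D: "norm D = 1" "g = (\<lambda>z. C + D * z) \<or> g = (\<lambda>z. C + D * cnj z)"
    using assms by (auto simp: plane_isometry_def)
  from B(2) show ?thesis
  proof
    assume "f = (\<lambda>z. A + B * z)"
    with B D show ?thesis unfolding plane_isometry_def
      by (intro exI[of _ "A + B * C"] exI[of _ "B * D"]) (auto simp: norm_mult algebra_simps)
  next
    assume "f = (\<lambda>z. A + B * cnj z)"
    with B D show ?thesis unfolding plane_isometry_def
      by (intro exI[of _ "A + B * cnj C"] exI[of _ "B * cnj D"]) (auto simp: norm_mult algebra_simps)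
  qed
qed

lemma plane_isometry_inverse:
  assumes "plane_isometry f"
  obtains g where "plane_isometry g" "\<And>x. g (f x) = x" "\<And>x. f (g x) = x"
proof -
  obtain A B where B: "norm B = 1" "f = (\<lambda>z. A + B * z) \<or> f = (\<lambda>z. A + B * cnj z)"
    using assms by (auto simp: plane_isometry_def)
  have BB: "B * cnj B = 1" "cnj B * B = 1" using B(1) by (simp_all add: complex_norm_square[symmetric] mult.commute)
  from B(2) show thesis
  proof
    assume f: "f = (\<lambda>z. A + B * z)"
    have "plane_isometry (\<lambda>z. - cnj B * A + cnj B * z)"
      unfolding plane_isometry_def by (rule exI[of _ "- cnj B * A"], rule exI[of _ "cnj B"]) (use B in auto)
    moreover have "- cnj B * A + cnj B * f z = z" "f (- cnj B * A + cnj B * z) = z" for z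
      using BB by (simp_all add: f ring_distribs BB flip: mult.assoc)
    ultimately show thesis using that by blast
  next
    assume f: "f = (\<lambda>z. A + B * cnj z)"
    have "plane_isometry (\<lambda>z. - B * cnj A + B * cnj z)"
      unfolding plane_isometry_def by (rule exI[of _ "- B * cnj A"], rule exI[of _ B]) (use B in auto)
    moreover have "- B * cnj A + B * cnj (f z) = z" "f (- B * cnj A + B * cnj z) = z" for z
      using BB by (simp_all add: f ring_distribs BB flip: mult.assoc)
    ultimately show thesis using that by blast
  qed
qed

lemma plane_isometry_continuous: "plane_isometry f \<Longrightarrow> continuous_on S f"
  unfolding plane_isometry_def by (auto intro!: continuous_intros)

lemma plane_isometry_bounded:
  assumes "plane_isometry f" "bounded S"
  shows "bounded (f ` S)"
proof -
  obtain x e where "\<forall>y\<in>S. dist x y \<le> e" using assms(2) by (auto simp: bounded_def)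
  then show ?thesis unfolding bounded_def
    by (intro exI[of _ "f x"] exI[of _ e]) (auto simp: plane_isometry_dist[OF assms(1)])
qed

lemma plane_isometry_closed_segment:
  assumes "plane_isometry f"
  shows "f ` closed_segment a b = closed_segment (f a) (f b)"
proof -
  obtain A g where g: "f = (\<lambda>z. A + g z)" "linear g"
    using plane_isometry_linear[OF assms] by blast
  have "f ` closed_segment a b = (+) A ` g ` closed_segment a b" by (auto simp: g)
  also have "\<dots> = closed_segment (f a) (f b)"
    by (simp add: closed_segment_linear_image[OF g(2), symmetric] closed_segment_translation[symmetric] g(1))
  finally show ?thesis .
qed

lemma plane_isometry_interior:
  assumes "plane_isometry f"
  shows "interior (f ` S) = f ` interior S"
proof -
  obtain A g where g: "f = (\<lambda>z. A + g z)" "linear g" "\<And>z. norm (g z) = norm z"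
    using plane_isometry_linear[OF assms] by blast
  have "inj g" using g by (metis linear_injective_0 norm_eq_zero)
  moreover have "f ` T = (+) A ` g ` T" for T by (auto simp: g)
  ultimately show ?thesis using g by (simp add: interior_translation interior_injective_linear_image)
qed

lemma plane_isometry_collinear:
  assumes "plane_isometry f" "collinear S"
  shows "collinear (f ` S)"
proof -
  obtain A g where g: "f = (\<lambda>z. A + g z)" "linear g"
    using plane_isometry_linear[OF assms(1)] by blast
  obtain u where u: "\<And>x y. x \<in> S \<Longrightarrow> y \<in> S \<Longrightarrow> \<exists>c. x - y = c *\<^sub>R u"
    using assms(2) unfolding collinear_def by blast
  have "\<exists>c. f x - f y = c *\<^sub>R g u" if xy: "x \<in> S" "y \<in> S" for x y
  proof -
    obtain c where "x - y = c *\<^sub>R u" using u xy by blast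
    then have "g x - g y = c *\<^sub>R g u" by (metis g(2) linear_diff linear_scale)
    then show ?thesis by (auto simp: g(1))
  qed
  then show ?thesis unfolding collinear_def by (intro exI[of _ "g u"]) auto
qed

lemma plane_isometry_collinear_3:
  assumes "plane_isometry f" "collinear {f a, f b, f c}"
  shows "collinear {a, b, c}"
proof -
  obtain h where h: "plane_isometry h" "\<And>x. h (f x) = x"
    using plane_isometry_inverse[OF assms(1)] by metis
  show ?thesis using plane_isometry_collinear[OF h(1) assms(2)] by (simp add: h(2))
qed

lemma image_inside_subset:
  fixes f g :: "complex \<Rightarrow> complex"
  assumes "plane_isometry f" "plane_isometry g" "\<And>x. g (f x) = x" "\<And>x. f (g x) = x"
  shows "f ` inside S \<subseteq> inside (f ` S)"
proof
  fix y assume "y \<in> f ` inside S"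
  then obtain x where x: "y = f x" "x \<notin> S" "bounded (connected_component_set (- S) x)"
    by (auto simp: inside_def)
  have y: "y \<notin> f ` S" using x(1,2) assms(3) by (metis imageE)
  define C where "C = connected_component_set (- (f ` S)) y"
  have "connected (g ` C)"
    by (intro connected_continuous_image plane_isometry_continuous assms) (simp add: C_def)
  moreover have "y \<in> C" using y by (simp add: C_def connected_component_refl)
  then have "x \<in> g ` C" using x(1) assms(3) by (metis imageI)
  moreover have "C \<subseteq> - (f ` S)" unfolding C_def by (rule connected_component_subset)
  then have "g ` C \<subseteq> - S" using assms(4) by (force simp: image_iff)
  ultimately have "g ` C \<subseteq> connected_component_set (- S) x"
    by (intro connected_component_maximal)
  then have "bounded (g ` C)" using x(3) bounded_subset by blast
  then have "bounded (f ` g ` C)" by (rule plane_isometry_bounded[OF assms(1)])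
  moreover have "f ` g ` C = C" by (auto simp: assms(4) image_image)
  ultimately have "bounded C" by simp
  then show "y \<in> inside (f ` S)" using y by (simp add: inside_def C_def)
qed

lemma plane_isometry_inside:
  assumes "plane_isometry f"
  shows "inside (f ` S) = f ` inside S"
proof
  obtain g where g: "plane_isometry g" "\<And>x. g (f x) = x" "\<And>x. f (g x) = x"
    using plane_isometry_inverse[OF assms] by metis
  show "f ` inside S \<subseteq> inside (f ` S)" by (rule image_inside_subset[OF assms g])
  have "g ` inside (f ` S) \<subseteq> inside (g ` f ` S)"
    by (rule image_inside_subset[OF g(1) assms g(3) g(2)])
  also have "g ` f ` S = S" by (auto simp: image_image g)
  finally have "f ` g ` inside (f ` S) \<subseteq> f ` inside S" by blast
  then show "inside (f ` S) \<subseteq> f ` inside S" by (simp add: image_image g)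
qed

lemma polygon_vertices_image:
  assumes "polygon_vertices P vs" and f: "plane_isometry f"
  shows "polygon_vertices (f ` P) (map f vs)"
proof -
  have ne: "vs \<noteq> []" using assms by (auto simp: polygon_vertices_def)
  then have v: "vert (map f vs) i = f (vert vs i)" for i by (simp add: vert_def)
  have s: "side (map f vs) i = f ` side vs i" for i
    by (simp add: side_def v plane_isometry_closed_segment[OF f])
  have inj: "inj f" by (rule plane_isometry_inj[OF f])
  have "path_image (boundary_path (map f vs)) = f ` path_image (boundary_path vs)"
    using ne by (simp add: path_image_boundary_path_UN s image_UN)
  then have "region (map f vs) = f ` region vs"
    by (simp add: region_def plane_isometry_inside[OF f] image_Un)
  moreover have "\<not> collinear {f (vert vs i), f (vert vs (Suc i)), f (vert vs (Suc (Suc i)))}" for i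
    using plane_isometry_collinear_3[OF f] assms(1) polygon_vertices_iff by blast
  ultimately show ?thesis
    using assms(1) inj unfolding polygon_vertices_iff simple_polygon_def
    by (auto simp: v s image_Int[OF inj, symmetric] inj_eq)
qed

lemma polygon_edge_image:
  assumes "polygon_edge P a b" "plane_isometry f"
  shows "polygon_edge (f ` P) (f a) (f b)"
proof -
  obtain vs i where "polygon_vertices P vs" "i < length vs" "a = vs ! i" "b = next_vertex vs i"
    using assms(1) by (auto simp: polygon_edge_def)
  then show ?thesis unfolding polygon_edge_def next_vertex_def
    using polygon_vertices_image[OF _ assms(2)]
    by (intro exI[of _ "map f vs"] exI[of _ i]) (auto intro!: nth_map[symmetric] mod_less_divisor)
qed

lemma norm_div_cnj: "z \<noteq> 0 \<Longrightarrow> norm (z / cnj z) = 1"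
  by (simp add: norm_divide)

lemma reflect_eq: "reflect a b z = a + (b - a) / cnj (b - a) * cnj (z - a)"
  by (simp add: reflect_def)

lemma plane_isometry_reflect:
  assumes "a \<noteq> b"
  shows "plane_isometry (reflect a b)"
proof -
  have "norm ((b - a) / cnj (b - a)) = 1" using assms by (intro norm_div_cnj) auto
  moreover have "reflect a b = (\<lambda>z. (a - (b - a) / cnj (b - a) * cnj a) + (b - a) / cnj (b - a) * cnj z)"
    by (rule ext) (simp only: reflect_eq complex_cnj_diff right_diff_distrib, simp)
  ultimately show ?thesis unfolding plane_isometry_def by blast
qed

text \<open>Reflections are conjugated by isometries: the factor \<open>B\<close> cancels in the
  coordinate \<open>(z - a) / (b - a)\<close>, and a change of orientation merely conjugates this
  coordinate.\<close>

lemma reflect_image: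
  assumes "plane_isometry f" "a \<noteq> b"
  shows "reflect (f a) (f b) (f z) = f (reflect a b z)"
proof -
  obtain A B where B: "norm B = 1" "f = (\<lambda>z. A + B * z) \<or> f = (\<lambda>z. A + B * cnj z)"
    using assms by (auto simp: plane_isometry_def)
  have B0: "B \<noteq> 0" using B by auto
  from B(2) show ?thesis
  proof
    assume f: "f = (\<lambda>z. A + B * z)"
    have d: "f z - f a = B * (z - a)" "f b - f a = B * (b - a)" by (auto simp: f algebra_simps)
    have "reflect (f a) (f b) (f z) = f a + B * (b - a) * cnj ((z - a) / (b - a))"
      unfolding reflect_def d using B0 by simp
    also have "\<dots> = A + B * (a + (b - a) * cnj ((z - a) / (b - a)))"
      by (simp add: f ring_distribs mult.assoc)
    finally show ?thesis by (simp add: f reflect_def)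
  next
    assume f: "f = (\<lambda>z. A + B * cnj z)"
    have d: "f z - f a = B * cnj (z - a)" "f b - f a = B * cnj (b - a)" by (auto simp: f algebra_simps)
    have "reflect (f a) (f b) (f z) = f a + B * cnj (b - a) * ((z - a) / (b - a))"
      unfolding reflect_def d using B0 by simp
    also have "\<dots> = A + B * cnj (a + (b - a) * cnj ((z - a) / (b - a)))"
      by (simp add: f ring_distribs mult.assoc)
    finally show ?thesis by (simp add: f reflect_def)
  qed
qed

lemma polygon_edge_neq: "polygon_edge P a b \<Longrightarrow> a \<noteq> b"
  by (auto simp: polygon_edge_def polygon_vertices_iff simple_polygon_def next_vertex_vert nth_vert)

text \<open>Reflecting an isometric copy of \<open>G\<close> in one of its edges amounts to composing the isometry, on the
  right, with the reflection in an edge of \<open>G\<close> itself.\<close>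

lemma edge_tiles_comp_reflect:
  assumes "plane_isometry f" "f ` G \<in> edge_tiles G" "polygon_edge G a b"
  shows "(f \<circ> reflect a b) ` G \<in> edge_tiles G"
proof -
  have "reflect (f a) (f b) ` f ` G \<in> edge_tiles G"
    by (intro edge_tiles.step assms polygon_edge_image)
  moreover have "reflect (f a) (f b) ` f ` G = (f \<circ> reflect a b) ` G"
    using reflect_image[OF assms(1) polygon_edge_neq[OF assms(3)]] by (auto simp: image_comp)
  ultimately show ?thesis by simp
qed

section \<open>Local convexity implies convexity\<close>

lemma segment_interior_locally_convex:
  fixes S :: "'a::euclidean_space set"
  assumes lc: "\<And>x. x \<in> S \<Longrightarrow> \<exists>r>0. convex (S \<inter> ball x r)"
    and p: "p \<in> interior S" and seg: "closed_segment p x \<subseteq> S" and t: "0 \<le> t" "t < 1"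
  shows "p + t *\<^sub>R (x - p) \<in> interior S"
proof (rule ccontr)
  assume bad: "p + t *\<^sub>R (x - p) \<notin> interior S"
  define h where "h s = p + s *\<^sub>R (x - p)" for s :: real
  have hS: "h s \<in> S" if "0 \<le> s" "s \<le> 1" for s
  proof -
    have "h s = (1 - s) *\<^sub>R p + s *\<^sub>R x" by (simp add: h_def algebra_simps)
    then show ?thesis using that seg by (auto simp: closed_segment_def)
  qed
  define B where "B = {s \<in> {0..1}. h s \<in> - interior S}"
  have "B = {0..1} \<inter> h -` (- interior S)" by (auto simp: B_def)
  moreover have "continuous_on {0..1} h" unfolding h_def by (intro continuous_intros)
  ultimately have "closed B"     by (metis closed_Compl closed_atLeastAtMost continuous_closed_preimage open_interior)
  then have "compact B" by (auto simp: compact_eq_bounded_closed B_def intro: bounded_subset[of "{0..1}"])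
  moreover have "t \<in> B" using bad t by (simp add: B_def h_def)
  \<comment> \<open>The first parameter at which the segment leaves the interior. Slightly before it
    the point is interior and slightly after it still in \<open>S\<close>; local convexity then
    makes the point between them interior, a contradiction.\<close>
  ultimately obtain s where s: "s \<in> B" "\<And>u. u \<in> B \<Longrightarrow> s \<le> u"
    using compact_attains_inf[of B] by auto
  have s1: "s < 1" using s(2)[OF \<open>t \<in> B\<close>] t by simp
  have s0: "0 < s" using s(1) p by (cases "s = 0") (auto simp: B_def h_def)
  obtain r where r: "0 < r" "convex (S \<inter> ball (h s) r)"
    using lc[OF hS[of s]] s0 s1 by auto
  \<comment> \<open>So small that both \<open>s - e\<close> and \<open>s + e\<close> stay in the
    unit interval and the corresponding points stay within distance \<open>r\<close>; the summand 1
    keeps the denominator positive.\<close>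
  define e where "e = min (min s (1 - s)) (r / (2 * (norm (x - p) + 1)))"
  have e: "0 < e" "e \<le> s" "e \<le> 1 - s" using s0 s1 r by (auto simp: e_def add_nonneg_pos)
  have "e * (norm (x - p) + 1) \<le> r / 2"
  proof -
    have "e \<le> r / (2 * (norm (x - p) + 1))" by (simp add: e_def)
    moreover have "0 < norm (x - p) + 1" by (simp add: add_nonneg_pos)
    ultimately show ?thesis by (simp add: field_simps)
  qed
  then have er: "e * norm (x - p) < r" using e r(1) by (simp add: algebra_simps)
  have "h (s - e) \<in> interior S"
  proof (rule ccontr)
    assume "h (s - e) \<notin> interior S"
    then have "s - e \<in> B" using e s1 by (auto simp: B_def)
    then show False using s(2) e(1) by fastforce
  qed
  moreover have ds: "dist (h s) (h (s - e)) < r" "dist (h s) (h (s + e)) < r"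
  proof -
    have "h s - h (s - e) = e *\<^sub>R (x - p)" "h s - h (s + e) = - (e *\<^sub>R (x - p))"
      by (simp_all add: h_def algebra_simps)
    then show "dist (h s) (h (s - e)) < r" "dist (h s) (h (s + e)) < r"
      using er e(1) by (simp_all add: dist_norm)
  qed
  ultimately have 1: "h (s - e) \<in> interior (S \<inter> ball (h s) r)" by simp
  have 2: "h (s + e) \<in> S \<inter> ball (h s) r" using ds hS[of "s + e"] e s0 by simp
  have "h (s - e) + h (s + e) = 2 *\<^sub>R h s"
    by (simp add: h_def scaleR_2 scaleR_left_distrib scaleR_left_diff_distrib)
  then have mid: "h s = midpoint (h (s - e)) (h (s + e))" by (simp add: midpoint_def)
  have "h s \<in> interior (S \<inter> ball (h s) r)"
  proof (cases "h (s - e) = h (s + e)")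
    case True
    then have "h s = h (s - e)" using mid by simp
    then show ?thesis using 1 by simp
  next
    case False
    then have "h s \<in> open_segment (h (s - e)) (h (s + e))" by (subst mid) simp
    then show ?thesis
      using in_interior_closure_convex_segment[OF r(2) 1] 2 closure_subset by blast
  qed
  then have "h s \<in> interior S" by simp
  then show False using s(1) by (simp add: B_def)
qed

lemma closed_segment_subset_closed:
  fixes S :: "'a::real_normed_vector set"
  assumes "closed S"
  shows "closed {x. closed_segment p x \<subseteq> S}"
proof -
  have "{x. closed_segment p x \<subseteq> S} = (\<Inter>t\<in>{0..1}. (\<lambda>x. (1 - t) *\<^sub>R p + t *\<^sub>R x) -` S)"
    by (fastforce simp: closed_segment_def)
  moreover have "closed ((\<lambda>x. (1 - t) *\<^sub>R p + t *\<^sub>R x) -` S)" for t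
    by (intro closed_vimage assms continuous_intros)
  ultimately show ?thesis by auto
qed

text \<open>The Tietze--Nakajima theorem for closures of open sets: the set of points of \<open>S\<close> that are visible from
  a given interior point is open and closed in \<open>S\<close>.\<close>

lemma locally_convex_imp_convex:
  fixes S :: "'a::euclidean_space set"
  assumes "closed S" "connected S" and dense: "S \<subseteq> closure (interior S)"
    and lc: "\<And>x. x \<in> S \<Longrightarrow> \<exists>r>0. convex (S \<inter> ball x r)"
  shows "convex S"
proof -
  have vis: "closed_segment p x \<subseteq> S" if p: "p \<in> interior S" and x: "x \<in> S" for p x
  proof -
    define V where "V = {x \<in> S. closed_segment p x \<subseteq> S}"
    have pS: "p \<in> S" using p interior_subset by blast
    have "closedin (top_of_set S) V"
    proof -
      have "V = S \<inter> {x. closed_segment p x \<subseteq> S}" by (auto simp: V_def)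
      then show ?thesis using closed_segment_subset_closed[OF assms(1)] by (simp add: closedin_closed_Int)
    qed
    moreover have "openin (top_of_set S) V"
      unfolding openin_euclidean_subtopology_iff
    proof (intro conjI ballI)
      fix x assume xV: "x \<in> V"
      obtain r where r: "0 < r" "convex (S \<inter> ball x r)" using lc xV by (auto simp: V_def)
      define d where "d = min (1/2) (r / (2 * (norm (x - p) + 1)))"
      have d: "0 < d" "d < 1" using r by (auto simp: d_def add_nonneg_pos min_less_iff_disj)
      have "d * (norm (x - p) + 1) \<le> r / 2"
      proof -
        have "d \<le> r / (2 * (norm (x - p) + 1))" by (simp add: d_def)
        moreover have "0 < norm (x - p) + 1" by (simp add: add_nonneg_pos)
        ultimately show ?thesis by (simp add: field_simps)
      qed
      then have dr: "d * norm (x - p) < r / 2" using d by (simp add: algebra_simps)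
      \<comment> \<open>A point just short of \<open>x\<close>. The segment from \<open>p\<close> to
        \<open>u\<close> is a compact part of the interior and survives small perturbations; the
        remaining piece, from the perturbed point \<open>u'\<close> to \<open>y\<close>, stays in
        the convex set \<open>S \<inter> ball x r\<close>.\<close>
      define u where "u = p + (1 - d) *\<^sub>R (x - p)"
      have "closed_segment p u \<subseteq> interior S"
      proof
        fix y assume "y \<in> closed_segment p u"
        then obtain s where s: "0 \<le> s" "s \<le> 1" "y = (1 - s) *\<^sub>R p + s *\<^sub>R u"
          by (auto simp: closed_segment_def)
        then have "y = p + (s * (1 - d)) *\<^sub>R (x - p)" by (simp add: u_def algebra_simps)
        moreover have "s * (1 - d) \<le> 1 * (1 - d)" using s d by (intro mult_right_mono) auto
        then have "s * (1 - d) < 1" by (rule le_less_trans) (use d in simp)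
          moreover have "0 \<le> s * (1 - d)" using s d by simp
        ultimately show "y \<in> interior S"
          using segment_interior_locally_convex[OF lc p] xV by (simp add: V_def)
      qed
      then obtain e where e: "0 < e" "(\<Union>y\<in>closed_segment p u. ball y e) \<subseteq> interior S"
        using compact_subset_open_imp_ball_epsilon_subset[of "closed_segment p u" "interior S"] by auto
      show "\<exists>e>0. \<forall>y\<in>S. dist y x < e \<longrightarrow> y \<in> V"
      proof (intro exI conjI ballI impI)
        show "0 < min e (r / 2)" using e r by simp
        fix y assume y: "y \<in> S" "dist y x < min e (r / 2)"
        define u' where "u' = p + (1 - d) *\<^sub>R (y - p)"
        have u'u: "u' - u = (1 - d) *\<^sub>R (y - x)" by (simp add: u'_def u_def algebra_simps)
        have "norm (u' - u) \<le> 1 * norm (y - x)" unfolding u'u norm_scaleR using d by (intro mult_right_mono) auto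
        then have nu: "norm (u' - u) \<le> norm (y - x)" by simp
        have A: "closed_segment p u' \<subseteq> S"
        proof
          fix z assume "z \<in> closed_segment p u'"
          then obtain s where s: "0 \<le> s" "s \<le> 1" "z = (1 - s) *\<^sub>R p + s *\<^sub>R u'"
            by (auto simp: closed_segment_def)
          define z' where "z' = (1 - s) *\<^sub>R p + s *\<^sub>R u"
          have "z' \<in> closed_segment p u" using s by (auto simp: z'_def closed_segment_def)
          moreover have "z - z' = s *\<^sub>R (u' - u)" by (simp add: s z'_def algebra_simps)
          then have "norm (z - z') \<le> 1 * norm (u' - u)" using s by (simp add: mult_left_le_one_le)
          then have "z \<in> ball z' e" using nu y by (simp add: dist_norm norm_minus_commute)
          ultimately show "z \<in> S" using e interior_subset by blast
        qed
        have "dist x u < r / 2"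
        proof -
          have "x - u = d *\<^sub>R (x - p)" by (simp add: u_def algebra_simps)
          then show ?thesis using dr d by (simp add: dist_norm)
        qed
        moreover have "dist u u' < r / 2" using nu y by (simp add: dist_norm norm_minus_commute)
        ultimately have "dist x u' < r" using dist_triangle_half_l[of x u r u'] dist_commute by (metis dist_triangle_half_r)
        moreover have "u' \<in> S" using A by auto
        moreover have "dist x y < r" using y r by (simp add: dist_commute)
        ultimately have "closed_segment u' y \<subseteq> S \<inter> ball x r"
          using y r by (intro closed_segment_subset) auto
        moreover have "u' \<in> closed_segment p y"
        proof -
          have "u' = (1 - (1 - d)) *\<^sub>R p + (1 - d) *\<^sub>R y" by (simp add: u'_def algebra_simps)
          then show ?thesis using d unfolding closed_segment_def by (intro CollectI exI[of _ "1 - d"]) auto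
        qed
        then have "closed_segment p y = closed_segment p u' \<union> closed_segment u' y"
          by (simp add: Un_closed_segment)
        ultimately show "y \<in> V" using A y by (auto simp: V_def)
      qed
    qed (auto simp: V_def)
    moreover have "p \<in> V" using pS by (simp add: V_def)
    ultimately have "V = S" using assms(2) by (auto simp: connected_clopen)
    then show ?thesis using x by (auto simp: V_def)
  qed
  show ?thesis
    unfolding convex_contains_segment
  proof (intro ballI)
    fix x y assume "x \<in> S" "y \<in> S"
    \<comment> \<open>Visibility is so far known from interior points. For fixed \<open>y\<close>
      the set of points that see \<open>y\<close> is closed, so density of the interior extends it
      to all of \<open>S\<close>.\<close>
    have "interior S \<subseteq> {z. closed_segment y z \<subseteq> S}"
      using vis \<open>y \<in> S\<close> by (auto simp: closed_segment_commute)
    then have "closure (interior S) \<subseteq> {z. closed_segment y z \<subseteq> S}"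
      by (intro closure_minimal closed_segment_subset_closed assms)
    then show "closed_segment x y \<subseteq> S"
      using dense \<open>x \<in> S\<close> by (auto simp: closed_segment_commute)
  qed
qed

section \<open>Local structure at the boundary\<close>

text \<open>The determinant of two plane vectors, positive when \<open>b\<close> points to the left
  of \<open>a\<close>.\<close>

definition wedge :: "complex \<Rightarrow> complex \<Rightarrow> real" where
  "wedge a b = Re a * Im b - Im a * Re b"

lemma wedge_linear:
  "wedge (a + b) c = wedge a c + wedge b c" "wedge a (b + c) = wedge a b + wedge a c"
  "wedge (a - b) c = wedge a c - wedge b c" "wedge a (b - c) = wedge a b - wedge a c"
  "wedge (r *\<^sub>R a) c = r * wedge a c" "wedge a (r *\<^sub>R c) = r * wedge a c"
  "wedge (- a) c = - wedge a c" "wedge a (- c) = - wedge a c"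
  by (simp_all add: wedge_def algebra_simps)

lemma wedge_self [simp]: "wedge a a = 0" "wedge 0 a = 0" "wedge a 0 = 0"
  by (simp_all add: wedge_def)

lemma wedge_commute: "wedge a b = - wedge b a"
  by (simp add: wedge_def)

lemma wedge_inner: "wedge a b = (\<i> * a) \<bullet> b"
  by (simp add: wedge_def inner_complex_def algebra_simps)

lemma wedge_cramer:
  assumes "wedge b a \<noteq> 0"
  shows "x = (wedge b x / wedge b a) *\<^sub>R a + (wedge x a / wedge b a) *\<^sub>R b"
proof -
  have "wedge b a * Re x = wedge b x * Re a + wedge x a * Re b"
    "wedge b a * Im x = wedge b x * Im a + wedge x a * Im b"
    by (simp_all add: wedge_def algebra_simps)
  then show ?thesis using assms by (simp add: complex_eq_iff field_simps)
qed

lemma collinear_iff_wedge: "collinear {a, b, c} \<longleftrightarrow> wedge (a - b) (c - b) = 0"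
proof -
  have "collinear {a, b, c} \<longleftrightarrow> collinear {0, a - b, c - b}"
    by (auto simp: collinear_def)
  also have "\<dots> \<longleftrightarrow> (c - b) / (a - b) \<in> \<real>" by (rule collinear_iff_Reals)
  also have "\<dots> \<longleftrightarrow> wedge (a - b) (c - b) = 0"
    by (simp add: complex_is_Real_iff Im_divide wedge_def sum_power2_eq_zero_iff complex_eq_iff[symmetric]) 
       (auto simp: algebra_simps complex_eq_iff)
  finally show ?thesis .
qed

lemma convex_wedge_halfspace:
  "convex {x. wedge a (x - z) > 0}" "convex {x. wedge a (x - z) < 0}"
  "convex {x. wedge a (x - z) \<ge> 0}" "convex {x. wedge a (x - z) \<le> 0}"
  using convex_halfspace_gt[of "wedge a z" "\<i> * a"] convex_halfspace_lt[of "\<i> * a" "wedge a z"]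
    convex_halfspace_ge[of "wedge a z" "\<i> * a"] convex_halfspace_le[of "\<i> * a" "wedge a z"]
  by (simp_all add: wedge_inner[symmetric] wedge_linear)

lemma inside_ray_segment:
  fixes a :: "'a::real_normed_vector"
  assumes "0 \<le> p" "norm (p *\<^sub>R a) < norm a"
  shows "v + p *\<^sub>R a \<in> closed_segment v (v + a)"
proof -
  have "p \<le> 1" using assms by (cases "a = 0") auto
  moreover have "v + p *\<^sub>R a = (1 - p) *\<^sub>R v + p *\<^sub>R (v + a)" by (simp add: algebra_simps)
  ultimately show ?thesis using assms(1) unfolding closed_segment_def by blast
qed

locale jordan_polygon =
  fixes vs :: "complex list" and P :: "complex set"
  assumes pv: "polygon_vertices P vs"
begin

abbreviation "n \<equiv> length vs"
abbreviation "v \<equiv> vert vs"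
abbreviation "d i \<equiv> v (Suc i) - v i"
definition "C = path_image (boundary_path vs)"
definition "I = inside C"
definition "Ext = outside C"

lemma n3: "3 \<le> n" and n0: "0 < n" and ne: "vs \<noteq> []" and sp: "simple_polygon vs"
  using pv by (auto simp: polygon_vertices_iff)

lemma P_eq: "P = C \<union> I"
  using pv by (simp add: polygon_vertices_def region_def C_def I_def)

lemma simple: "simple_path (boundary_path vs)"
  using sp n3 by (simp add: simple_path_boundary_path)

lemma loop: "pathfinish (boundary_path vs) = pathstart (boundary_path vs)"
  using ne by (simp add: boundary_path_def pathstart_polygonal_path pathfinish_polygonal_path)

lemma jordan: "I \<noteq> {}" "open I" "connected I" "open Ext" "bounded I" "I \<inter> Ext = {}"
    "I \<union> Ext = - C" "frontier I = C" "frontier Ext = C"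
  using Jordan_inside_outside[OF simple loop] by (auto simp: C_def I_def Ext_def)

lemma C_sides: "C = (\<Union>i<n. side vs i)" and side_subset_C: "side vs i \<subseteq> C"
proof -
  show "C = (\<Union>i<n. side vs i)" by (simp add: C_def path_image_boundary_path[OF ne])
  have "C = (\<Union>i. side vs i)" by (simp add: C_def path_image_boundary_path_UN[OF ne])
  then show "side vs i \<subseteq> C" by blast
qed

lemma compl_P: "- P = Ext"
  using jordan(6,7) P_eq by blast

lemma closure_I: "closure I = P"
  by (metis P_eq closure_Un_frontier jordan(8) sup_commute)

lemma closed_P: "closed P" and connected_P: "connected P" and compact_P: "compact P"
  using closure_I jordan by (auto simp: compact_eq_bounded_closed intro: connected_imp_connected_closure bounded_closure)

lemma I_subset: "I \<subseteq> interior P"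
  by (rule interior_maximal) (use P_eq jordan in auto)

text \<open>By the Jordan curve theorem every point of the curve is a limit of points outside, so
  none is interior to \<open>P\<close>.\<close>

lemma interior_P: "interior P = I"
proof -
  have "interior P \<inter> C = {}"
  proof (rule ccontr)
    assume "interior P \<inter> C \<noteq> {}"
    then obtain x where x: "x \<in> interior P" "x \<in> closure Ext"
      using jordan(9) by (auto simp: frontier_def)
    then have "interior P \<inter> Ext \<noteq> {}"
      using open_Int_closure_eq_empty[OF open_interior] by blast
    then show False using compl_P interior_subset by blast
  qed
  then show ?thesis using I_subset interior_subset P_eq by blast
qed

lemma dense_P: "P \<subseteq> closure (interior P)"
  by (simp add: interior_P closure_I)

lemma v_neq: "v i \<noteq> v (Suc i)"
  using sp by (simp add: simple_polygon_def)

lemma wedge_neq: "wedge (v (Suc (Suc i)) - v (Suc i)) (v i - v (Suc i)) \<noteq> 0"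
proof -
  have "\<not> collinear {v i, v (Suc i), v (Suc (Suc i))}" using pv by (simp add: polygon_vertices_iff)
  then show ?thesis
    using wedge_commute[of "v (Suc (Suc i)) - v (Suc i)" "v i - v (Suc i)"]
    by (simp add: collinear_iff_wedge)
qed

lemma ex_offset: "\<exists>k<n. (i + k) mod n = j mod n"
proof -
  obtain m where m: "n dvd i + m" using ex_add_dvd n0 by blast
  have "(i + (j + m) mod n) mod n = (i + m + j) mod n" by (simp add: mod_add_right_eq ac_simps)
  also have "\<dots> = j mod n" using m by (metis add.left_neutral dvd_eq_mod_eq_0 mod_add_left_eq)
  finally show ?thesis using n0 by (metis mod_less_divisor)
qed

lemma vert_cong: "i mod n = j mod n \<Longrightarrow> v i = v j"
  by (metis vert_mod)

lemma side_cong: "i mod n = j mod n \<Longrightarrow> side vs i = side vs j"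
  by (metis side_mod)

text \<open>Side \<open>j\<close> is reached from side \<open>i\<close> in \<open>k < n\<close>
  forward steps: \<open>k = 0\<close> is the same side, \<open>k = 1\<close> and
  \<open>k = n - 1\<close> are the neighbours, and all other sides are disjoint from side
  \<open>i\<close>.\<close>

lemma two_sides:
  assumes "z \<in> side vs i" "z \<in> side vs j"
  shows "i mod n = j mod n \<or> (j mod n = Suc i mod n \<and> z = v (Suc i)) \<or> (i mod n = Suc j mod n \<and> z = v i)"
proof -
  obtain k where k: "k < n" "(i + k) mod n = j mod n" using ex_offset by blast
  have zk: "z \<in> side vs (i + k)" using assms(2) side_cong[OF k(2)] by simp
  consider "k = 0" | "k = 1" | "2 \<le> k" "k + 2 \<le> n" | "k = n - 1" using k(1) by linarith
  then show ?thesis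
  proof cases
    case 1 then show ?thesis using k by simp
  next
    case 2
    have "side vs i \<inter> side vs (Suc i) = {v (Suc i)}" using sp by (simp add: simple_polygon_def)
    then show ?thesis using 2 k zk assms(1) by auto
  next
    case 3
    then have "side vs i \<inter> side vs (i + k) = {}" using sp by (simp add: simple_polygon_def)
    then show ?thesis using zk assms(1) by auto
  next
    case 4
    then have "Suc (i + k) = i + n" using n0 by simp
    then have e: "Suc (i + k) mod n = i mod n" by (simp only: mod_add_self2)
    then have "Suc j mod n = i mod n" using k(2) by (metis mod_Suc_eq)
    moreover have "side vs (i + k) \<inter> side vs (Suc (i + k)) = {v (Suc (i + k))}"
      using sp by (simp add: simple_polygon_def)
    then have "side vs (i + k) \<inter> side vs i = {v i}" using side_cong[OF e] vert_cong[OF e] by simp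
    ultimately show ?thesis using zk assms(1) by auto
  qed
qed

lemma away_from_sides:
  assumes "\<And>j. j < n \<Longrightarrow> j \<notin> J \<Longrightarrow> z \<notin> side vs j"
  shows "\<exists>r>0. \<forall>x\<in>ball z r. x \<in> C \<longrightarrow> (\<exists>j\<in>J. x \<in> side vs j)"
proof -
  define K where "K = (\<Union>j\<in>{..<n} - J. side vs j)"
  have "closed K" unfolding K_def side_def by (intro closed_UN) auto
  moreover have "z \<notin> K" using assms by (auto simp: K_def)
  ultimately obtain r where r: "0 < r" "ball z r \<subseteq> - K"
    using open_contains_ball[of "- K"] by auto
  then show ?thesis by (intro exI[of _ r]) (auto simp: K_def C_sides)
qed

lemma connected_inside_or_outside:
  assumes "connected S" "S \<inter> C = {}"
  shows "S \<subseteq> I \<or> S \<subseteq> Ext"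
proof (rule ccontr)
  assume "\<not> ?thesis"
  then have "I \<inter> S \<noteq> {}" "Ext \<inter> S \<noteq> {}" using jordan(7) assms(2) by blast+
  then show False
    using connectedD[OF assms(1) jordan(2,4)] jordan(6,7) assms(2) by blast
qed

lemma ball_meets:
  assumes "z \<in> C" "0 < r"
  shows "ball z r \<inter> I \<noteq> {}" "ball z r \<inter> Ext \<noteq> {}"
proof -
  have "z \<in> closure I" "z \<in> closure Ext" using assms(1) jordan(8,9) by (auto simp: frontier_def)
  then show "ball z r \<inter> I \<noteq> {}" "ball z r \<inter> Ext \<noteq> {}"
    using assms(2) by (metis centre_in_ball disjoint_iff open_Int_closure_eq_empty open_ball)+
qed

text \<open>Each piece is connected and avoids the curve, so it lies entirely inside or entirely
  outside. Every disc around a boundary point meets both regions, so the two pieces cannot lie on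
  the same side.\<close>

lemma two_pieces:
  assumes z: "z \<in> C" and r: "0 < r" and S: "connected S" "connected T" "S \<inter> C = {}" "T \<inter> C = {}"
    and cov: "ball z r \<subseteq> S \<union> T \<union> C"
  shows "S \<subseteq> I \<and> T \<subseteq> Ext \<or> S \<subseteq> Ext \<and> T \<subseteq> I"
proof -
  have dis: "I \<inter> C = {}" "Ext \<inter> C = {}" using jordan(7) by blast+
  have "\<not> (S \<subseteq> I \<and> T \<subseteq> I)"
  proof
    assume "S \<subseteq> I \<and> T \<subseteq> I"
    then have "ball z r \<subseteq> I \<union> C" using cov by blast
    then show False using ball_meets(2)[OF z r] dis(2) jordan(6) by blast
  qed
  moreover have "\<not> (S \<subseteq> Ext \<and> T \<subseteq> Ext)"
  proof
    assume "S \<subseteq> Ext \<and> T \<subseteq> Ext"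
    then have "ball z r \<subseteq> Ext \<union> C" using cov by blast
    then show False using ball_meets(1)[OF z r] dis(1) jordan(6) by blast
  qed
  ultimately show ?thesis
    using connected_inside_or_outside[OF S(1,3)] connected_inside_or_outside[OF S(2,4)] by argo
qed

text \<open>A disc that avoids the other sides and both end points meets the curve exactly in the
  line of the edge, which leaves two half discs. The sign \<open>s\<close> records which of them is
  inside.\<close>

lemma edge_local:
  assumes "z \<in> open_segment (v i) (v (Suc i))"
  obtains s r where "s = 1 \<or> s = -1" "0 < r"
    "\<And>x. x \<in> ball z r \<Longrightarrow> s * wedge (d i) (x - z) > 0 \<Longrightarrow> x \<in> I"
    "\<And>x. x \<in> ball z r \<Longrightarrow> s * wedge (d i) (x - z) < 0 \<Longrightarrow> x \<in> Ext"
    "\<And>x. x \<in> ball z r \<Longrightarrow> wedge (d i) (x - z) = 0 \<Longrightarrow> x \<in> C"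
proof -
  have zs: "z \<in> side vs i" "z \<noteq> v i" "z \<noteq> v (Suc i)"
    using assms by (auto simp: side_def open_segment_def)
  have "z \<notin> side vs j" if "j < n" "j \<notin> {i mod n}" for j
    using two_sides[OF zs(1), of j] zs that by auto
  then obtain r1 where r1: "0 < r1" "\<And>x. x \<in> ball z r1 \<Longrightarrow> x \<in> C \<Longrightarrow> x \<in> side vs i"
    using away_from_sides[of "{i mod n}" z] by auto
  define r where "r = min r1 (min (dist z (v i)) (dist z (v (Suc i))))"
  have r: "0 < r" using r1 zs by (simp add: r_def)
  obtain t where t: "0 < t" "t < 1" "z = v i + t *\<^sub>R d i"
    using assms unfolding in_segment by (auto simp: algebra_simps)
  have on_C: "x \<in> C \<longleftrightarrow> wedge (d i) (x - z) = 0" if x: "x \<in> ball z r" for x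
  proof
    assume "x \<in> C"
    then have "x \<in> side vs i" using r1 x by (auto simp: r_def)
    then obtain u where "x = v i + u *\<^sub>R d i"
      by (auto simp: side_def closed_segment_def algebra_simps)
    then have "x - z = (u - t) *\<^sub>R d i" by (simp add: t algebra_simps)
    then show "wedge (d i) (x - z) = 0" by (simp add: wedge_linear(6))
  next
    assume w: "wedge (d i) (x - z) = 0"
    have "d i \<noteq> 0" using v_neq[of i] by auto
    then have "collinear {0, d i, x - z}" using w collinear_iff_wedge[of "d i" 0 "x - z"] 
      by (simp add: insert_commute)
    then obtain s where s: "x - z = s *\<^sub>R d i" using \<open>d i \<noteq> 0\<close>
      unfolding collinear_lemma by (metis scaleR_zero_left)
    have x2: "x = v i + (t + s) *\<^sub>R d i" using s t by (simp add: algebra_simps)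
    have "norm (x - z) < norm (z - v i)" "norm (x - z) < norm (z - v (Suc i))"
      using x by (auto simp: r_def dist_norm norm_minus_commute)
    moreover have "z - v i = t *\<^sub>R d i" "z - v (Suc i) = (t - 1) *\<^sub>R d i" using t by (auto simp: algebra_simps)
    ultimately have "\<bar>s\<bar> < t" "\<bar>s\<bar> < 1 - t" using s t \<open>d i \<noteq> 0\<close> by auto
    then have "0 \<le> t + s" "t + s \<le> 1" by linarith+
    moreover have "x = (1 - (t + s)) *\<^sub>R v i + (t + s) *\<^sub>R v (Suc i)"
      unfolding x2 by (simp add: algebra_simps)
    ultimately have "x \<in> side vs i" unfolding side_def closed_segment_def by blast
    then show "x \<in> C" using side_subset_C by blast
  qed
  define S where "S = ball z r \<inter> {x. wedge (d i) (x - z) > 0}"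
  define T where "T = ball z r \<inter> {x. wedge (d i) (x - z) < 0}"
  have con: "connected S" "connected T" unfolding S_def T_def
    by (intro convex_connected convex_Int convex_ball convex_wedge_halfspace)+
  have dis: "S \<inter> C = {}" "T \<inter> C = {}" using on_C by (force simp: S_def T_def)+
  have cov: "ball z r \<subseteq> S \<union> T \<union> C" using on_C by (force simp: S_def T_def)
  have "z \<in> C" using zs side_subset_C by blast
  from two_pieces[OF this r con dis cov] show thesis
  proof
    assume "S \<subseteq> I \<and> T \<subseteq> Ext"
    then have "x \<in> I" if "x \<in> ball z r" "1 * wedge (d i) (x - z) > 0" for x
      using that by (auto simp: S_def)
    moreover have "x \<in> Ext" if "x \<in> ball z r" "1 * wedge (d i) (x - z) < 0" for x
      using that \<open>S \<subseteq> I \<and> T \<subseteq> Ext\<close> by (auto simp: T_def)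
    ultimately show thesis using that[of 1 r] r on_C by blast
  next
    assume "S \<subseteq> Ext \<and> T \<subseteq> I"
    then have "x \<in> I" if "x \<in> ball z r" "-1 * wedge (d i) (x - z) > 0" for x
      using that by (auto simp: T_def)
    moreover have "x \<in> Ext" if "x \<in> ball z r" "-1 * wedge (d i) (x - z) < 0" for x
      using that \<open>S \<subseteq> Ext \<and> T \<subseteq> I\<close> by (auto simp: S_def)
    ultimately show thesis using that[of "-1" r] r on_C by blast
  qed
qed

text \<open>Coordinates of \<open>x\<close> relative to vertex \<open>i + 1\<close> along the two edges that meet there.\<close>

definition crd1 :: "nat \<Rightarrow> complex \<Rightarrow> real" where
  "crd1 i x = wedge (d (Suc i)) (x - v (Suc i)) / wedge (d (Suc i)) (v i - v (Suc i))"

definition crd2 :: "nat \<Rightarrow> complex \<Rightarrow> real" where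
  "crd2 i x = wedge (x - v (Suc i)) (v i - v (Suc i)) / wedge (d (Suc i)) (v i - v (Suc i))"

lemma crd_eq: "x = v (Suc i) + crd1 i x *\<^sub>R (v i - v (Suc i)) + crd2 i x *\<^sub>R d (Suc i)"
  using wedge_cramer[OF wedge_neq[of i], of "x - v (Suc i)"]
  by (simp add: crd1_def crd2_def algebra_simps)

lemma crd_unique:
  assumes "x = v (Suc i) + p *\<^sub>R (v i - v (Suc i)) + q *\<^sub>R d (Suc i)"
  shows "crd1 i x = p" "crd2 i x = q"
proof -
  have "x - v (Suc i) = p *\<^sub>R (v i - v (Suc i)) + q *\<^sub>R d (Suc i)" by (simp add: assms)
  then show "crd1 i x = p" "crd2 i x = q"
    using wedge_neq[of i] unfolding crd1_def crd2_def
    by (simp_all add: wedge_linear(1,2,5,6))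
qed

lemma convex_crd:
  "convex {x. crd1 i x > 0}" "convex {x. crd1 i x < 0}" "convex {x. crd1 i x \<ge> 0}"
  "convex {x. crd2 i x > 0}" "convex {x. crd2 i x < 0}" "convex {x. crd2 i x \<ge> 0}"
proof -
  let ?w = "wedge (d (Suc i)) (v i - v (Suc i))"
  have lin: "convex {x. f x - f c > 0}" "convex {x. f x - f c < 0}" "convex {x. f x - f c \<ge> 0}"
    if "linear f" for f :: "complex \<Rightarrow> real" and c
  proof -
    have "{x. f x - f c > 0} = f -` {f c<..}" "{x. f x - f c < 0} = f -` {..<f c}"
      "{x. f x - f c \<ge> 0} = f -` {f c..}" by auto
    then show "convex {x. f x - f c > 0}" "convex {x. f x - f c < 0}" "convex {x. f x - f c \<ge> 0}"
      using that by (simp_all add: convex_linear_vimage)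
  qed
  have 1: "linear (\<lambda>x. wedge (d (Suc i)) x / ?w)" and 2: "linear (\<lambda>x. wedge x (v i - v (Suc i)) / ?w)"
    by (auto intro!: linearI simp: wedge_linear(1,2,5,6) add_divide_distrib)
  have "crd1 i x = wedge (d (Suc i)) x / ?w - wedge (d (Suc i)) (v (Suc i)) / ?w"
    "crd2 i x = wedge x (v i - v (Suc i)) / ?w - wedge (v (Suc i)) (v i - v (Suc i)) / ?w" for x
    unfolding crd1_def crd2_def by (simp_all only: wedge_linear(3,4) diff_divide_distrib)
  then show "convex {x. crd1 i x > 0}" "convex {x. crd1 i x < 0}" "convex {x. crd1 i x \<ge> 0}"
    "convex {x. crd2 i x > 0}" "convex {x. crd2 i x < 0}" "convex {x. crd2 i x \<ge> 0}"
    using lin[OF 1, of "v (Suc i)"] lin[OF 2, of "v (Suc i)"] by simp_all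
qed

definition convex_corner :: "nat \<Rightarrow> bool" where
  "convex_corner i \<longleftrightarrow> (\<exists>r>0. P \<inter> ball (v (Suc i)) r = {x. 0 \<le> crd1 i x} \<inter> {x. 0 \<le> crd2 i x} \<inter> ball (v (Suc i)) r)"

definition reflex_corner :: "nat \<Rightarrow> bool" where
  "reflex_corner i \<longleftrightarrow> (\<exists>r>0. \<forall>x\<in>ball (v (Suc i)) r. crd1 i x < 0 \<or> crd2 i x < 0 \<longrightarrow> x \<in> I)"

text \<open>In a small disc the two edges separate the open sector spanned by them from its
  complement. Either the sector is inside, and the corner is convex, or the complement is inside,
  and the corner is reflex.\<close>

lemma vertex_local: "convex_corner i \<or> reflex_corner i"
proof -
  define z where "z = v (Suc i)"
  define a where "a = v i - z"
  define b where "b = d (Suc i)"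
  have ab: "a \<noteq> 0" "b \<noteq> 0" using v_neq[of i] v_neq[of "Suc i"] by (auto simp: a_def b_def z_def)
  have sides: "side vs i = closed_segment z (z + a)" "side vs (Suc i) = closed_segment z (z + b)"
    by (auto simp: side_def a_def b_def z_def closed_segment_commute)
  have zs: "z \<in> side vs (Suc i)" by (simp add: sides)
  have "z \<notin> side vs j" if "j < n" "j \<notin> {i mod n, Suc i mod n}" for j
  proof
    assume "z \<in> side vs j"
    from two_sides[OF zs this] that v_neq[of "Suc i"] have "Suc i mod n = Suc j mod n" by (auto simp: z_def)
    then have "(Suc i + (n - 1)) mod n = (Suc j + (n - 1)) mod n" by (metis mod_add_left_eq)
    then show False using that n0 by simp
  qed
  then obtain r1 where r1: "0 < r1" "\<And>x. x \<in> ball z r1 \<Longrightarrow> x \<in> C \<Longrightarrow> x \<in> side vs i \<or> x \<in> side vs (Suc i)"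
    using away_from_sides[of "{i mod n, Suc i mod n}" z] by auto
  define r where "r = min r1 (min (norm a) (norm b))"
  have r: "0 < r" using r1 ab by (simp add: r_def)
  define p where "p = crd1 i"
  define q where "q = crd2 i"
  have x_eq: "x = z + p x *\<^sub>R a + q x *\<^sub>R b" for x
    using crd_eq[of x i] by (simp add: p_def q_def a_def b_def z_def)
  have pq: "p (z + s *\<^sub>R a + t *\<^sub>R b) = s" "q (z + s *\<^sub>R a + t *\<^sub>R b) = t" for s t
    using crd_unique[of "z + s *\<^sub>R a + t *\<^sub>R b" i s t] by (simp_all add: p_def q_def a_def b_def z_def)
  have on_C: "x \<in> C \<longleftrightarrow> (p x = 0 \<and> 0 \<le> q x) \<or> (q x = 0 \<and> 0 \<le> p x)" if x: "x \<in> ball z r" for x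
  proof
    assume "x \<in> C"
    then have "x \<in> side vs i \<or> x \<in> side vs (Suc i)" using r1 x by (auto simp: r_def)
    then show "(p x = 0 \<and> 0 \<le> q x) \<or> (q x = 0 \<and> 0 \<le> p x)"
    proof
      assume "x \<in> side vs i"
      then obtain u where "0 \<le> u" "x = z + u *\<^sub>R a + 0 *\<^sub>R b"
        unfolding sides closed_segment_def by (auto simp: algebra_simps)
      then show ?thesis using pq by metis
    next
      assume "x \<in> side vs (Suc i)"
      then obtain u where "0 \<le> u" "x = z + 0 *\<^sub>R a + u *\<^sub>R b"
        unfolding sides closed_segment_def by (auto simp: algebra_simps)
      then show ?thesis using pq by metis
    qed
  next
    have xz: "norm (x - z) < norm a" "norm (x - z) < norm b"
      using x by (auto simp: r_def dist_norm norm_minus_commute)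
    assume "(p x = 0 \<and> 0 \<le> q x) \<or> (q x = 0 \<and> 0 \<le> p x)"
    then have "x \<in> side vs i \<or> x \<in> side vs (Suc i)"
    proof
      assume h: "p x = 0 \<and> 0 \<le> q x"
      then have "x = z + q x *\<^sub>R b" using x_eq[of x] by simp
      then show ?thesis using inside_ray_segment[of "q x" b z] h xz(2) sides by (metis add_diff_cancel_left')
    next
      assume h: "q x = 0 \<and> 0 \<le> p x"
      then have "x = z + p x *\<^sub>R a" using x_eq[of x] by simp
      then show ?thesis using inside_ray_segment[of "p x" a z] h xz(1) sides by (metis add_diff_cancel_left')
    qed
    then show "x \<in> C" using side_subset_C by blast
  qed
  define S where "S = ball z r \<inter> ({x. p x > 0} \<inter> {x. q x > 0})"
  define T1 where "T1 = ball z r \<inter> {x. p x < 0}"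
  define T2 where "T2 = ball z r \<inter> {x. q x < 0}"
  have con: "connected S" "connected T1" "connected T2" unfolding S_def T1_def T2_def p_def q_def
    by (intro convex_connected convex_Int convex_ball convex_crd)+
  \<comment> \<open>The complement of the sector is the union of two half discs; it is connected
    because they share points of the opposite sector.\<close>
  have "T1 \<inter> T2 \<noteq> {}"
  proof -
    define e where "e = r / (2 * (norm (a + b) + 1))"
    have pos: "0 < norm (a + b) + 1" by (simp add: add_nonneg_pos)
    then have e: "0 < e" using r by (simp add: e_def)
    have "e * (norm (a + b) + 1) = r / 2" using pos e_def by (simp add: field_simps)
    then have "e * norm (a + b) < r" using e r by (simp add: algebra_simps)
    define y where "y = z + (- e) *\<^sub>R a + (- e) *\<^sub>R b"
    have "z - y = e *\<^sub>R (a + b)" by (simp add: y_def algebra_simps)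
    then have "y \<in> ball z r" using \<open>e * norm (a + b) < r\<close> e by (simp add: dist_norm)
    moreover have "p y = - e" "q y = - e" unfolding y_def by (rule pq)+
    ultimately have "y \<in> T1 \<inter> T2" using e by (simp add: T1_def T2_def)
    then show ?thesis by blast
  qed
  then have conT: "connected (T1 \<union> T2)" using con by (intro connected_Un)
  have dis: "S \<inter> C = {}" "(T1 \<union> T2) \<inter> C = {}" using on_C by (force simp: S_def T1_def T2_def)+
  have cov: "ball z r \<subseteq> S \<union> (T1 \<union> T2) \<union> C" using on_C by (force simp: S_def T1_def T2_def)
  have "z \<in> C" using zs side_subset_C by blast
  from two_pieces[OF this r con(1) conT dis cov] show ?thesis
  proof
    assume h: "S \<subseteq> I \<and> T1 \<union> T2 \<subseteq> Ext"
    have "x \<in> P \<longleftrightarrow> 0 \<le> p x \<and> 0 \<le> q x" if x: "x \<in> ball z r" for x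
    proof
      assume "x \<in> P"
      then have "x \<notin> Ext" using compl_P by blast
      then have "x \<notin> T1 \<union> T2" using h by blast
      then show "0 \<le> p x \<and> 0 \<le> q x" using x by (auto simp: T1_def T2_def)
    next
      assume "0 \<le> p x \<and> 0 \<le> q x"
      then have "x \<in> S \<or> x \<in> C" using on_C[OF x] x by (auto simp: S_def)
      then show "x \<in> P" using h P_eq by blast
    qed
    then have "convex_corner i"
      unfolding convex_corner_def using r by (intro exI[of _ r]) (auto simp: p_def q_def z_def)
    then show ?thesis ..
  next
    assume h: "S \<subseteq> Ext \<and> T1 \<union> T2 \<subseteq> I"
    then have "reflex_corner i"
      unfolding reflex_corner_def using r by (intro exI[of _ r]) (auto simp: p_def q_def z_def T1_def T2_def)
    then show ?thesis ..
  qed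
qed

text \<open>\<open>P\<close> is locally a disc at inside points, a half disc at relative interior
  points of edges and a sector at vertices, hence locally convex everywhere.\<close>

lemma convex_if_corners:
  assumes "\<And>i. convex_corner i"
  shows "convex P"
proof (rule locally_convex_imp_convex[OF closed_P connected_P dense_P])
  fix x assume x: "x \<in> P"
  consider "x \<in> I" | i where "x \<in> open_segment (v i) (v (Suc i))" | i where "x = v (Suc i)"
  proof -
    have "thesis" if "x \<in> side vs i" for i
    proof -
      obtain j where "x = v (Suc j)" if "x = v i"
        using n0 by (metis Suc_pred' add.commute add_Suc_right vert_add_length)
      then show thesis using that \<open>x \<in> side vs i\<close> \<open>\<And>i. x \<in> open_segment (v i) (v (Suc i)) \<Longrightarrow> thesis\<close>
         \<open>\<And>i. x = v (Suc i) \<Longrightarrow> thesis\<close>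
        by (auto simp: side_def open_segment_def)
    qed
    then show thesis using that x P_eq C_sides by auto
  qed
  then show "\<exists>r>0. convex (P \<inter> ball x r)"
  proof cases
    case 1
    then obtain r where "0 < r" "ball x r \<subseteq> I" using jordan(2) open_contains_ball by blast
    then have "P \<inter> ball x r = ball x r" using P_eq by blast
    then show ?thesis using \<open>0 < r\<close> by (metis convex_ball)
  next
    case 2
    obtain s r where s: "s = 1 \<or> s = -1" "0 < r"
      "\<And>y. y \<in> ball x r \<Longrightarrow> s * wedge (d i) (y - x) > 0 \<Longrightarrow> y \<in> I"
      "\<And>y. y \<in> ball x r \<Longrightarrow> s * wedge (d i) (y - x) < 0 \<Longrightarrow> y \<in> Ext"
      "\<And>y. y \<in> ball x r \<Longrightarrow> wedge (d i) (y - x) = 0 \<Longrightarrow> y \<in> C"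
      by (rule edge_local[OF 2]) blast
    have "P \<inter> ball x r = {y. 0 \<le> s * wedge (d i) (y - x)} \<inter> ball x r"
    proof -
      have "y \<in> P \<longleftrightarrow> 0 \<le> s * wedge (d i) (y - x)" if "y \<in> ball x r" for y
      proof (cases "s * wedge (d i) (y - x)" "0::real" rule: linorder_cases)
        case less
        then show ?thesis using s(4)[OF that] compl_P by auto
      next
        case equal
        then have "wedge (d i) (y - x) = 0" using s(1) by auto
        then show ?thesis using s(5)[OF that] P_eq equal by auto
      next
        case greater
        then show ?thesis using s(3)[OF that] P_eq by auto
      qed
      then show ?thesis by blast
    qed
    moreover have "convex {y. 0 \<le> s * wedge (d i) (y - x)}"
      using s(1) convex_wedge_halfspace by auto
    ultimately show ?thesis using s(2) by (metis convex_Int convex_ball)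
  next
    case 3
    obtain r where "r > 0" "P \<inter> ball (v (Suc i)) r = {x. 0 \<le> crd1 i x} \<inter> {x. 0 \<le> crd2 i x} \<inter> ball (v (Suc i)) r"
      using assms[of i] by (auto simp: convex_corner_def)
    then show ?thesis unfolding 3 by (metis convex_Int convex_ball convex_crd(3,6))
  qed
qed

lemma polygon_edge_vert: "polygon_edge P (v i) (v (Suc i))"
  unfolding polygon_edge_def next_vertex_vert
  by (intro exI[of _ vs] exI[of _ "i mod n"]) (use pv n0 in \<open>auto simp: nth_vert\<close>)

text \<open>At a reflex corner, a point on the backward prolongation of an edge is interior both to the tile and
  to its mirror image in that edge, although the two differ along the edge.\<close>

lemma no_reflex_corner:
  assumes "generates_edge_tessellation P"
  shows "\<not> reflex_corner i"
proof
  assume "reflex_corner i"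
  then obtain r where r: "0 < r" "\<And>x. x \<in> ball (v (Suc i)) r \<Longrightarrow> crd1 i x < 0 \<or> crd2 i x < 0 \<Longrightarrow> x \<in> I"
    unfolding reflex_corner_def by blast
  define z where "z = v (Suc i)"
  define b where "b = d (Suc i)"
  define f where "f = reflect z (z + b)"
  have zb: "z + b = v (Suc (Suc i))" by (simp add: z_def b_def)
  have b0: "b \<noteq> 0" using v_neq[of "Suc i"] by (simp add: b_def)
  have f: "plane_isometry f" unfolding f_def by (rule plane_isometry_reflect) (use b0 in simp)
  have f_eq: "f x = z + b * cnj ((x - z) / b)" for x by (simp add: f_def reflect_def)
  have tile: "f ` P \<in> edge_tiles P"
  proof -
    have "f = reflect (v (Suc i)) (v (Suc (Suc i)))" unfolding f_def zb by (simp add: z_def)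
    then show ?thesis by (metis edge_tiles.step edge_tiles.base polygon_edge_vert)
  qed
  define e where "e = r / (2 * norm b)"
  have e: "0 < e" "e * norm b < r" using r b0 by (auto simp: e_def)
  \<comment> \<open>This point lies on the mirror line, so it is fixed by \<open>f\<close>, and its
    negative second coordinate places it inside.\<close>
  define y where "y = z - e *\<^sub>R b"
  have "y = v (Suc i) + 0 *\<^sub>R (v i - v (Suc i)) + (- e) *\<^sub>R d (Suc i)" by (simp add: y_def z_def b_def)
  then have "crd2 i y = - e" by (rule crd_unique)
  moreover have "y \<in> ball (v (Suc i)) r" using e by (simp add: y_def z_def dist_norm)
  ultimately have yI: "y \<in> I" using r(2) e by auto
  have "f y = y" using b0 by (simp add: f_eq y_def scaleR_conv_of_real)
  then have "y \<in> f ` interior P" using yI interior_P by (metis imageI)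
  then have "y \<in> interior (f ` P)" using plane_isometry_interior[OF f] by simp
  then have "\<not> disjnt (interior P) (interior (f ` P))"
    using yI interior_P by (auto simp: disjnt_def)
  then have eq: "f ` P = P"
    using assms tile edge_tiles.base[of P]
    unfolding generates_edge_tessellation_def tessellation_def pairwise_def by metis
  define m where "m = midpoint (v (Suc i)) (v (Suc (Suc i)))"
  have "m \<in> open_segment (v (Suc i)) (v (Suc (Suc i)))" using v_neq[of "Suc i"] by (simp add: m_def)
  then obtain s r where s: "s = 1 \<or> s = -1" "0 < r"
      "\<And>y. y \<in> ball m r \<Longrightarrow> s * wedge b (y - m) > 0 \<Longrightarrow> y \<in> I"
      "\<And>y. y \<in> ball m r \<Longrightarrow> s * wedge b (y - m) < 0 \<Longrightarrow> y \<in> Ext"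
    unfolding b_def by (rule edge_local[of m "Suc i"]) blast
  define e where "e = s * (r / (2 * norm b))"
  have e: "\<bar>e\<bar> * norm b < r" "0 < s * e" using s b0 by (auto simp: e_def)
  define x where "x = m + e *\<^sub>R (\<i> * b)"
  have m_eq: "m = z + (1/2) *\<^sub>R b" by (simp add: m_def midpoint_def z_def b_def algebra_simps scaleR_2 flip: scaleR_2)
  have "wedge b (\<i> * b) > 0" using b0 by (simp add: wedge_def complex_eq_iff sum_power2_gt_zero_iff flip: power2_eq_square)
  then have "s * wedge b (x - m) > 0" "s * wedge b ((m - e *\<^sub>R (\<i> * b)) - m) < 0"
    using e by (simp_all add: x_def wedge_linear mult.assoc[symmetric] mult_pos_pos)
  moreover have "x \<in> ball m r" "m - e *\<^sub>R (\<i> * b) \<in> ball m r"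
    using e by (simp_all add: x_def dist_norm norm_mult)
  ultimately have xI: "x \<in> I" "m - e *\<^sub>R (\<i> * b) \<in> Ext" using s(3,4) by blast+
  have "(x - z) / b = 1/2 + e * \<i>" using b0 by (simp add: x_def m_eq scaleR_conv_of_real field_simps)
  then have "f x = z + b * (1/2 - e * \<i>)" by (simp add: f_eq)
  also have "\<dots> = m - e *\<^sub>R (\<i> * b)" by (simp add: m_eq scaleR_conv_of_real algebra_simps)
  finally have "f x \<notin> P" using xI compl_P by auto
  moreover have "f x \<in> f ` P" using xI P_eq by blast
  ultimately show False using eq by blast
qed

lemma convex_P: "generates_edge_tessellation P \<Longrightarrow> convex P"
  using convex_if_corners vertex_local no_reflex_corner by blast

end

section \<open>Convex polygons\<close>

lemma wedge_cis: "wedge (r *\<^sub>R cis a) (s *\<^sub>R cis b) = r * s * sin (b - a)"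
  by (simp add: wedge_def sin_diff algebra_simps)

lemma wedge_mult_right: "wedge (a * c) (b * c) = (norm c)\<^sup>2 * wedge a b"
  unfolding wedge_def cmod_power2 by (simp add: algebra_simps power2_eq_square)

lemma Im_divide_wedge: "Im (b / a) = wedge a b / (norm a)\<^sup>2"
  by (simp add: wedge_def Im_divide cmod_power2 algebra_simps)

lemma polar: "z = norm z *\<^sub>R cis (Arg z)"
  using rcis_cmod_Arg[of z] by (simp add: rcis_def scaleR_conv_of_real)

lemma sin_neg_imp:
  assumes "sin x < 0" "- pi < x" "x < pi"
  shows "x < 0"
  using assms sin_ge_zero[of x] by linarith

lemma sin_pos_imp_less_pi:
  assumes "0 < sin x" "0 \<le> x" "x < 2 * pi"
  shows "x < pi"
  using assms sin_le_zero[of x] by linarith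

text \<open>Division by \<open>cis a\<close> turns the sum into \<open>w\<close>, which lies in the
  upper half plane and to the right of \<open>cis (b - a)\<close>. Its argument is therefore between
  0 and \<open>b - a\<close>, and \<open>c\<close> is obtained as a real number rather than modulo
  \<open>2 * pi\<close>.\<close>

lemma sum_of_directions:
  assumes "0 < r" "0 < s" "a < b" "b < a + pi"
  obtains c t where "0 < t" "a < c" "c < b" "r *\<^sub>R cis a + s *\<^sub>R cis b = t *\<^sub>R cis c"
proof -
  define w where "w = complex_of_real r + s *\<^sub>R cis (b - a)"
  have pos: "0 < sin (b - a)" using assms by (intro sin_gt_zero) auto
  have "Im w > 0" using assms pos by (simp add: w_def)
  then have A: "0 < Arg w" "Arg w < pi" "w \<noteq> 0" using Arg_lt_pi by auto
  have "wedge ((1::real) *\<^sub>R cis (b - a)) (norm w *\<^sub>R cis (Arg w)) = wedge (cis (b - a)) w"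
    by (simp only: polar[of w, symmetric] scaleR_one)
  also have "wedge (cis (b - a)) w = - r * sin (b - a)"
    by (simp add: w_def wedge_def algebra_simps)
  finally have "norm w * sin (Arg w - (b - a)) = - r * sin (b - a)" unfolding wedge_cis by simp
  also have "\<dots> < 0" using assms pos by simp
  finally have "sin (Arg w - (b - a)) < 0" using A(3) by (simp add: mult_less_0_iff)
  then have "Arg w - (b - a) < 0" using A(1,2) assms sin_neg_imp[of "Arg w - (b - a)"] by linarith
  moreover have "r *\<^sub>R cis a + s *\<^sub>R cis b = cis a * w"
  proof -
    have "cis a * cis (b - a) = cis b" by (simp add: cis_mult)
    then show ?thesis by (simp add: w_def scaleR_conv_of_real distrib_left mult.left_commute mult.commute)
  qed
  then have "r *\<^sub>R cis a + s *\<^sub>R cis b = norm w *\<^sub>R cis (a + Arg w)"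
    by (subst (asm) polar[of w]) (simp add: cis_mult)
  ultimately show thesis using A by (intro that[of "norm w" "a + Arg w"]) auto
qed

lemma cis_eq_1_bounds:
  assumes "cis x = 1" "0 < x" "x < 4 * pi"
  shows "x = 2 * pi"
proof -
  have "cos x = 1" using assms(1) by (simp add: complex_eq_iff)
  then obtain k :: int where k: "x = of_int k * (2 * pi)" using cos_one_2pi_int by auto
  have "0 < k" using assms(2) unfolding k by (simp add: zero_less_mult_iff)
  moreover have "of_int k * (2 * pi) < 2 * (2 * pi)" using assms(3) unfolding k by simp
  then have "real_of_int k < 2" by (simp add: mult_less_cancel_right_pos)
  ultimately have "k = 1" by linarith
  then show ?thesis using k by simp
qed

lemma cis_eq_bounds:
  assumes "cis x = cis y" "\<bar>x - y\<bar> < 2 * pi"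
  shows "x = y"
proof -
  have "cis (x - y) = 1" using assms(1) by (simp flip: cis_divide)
  then have "cos (x - y) = 1" by (simp add: complex_eq_iff)
  then obtain k :: int where k: "x - y = of_int k * (2 * pi)" using cos_one_2pi_int by auto
  then have "\<bar>real_of_int k\<bar> * (2 * pi) < 1 * (2 * pi)" using assms(2) by (simp add: abs_mult)
  then have "\<bar>real_of_int k\<bar> < 1" by (simp add: mult_less_cancel_right_pos)
  then have "k = 0" by linarith
  then show ?thesis using k by simp
qed

locale convex_polygon = jordan_polygon +
  assumes cvx: "convex P"
begin

text \<open>The line of an edge supports \<open>P\<close>: moving from the midpoint of the edge
  towards a point of \<open>P\<close> beyond the line would stay in \<open>P\<close> by convexity,
  but would enter the outer half disc.\<close>

lemma one_side:
  obtains s where "s = 1 \<or> s = -1" "\<And>x. x \<in> P \<Longrightarrow> 0 \<le> s * wedge (d i) (x - v i)"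
proof -
  define m where "m = midpoint (v i) (v (Suc i))"
  have m: "m \<in> open_segment (v i) (v (Suc i))" using v_neq[of i] by (simp add: m_def)
  obtain s r where s: "s = 1 \<or> s = -1" "0 < r"
      "\<And>y. y \<in> ball m r \<Longrightarrow> s * wedge (d i) (y - m) < 0 \<Longrightarrow> y \<in> Ext"
    by (rule edge_local[OF m]) blast
  have "m \<in> side vs i" using m by (simp add: side_def open_segment_def)
  then have mP: "m \<in> P" using side_subset_C P_eq by blast
  have "0 \<le> s * wedge (d i) (x - v i)" if x: "x \<in> P" for x
  proof (rule ccontr)
    assume neg: "\<not> ?thesis"
    have "m - v i = (1/2) *\<^sub>R d i" by (simp add: m_def midpoint_def complex_eq_iff field_simps)
    then have "wedge (d i) (m - v i) = 0" by (simp only: wedge_linear(6)) simp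
    moreover have "wedge (d i) (x - v i) = wedge (d i) (x - m) + wedge (d i) (m - v i)"
      by (simp add: wedge_linear)
    ultimately have w: "s * wedge (d i) (x - m) < 0" using neg by simp
    define e where "e = min 1 (r / (2 * (norm (x - m) + 1)))"
    have e: "0 < e" "e \<le> 1" using s(2) by (auto simp: e_def add_nonneg_pos)
    have "e * (norm (x - m) + 1) \<le> r / 2"
    proof -
      have "e \<le> r / (2 * (norm (x - m) + 1))" by (simp add: e_def)
      moreover have "0 < norm (x - m) + 1" by (simp add: add_nonneg_pos)
      ultimately show ?thesis by (simp add: field_simps)
    qed
    then have er: "e * norm (x - m) < r" using e s(2) by (simp add: algebra_simps)
    define y where "y = m + e *\<^sub>R (x - m)"
    have "y = (1 - e) *\<^sub>R m + e *\<^sub>R x" by (simp add: y_def algebra_simps)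
    then have "y \<in> P" using cvx mP x e by (simp add: convexD_alt)
    moreover have "y \<in> ball m r" using er e by (simp add: y_def dist_norm)
    moreover have "s * wedge (d i) (y - m) = e * (s * wedge (d i) (x - m))"
      by (simp add: y_def wedge_linear(6) del: mult_cancel_left)
    then have "s * wedge (d i) (y - m) < 0" using mult_pos_neg[OF e(1) w] by linarith
    ultimately show False using s(3) compl_P by blast
  qed
  then show thesis using that s(1) by blast
qed

lemma v_in_P: "v i \<in> P"
proof -
  have "v i \<in> side vs i" by (simp add: side_def)
  then show ?thesis using side_subset_C P_eq by blast
qed

lemma turn_neq: "wedge (d i) (d (Suc i)) \<noteq> 0"
  using wedge_neq[of i] wedge_commute[of "d i" "d (Suc i)"] wedge_linear(8)[of "d (Suc i)" "d i"]
  by simp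

text \<open>The signs of consecutive edges agree: testing edge \<open>i\<close> with
  \<open>v (i + 2)\<close> and edge \<open>i + 1\<close> with \<open>v i\<close> gives the same
  nonzero number \<open>wedge (d i) (d (Suc i))\<close>.\<close>

lemma orientation:
  obtains s where "s = 1 \<or> s = -1" "\<And>x i. x \<in> P \<Longrightarrow> 0 \<le> s * wedge (d i) (x - v i)"
proof -
  define S where "S s i \<longleftrightarrow> (s = 1 \<or> s = -1) \<and> (\<forall>x\<in>P. 0 \<le> s * wedge (d i) (x - v i))" for s :: real and i
  obtain s where s: "S s 0" unfolding S_def by (rule one_side[of 0]) blast
  have "S s i" for i
  proof (induction i)
    case (Suc i)
    obtain t where t: "S t (Suc i)" unfolding S_def by (rule one_side[of "Suc i"]) blast
    have "0 \<le> s * wedge (d i) (v (Suc (Suc i)) - v i)" using Suc v_in_P by (simp add: S_def)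
    moreover have "wedge (d i) (v (Suc (Suc i)) - v i) = wedge (d i) (d (Suc i))"
      using wedge_linear(2)[of "d i" "d (Suc i)" "d i"] by simp
    ultimately have 1: "0 \<le> s * wedge (d i) (d (Suc i))" by simp
    have "0 \<le> t * wedge (d (Suc i)) (v i - v (Suc i))" using t v_in_P by (simp add: S_def)
    moreover have "wedge (d (Suc i)) (v i - v (Suc i)) = wedge (d i) (d (Suc i))"
      using wedge_linear(8)[of "d (Suc i)" "d i"] wedge_commute[of "d i" "d (Suc i)"] by simp
    ultimately have 2: "0 \<le> t * wedge (d i) (d (Suc i))" by simp
    have "s = t" using 1 2 turn_neq[of i] t Suc by (auto simp: S_def)
    then show ?case using t by simp
  qed (rule s)
  then show thesis using that[of s] by (auto simp: S_def)
qed

end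

text \<open>The vertices run counterclockwise. The clockwise case is reduced to this one by
  reversing the list.\<close>

locale ccw_polygon = convex_polygon +
  assumes left: "\<And>x i. x \<in> P \<Longrightarrow> 0 \<le> wedge (d i) (x - v i)"
begin

lemma turn_pos: "0 < wedge (d i) (d (Suc i))"
proof -
  have "wedge (d i) (v (Suc (Suc i)) - v i) = wedge (d i) (d (Suc i))"
    using wedge_linear(2)[of "d i" "d (Suc i)" "d i"] by simp
  then show ?thesis using left[OF v_in_P, of i "Suc (Suc i)"] turn_neq[of i] by simp
qed

lemma obtain_pred: obtains p where "v (Suc p) = v i" "v (Suc (Suc p)) = v (Suc i)" "Suc p mod n = i mod n"
proof -
  have "Suc (i + n - 1) = i + n" using n0 by simp
  then show thesis
    by (intro that[of "i + n - 1"]) (use vert_add_length[of vs i] vert_add_length[of vs "Suc i"] in simp_all)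
qed

lemma vert_eq_iff: "v i = v j \<longleftrightarrow> i mod n = j mod n"
proof
  assume e: "v i = v j"
  have "v i \<in> side vs i" "v i \<in> side vs j" using e by (auto simp: side_def)
  from two_sides[OF this] show "i mod n = j mod n"
  proof (elim disjE conjE)
    assume "v i = v (Suc i)"
    then show ?thesis using v_neq by blast
  next
    assume "i mod n = Suc j mod n"
    then have "v j = v (Suc j)" using e vert_cong by metis
    then show ?thesis using v_neq by blast
  qed
qed (rule vert_cong)

lemma d_neq: "d i \<noteq> 0"
  using v_neq[of i] by auto

text \<open>Write \<open>v j = v i + t * d i\<close>. A negative \<open>t\<close> would put
  \<open>v j\<close> to the right of the preceding edge, and \<open>t > 1\<close> to the right of
  the following one; otherwise \<open>v j\<close> lies on side \<open>i\<close>, and simplicity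
  leaves only its end points.\<close>

lemma on_edge_line:
  assumes "wedge (d i) (v j - v i) = 0"
  shows "j mod n = i mod n \<or> j mod n = Suc i mod n"
proof -
  have "collinear {0, d i, v j - v i}" using assms collinear_iff_wedge[of "d i" 0 "v j - v i"]
    by (simp add: insert_commute)
  then obtain t where t: "v j - v i = t *\<^sub>R d i" using d_neq[of i]
    unfolding collinear_lemma by (metis scaleR_zero_left)
  consider "t < 0" | "1 < t" | "0 \<le> t" "t \<le> 1" by linarith
  then show ?thesis
  proof cases
    case 1
    obtain p where p: "v (Suc p) = v i" "v (Suc (Suc p)) = v (Suc i)" by (rule obtain_pred)
    have "wedge (d p) (v j - v p) = wedge (d p) (t *\<^sub>R d i + d p)" using p by (simp flip: t)
    also have "\<dots> = t * wedge (d p) (d (Suc p))" using p by (simp only: wedge_linear(2,6)) simp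
    also have "\<dots> < 0" using 1 turn_pos[of p] by (simp add: mult_neg_pos)
    finally show ?thesis using left[OF v_in_P, of p j] by simp
  next
    case 2
    have "v j - v (Suc i) = (t - 1) *\<^sub>R d i" using t by (simp add: algebra_simps)
    then have "wedge (d (Suc i)) (v j - v (Suc i)) = (t - 1) * wedge (d (Suc i)) (d i)"
      by (simp only: wedge_linear(6))
    also have "\<dots> < 0" using 2 turn_pos[of i] wedge_commute[of "d i"] by (simp add: mult_pos_neg)
    finally show ?thesis using left[OF v_in_P, of "Suc i" j] by simp
  next
    case 3
    have "v j = (1 - t) *\<^sub>R v i + t *\<^sub>R v (Suc i)" using t by (simp add: algebra_simps)
    then have "v j \<in> side vs i" using 3 unfolding side_def closed_segment_def by blast
    moreover have "v j \<in> side vs j" by (simp add: side_def)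
    ultimately show ?thesis using two_sides v_neq vert_cong by metis
  qed
qed

lemma strict_left:
  assumes "j mod n \<noteq> i mod n" "j mod n \<noteq> Suc i mod n"
  shows "0 < wedge (d i) (v j - v i)"
  using on_edge_line[of i j] left[OF v_in_P, of i j] assms by fastforce

lemma range_vert: "range v = set vs"
proof
  show "range v \<subseteq> set vs" using n0 by (auto simp: vert_def)
  show "set vs \<subseteq> range v"
  proof
    fix x assume "x \<in> set vs"
    then obtain i where "i < n" "x = vs ! i" by (auto simp: in_set_conv_nth)
    then have "x = v i" by (simp add: nth_vert)
    then show "x \<in> range v" by blast
  qed
qed

text \<open>A compact convex set is the hull of its frontier, and the frontier consists of segments
  between vertices.\<close>

lemma P_hull: "P = convex hull (range v)"
proof
  have "frontier P = C"
    unfolding frontier_def interior_P closure_closed[OF closed_P] using P_eq jordan(7) by blast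
  then have "P = convex hull C" using Krein_Milman_frontier[OF cvx compact_P] by simp
  moreover have "side vs i \<subseteq> convex hull (range v)" for i
    unfolding side_def by (intro closed_segment_subset_convex_hull hull_inc) auto
  then have "C \<subseteq> convex hull (range v)" unfolding C_sides by blast
  ultimately show "P \<subseteq> convex hull (range v)" by (simp add: hull_minimal)
  show "convex hull (range v) \<subseteq> P" by (rule hull_minimal) (use v_in_P cvx in auto)
qed

text \<open>Describes the vertices through the set \<open>P\<close> alone, so that every symmetry of
  \<open>P\<close> is seen to map vertices to vertices.\<close>

lemma extreme_iff: "x extreme_point_of P \<longleftrightarrow> x \<in> range v"
  unfolding P_hull
proof (rule extreme_point_of_convex_hull_convex_independent)
  show "compact (range v)" unfolding range_vert by (simp add: finite_imp_compact)
  fix a assume "a \<in> range v"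
  then obtain i where i: "a = v i" by blast
  obtain p where p: "v (Suc p) = v i" "v (Suc (Suc p)) = v (Suc i)" "Suc p mod n = i mod n" by (rule obtain_pred)
  \<comment> \<open>The functional of \<open>c\<close> adds those of the two edges at
    \<open>a\<close>. Both are nonnegative on the vertices and vanish together only at
    \<open>a\<close>, so the line through \<open>a\<close> in direction \<open>c\<close> separates
    \<open>a\<close> from the rest.\<close>
  define c where "c = d p + d i"
  have "range v - {a} \<subseteq> {x. wedge c (x - a) > 0}"
  proof
    fix x assume "x \<in> range v - {a}"
    then obtain j where j: "x = v j" "j mod n \<noteq> i mod n" using i vert_eq_iff by auto
    have 1: "0 \<le> wedge (d i) (v j - v i)" by (rule left[OF v_in_P])
    have e: "wedge (d p) (v j - v i) = wedge (d p) (v j - v p)"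
      using p wedge_linear(2)[of "d p" "v j - v i" "d p"] by simp
    have 2: "0 \<le> wedge (d p) (v j - v i)" unfolding e by (rule left[OF v_in_P])
    have "wedge (d i) (v j - v i) \<noteq> 0 \<or> wedge (d p) (v j - v i) \<noteq> 0"
    proof (rule ccontr)
      assume "\<not> ?thesis"
      then have "j mod n = Suc i mod n" "j mod n = p mod n"
        using on_edge_line[of i j] on_edge_line[of p j] e j(2) p(3) by auto
      then have "v (Suc (Suc p)) = v p" using p(2) vert_cong by metis
      then have "d (Suc p) = - d p" by simp
      then have "wedge (d p) (d (Suc p)) = 0" by (metis wedge_linear(8) wedge_self(1) neg_0_equal_iff_equal)
      then show False using turn_neq by blast
    qed
    then show "x \<in> {x. wedge c (x - a) > 0}" using 1 2 by (auto simp: c_def wedge_linear(1) j i)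
  qed
  then have "convex hull (range v - {a}) \<subseteq> {x. wedge c (x - a) > 0}"
    by (rule hull_minimal) (rule convex_wedge_halfspace)
  then show "a \<notin> convex hull (range v - {a})" by auto
qed

section \<open>Exterior angles and their sum\<close>

definition "turn i = Arg (d (Suc i) / d i)"

lemma turn_bounds: "0 < turn i" "turn i < pi"
proof -
  have "0 < Im (d (Suc i) / d i)" unfolding Im_divide_wedge using turn_pos[of i] d_neq[of i] by simp
  then show "0 < turn i" "turn i < pi" using Arg_lt_pi[of "d (Suc i) / d i"] by (auto simp: turn_def)
qed

lemma d_Suc: "d (Suc i) = (norm (d (Suc i)) / norm (d i)) *\<^sub>R cis (turn i) * d i"
proof -
  have "d (Suc i) = (d (Suc i) / d i) * d i" using d_neq by simp
  then show ?thesis using polar[of "d (Suc i) / d i"] by (simp only: norm_divide turn_def)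
qed

lemma d_direction: "d k / d 0 = (norm (d k) / norm (d 0)) *\<^sub>R cis (\<Sum>i<k. turn i)"
proof (induction k)
  case 0
  then show ?case using d_neq[of 0] by simp
next
  case (Suc k)
  have "d (Suc k) / d 0 = ((norm (d (Suc k)) / norm (d k)) *\<^sub>R cis (turn k)) * (d k / d 0)"
    by (subst d_Suc) simp
  also have "\<dots> = (norm (d (Suc k)) / norm (d k)) *\<^sub>R cis (turn k) * ((norm (d k) / norm (d 0)) *\<^sub>R cis (\<Sum>i<k. turn i))"
    by (simp only: Suc)
  also have "\<dots> = (norm (d (Suc k)) / norm (d 0)) *\<^sub>R (cis (turn k) * cis (\<Sum>i<k. turn i))"
    using d_neq[of k] by simp
  finally show ?case by (simp add: cis_mult add.commute)
qed

text \<open>The direction of \<open>v k - v 0\<close> is followed as a real number \<open>a\<close>, so that the total turning is found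
  exactly and not only modulo \<open>2 \<pi>\<close>.\<close>

lemma fan_step:
  assumes k: "1 \<le> k" "k + 2 \<le> n"
    and a: "0 \<le> a" "a < pi" "0 < r" "(v k - v 0) / d 0 = r *\<^sub>R cis a"
    and phi: "a < (\<Sum>i<k. turn i)" "(\<Sum>i<k. turn i) < a + pi"
  obtains b s where "0 \<le> b" "b < pi" "0 < s" "(v (Suc k) - v 0) / d 0 = s *\<^sub>R cis b"
    "b < (\<Sum>i<Suc k. turn i)" "(\<Sum>i<Suc k. turn i) < b + 2 * pi"
proof -
  define phi where "phi = (\<Sum>i<k. turn i)"
  define t where "t = norm (d k) / norm (d 0)"
  have t: "0 < t" using d_neq by (simp add: t_def)
  have Dk: "d k / d 0 = t *\<^sub>R cis phi" using d_direction[of k] by (simp add: t_def phi_def)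
  have phi': "a < phi" "phi < a + pi" using phi by (simp_all add: phi_def)
  obtain b s where b: "0 < s" "a < b" "b < phi" "r *\<^sub>R cis a + t *\<^sub>R cis phi = s *\<^sub>R cis b"
    by (rule sum_of_directions[OF a(3) t phi'])
  have Z: "(v (Suc k) - v 0) / d 0 = s *\<^sub>R cis b"
    unfolding b(4)[symmetric] a(4)[symmetric] Dk[symmetric] by (simp flip: add_divide_distrib)
  \<comment> \<open>The vertex \<open>v (k + 1)\<close> is not an end point of edge 0, so it lies
    strictly to its left; this keeps the direction \<open>b\<close> of the diagonal below
    \<open>pi\<close>.\<close>
  have "Suc k mod n = Suc k" "0 mod n = 0" "Suc 0 mod n = 1" using k by simp_all
  then have "0 < wedge (d 0) (v (Suc k) - v 0)" using k by (intro strict_left) auto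
  then have "0 < Im ((v (Suc k) - v 0) / d 0)" unfolding Im_divide_wedge using d_neq[of 0] by simp
  then have "0 < sin b" unfolding Z using b(1) by (simp add: zero_less_mult_iff)
  then have "b < pi" using b a phi by (intro sin_pos_imp_less_pi) (auto simp: phi_def)
  then show thesis using b a phi Z turn_bounds[of k]
    by (intro that[of b s]) (auto simp: phi_def)
qed

text \<open>The invariant says that the edge direction is ahead of the diagonal direction by less
  than \<open>pi\<close>. A turn weakens this bound to \<open>2 * pi\<close>; it is restored because
  \<open>v 0\<close> lies strictly to the left of the next edge.\<close>

lemma fan:
  assumes "1 \<le> k" "k + 2 \<le> n"
  shows "\<exists>a r. 0 \<le> a \<and> a < pi \<and> 0 < r \<and> (v k - v 0) / d 0 = r *\<^sub>R cis a \<and>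
    a < (\<Sum>i<k. turn i) \<and> (\<Sum>i<k. turn i) < a + pi"
  using assms
proof (induction k rule: dec_induct)
  case base
  then show ?case using turn_bounds[of 0] d_neq[of 0] by (intro exI[of _ 0] exI[of _ 1]) auto
next
  case (step k)
  then obtain a r where a: "0 \<le> a" "a < pi" "0 < r" "(v k - v 0) / d 0 = r *\<^sub>R cis a"
    "a < (\<Sum>i<k. turn i)" "(\<Sum>i<k. turn i) < a + pi" by auto
  obtain b s where b: "0 \<le> b" "b < pi" "0 < s" "(v (Suc k) - v 0) / d 0 = s *\<^sub>R cis b"
    "b < (\<Sum>i<Suc k. turn i)" "(\<Sum>i<Suc k. turn i) < b + 2 * pi"
    by (rule fan_step[OF _ _ a]) (use step in simp_all)
  have "0 mod n = 0" "Suc k mod n = Suc k" "Suc (Suc k) mod n = Suc (Suc k)" using step by simp_all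
  then have "0 < wedge (d (Suc k)) (v 0 - v (Suc k))" by (intro strict_left) auto
  then have "0 < wedge (v (Suc k) - v 0) (d (Suc k))"
    using wedge_commute[of "v (Suc k) - v 0"] wedge_linear(8)[of "d (Suc k)" "v (Suc k) - v 0"] by simp
  then have "0 < wedge ((v (Suc k) - v 0) / d 0) (d (Suc k) / d 0)"
    using wedge_mult_right[of "v (Suc k) - v 0" "inverse (d 0)" "d (Suc k)"] d_neq[of 0]
    by (simp add: divide_inverse)
  also have "\<dots> = s * (norm (d (Suc k)) / norm (d 0)) * sin ((\<Sum>i<Suc k. turn i) - b)"
    unfolding b(4) d_direction[of "Suc k"] wedge_cis by (rule refl)
  finally have "0 < sin ((\<Sum>i<Suc k. turn i) - b)"
    using mult_pos_pos[OF b(3), of "norm (d (Suc k)) / norm (d 0)"] d_neq[of "Suc k"] d_neq[of 0]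
    by (metis divide_pos_pos zero_less_mult_pos zero_less_norm_iff)
  then have "(\<Sum>i<Suc k. turn i) - b < pi" using b by (intro sin_pos_imp_less_pi) auto
  then show ?case using b by (intro exI[of _ b] exI[of _ s]) auto
qed

text \<open>After \<open>n\<close> turns the direction of \<open>d 0\<close> recurs, so the total is
  a multiple of \<open>2 * pi\<close>. The fan bounds the first \<open>n - 1\<close> turns by
  \<open>3 * pi\<close>, and the last turn is less than \<open>pi\<close>; only
  \<open>2 * pi\<close> remains between 0 and \<open>4 * pi\<close>.\<close>

lemma sum_turn: "(\<Sum>i<n. turn i) = 2 * pi"
proof -
  define m where "m = n - 2"
  have m: "1 \<le> m" "m + 2 \<le> n" "n = Suc (Suc m)" using n3 by (auto simp: m_def)
  obtain a r where a: "0 \<le> a" "a < pi" "0 < r" "(v m - v 0) / d 0 = r *\<^sub>R cis a"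
    "a < (\<Sum>i<m. turn i)" "(\<Sum>i<m. turn i) < a + pi" using fan[OF m(1,2)] by auto
  obtain b s where b: "0 \<le> b" "b < pi" "0 < s" "(v (Suc m) - v 0) / d 0 = s *\<^sub>R cis b"
    "b < (\<Sum>i<Suc m. turn i)" "(\<Sum>i<Suc m. turn i) < b + 2 * pi"
    by (rule fan_step[OF m(1,2) a])
  have vn: "v (Suc (Suc m)) = v 0" "v (Suc (Suc (Suc m))) = v 1"
    using vert_add_length[of vs 0] vert_add_length[of vs 1] m(3) by simp_all
  have "wedge ((v (Suc m) - v 0) / d 0) (d (Suc m) / d 0) =
    s * (norm (d (Suc m)) / norm (d 0)) * sin ((\<Sum>i<Suc m. turn i) - b)"
    unfolding b(4) d_direction[of "Suc m"] wedge_cis by (rule refl)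
  \<comment> \<open>The last edge runs back along the diagonal to \<open>v 0\<close>, so the turning
    so far differs from \<open>b\<close> by a multiple of \<open>pi\<close>.\<close>
  moreover have "d (Suc m) / d 0 = - ((v (Suc m) - v 0) / d 0)" unfolding vn
    by (simp add: minus_divide_left)
  ultimately have "s * (norm (d (Suc m)) / norm (d 0)) * sin ((\<Sum>i<Suc m. turn i) - b) = 0"
    by (simp only: wedge_linear(8) wedge_self(1) minus_zero)
  then have "sin ((\<Sum>i<Suc m. turn i) - b) = 0" using b(3) d_neq[of "Suc m"] d_neq[of 0] by simp
  then have "\<not> (\<Sum>i<Suc m. turn i) - b < pi" using b sin_gt_zero[of "(\<Sum>i<Suc m. turn i) - b"] by linarith
  then have "pi \<le> (\<Sum>i<Suc m. turn i)" using b by linarith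
  then have "0 < (\<Sum>i<n. turn i)" "(\<Sum>i<n. turn i) < 4 * pi"
    unfolding m(3) sum.lessThan_Suc[of _ "Suc m"] using b turn_bounds[of "Suc m"] pi_gt_zero by linarith+
  moreover have "cis (\<Sum>i<n. turn i) = 1"
  proof -
    have "d n = d 0" using vn m(3) by simp
    then show ?thesis using d_direction[of n] d_neq[of 0] by simp
  qed
  ultimately show ?thesis by (intro cis_eq_1_bounds)
qed

end

section \<open>Angles at a vertex of the tiling\<close>

lemma angle_commute: "angle a b c = angle c b a"
  by (simp add: angle_def inner_commute mult.commute)

lemma plane_isometry_angle:
  assumes "plane_isometry f"
  shows "angle (f a) (f b) (f c) = angle a b c"
proof -
  obtain A g where g: "f = (\<lambda>z. A + g z)" "linear g" "\<And>z. norm (g z) = norm z"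
    using plane_isometry_linear[OF assms] by blast
  then have "orthogonal_transformation g" by (simp add: orthogonal_transformation)
  moreover have "f x - f y = g (x - y)" for x y using g by (simp add: linear_diff)
  ultimately show ?thesis using g(3) by (simp add: angle_def orthogonal_transformation_def)
qed

context ccw_polygon
begin

text \<open>The interior angle at vertex \<open>i + 1\<close>.\<close>

definition "corner i = pi - turn i"

lemma corner_bounds: "0 < corner i" "corner i < pi"
  using turn_bounds[of i] by (auto simp: corner_def)

lemma sum_corner: "(\<Sum>i<n. corner i) = (real n - 2) * pi"
  using sum_turn by (simp add: corner_def sum_subtractf algebra_simps)

lemma angle_corner: "angle (v i) (v (Suc i)) (v (Suc (Suc i))) = corner i"
proof -
  define r where "r = norm (d (Suc i)) / norm (d i)"
  have r: "0 < r" using d_neq by (simp add: r_def)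
  have e: "d (Suc i) = r *\<^sub>R cis (turn i) * d i" unfolding r_def by (rule d_Suc)
  have 1: "v i - v (Suc i) = - d i" by simp
  have inner: "d i \<bullet> d (Suc i) = r * cos (turn i) * (norm (d i))\<^sup>2"
    unfolding e cmod_power2 by (simp add: inner_complex_def algebra_simps power2_eq_square)
  have norm: "norm (d (Suc i)) = r * norm (d i)"
    unfolding r_def using d_neq[of i] by simp
  have "(- d i \<bullet> d (Suc i)) / (norm (- d i) * norm (d (Suc i))) =
      - (r * cos (turn i) * (norm (d i))\<^sup>2) / (norm (d i) * (r * norm (d i)))"
    by (simp only: inner_minus_left inner norm norm_minus_cancel)
  also have "\<dots> = cos (corner i)"
    using r d_neq[of i] by (simp add: corner_def power2_eq_square)
  finally show ?thesis
    unfolding angle_def 1 using corner_bounds[of i] by (simp add: arccos_cos)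
qed

lemma vert_pred_Suc: "v (Suc (k + n - 1)) = v k" "v (Suc (Suc (k + n - 1))) = v (Suc k)"
proof -
  have "Suc (k + n - 1) = k + n" using n0 by simp
  then show "v (Suc (k + n - 1)) = v k" "v (Suc (Suc (k + n - 1))) = v (Suc k)"
    using vert_add_length[of vs k] vert_add_length[of vs "Suc k"] by simp_all
qed

text \<open>Convexity puts the triangle of three consecutive vertices into \<open>P\<close>, so the
  first branch of the definition applies with \<open>r = 1\<close>. The index is shifted because
  \<open>corner i\<close> sits at vertex \<open>i + 1\<close>.\<close>

lemma interior_angle_corner:
  assumes "k < n"
  shows "interior_angle vs k = corner (k + n - 1)"
proof -
  have "region vs = P" using pv by (simp add: polygon_vertices_def)
  moreover have "convex hull {v k, v k + 1 *\<^sub>R (v (k + n - 1) - v k), v k + 1 *\<^sub>R (v (Suc k) - v k)} \<subseteq> P"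
    by (rule hull_minimal) (use v_in_P cvx in auto)
  then have "\<exists>r>0. convex hull {v k, v k + r *\<^sub>R (v (k + n - 1) - v k), v k + r *\<^sub>R (v (Suc k) - v k)} \<subseteq> P"
    using zero_less_one by blast
  ultimately have "interior_angle vs k = angle (v (k + n - 1)) (v k) (v (Suc k))"
    using assms by (simp add: interior_angle_def prev_vertex_vert next_vertex_vert nth_vert)
  then show ?thesis using angle_corner[of "k + n - 1"] by (simp only: vert_pred_Suc)
qed

section \<open>Rotations and reflections about a vertex, in polar coordinates\<close>

definition pt :: "nat \<Rightarrow> real \<Rightarrow> real \<Rightarrow> complex" where
  "pt i r a = v (Suc i) + r *\<^sub>R cis a * d (Suc i)"

definition rot :: "nat \<Rightarrow> real \<Rightarrow> complex \<Rightarrow> complex" where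
  "rot i a x = v (Suc i) + cis a * (x - v (Suc i))"

text \<open>Angles at vertex \<open>i + 1\<close> are measured counterclockwise from the outgoing
  edge, and radii in units of its length. The map sends angle \<open>b\<close> to
  \<open>a - b\<close>, so it is the reflection in the line at angle \<open>a / 2\<close>;
  \<open>a = corner i\<close> gives the bisector.\<close>

definition mir :: "nat \<Rightarrow> real \<Rightarrow> complex \<Rightarrow> complex" where
  "mir i a x = v (Suc i) + cis a * d (Suc i) * cnj ((x - v (Suc i)) / d (Suc i))"

lemma rot_pt: "rot i a (pt i r b) = pt i r (a + b)"
  by (simp add: rot_def pt_def flip: cis_mult)

lemma mir_pt: "mir i a (pt i r b) = pt i r (a - b)"
proof -
  have "(pt i r b - v (Suc i)) / d (Suc i) = r *\<^sub>R cis b"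
    using d_neq[of "Suc i"] by (simp add: pt_def scaleR_conv_of_real)
  moreover have "cis (a - b) = cis a * cis (- b)" by (simp add: cis_mult)
  ultimately show ?thesis by (simp add: mir_def cis_cnj) (simp add: pt_def scaleR_conv_of_real)
qed

lemma pt_eqD:
  assumes "pt i r a = pt i s b" "0 < r" "0 \<le> s" "\<bar>a - b\<bar> < 2 * pi"
  shows "a = b"
proof -
  have "(r *\<^sub>R cis a) * d (Suc i) = (s *\<^sub>R cis b) * d (Suc i)"
    using assms(1) by (simp only: pt_def add_left_cancel)
  then have e: "r *\<^sub>R cis a = s *\<^sub>R cis b" using d_neq mult_right_cancel by metis
  then have "norm (r *\<^sub>R cis a) = norm (s *\<^sub>R cis b)" by simp
  then have "r = s" using assms by simp
  then have "cis a = cis b" using e assms by simp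
  then show ?thesis using assms(4) by (rule cis_eq_bounds)
qed

lemma plane_isometry_mir: "plane_isometry (mir i a)"
proof -
  define B where "B = cis a * (d (Suc i) / cnj (d (Suc i)))"
  have "norm B = 1" unfolding B_def norm_mult norm_div_cnj[OF d_neq] by simp
  moreover have "mir i a = (\<lambda>x. (v (Suc i) - B * cnj (v (Suc i))) + B * cnj x)"
  proof
    fix x
    have "mir i a x = v (Suc i) + B * cnj (x - v (Suc i))" by (simp add: mir_def B_def)
    then show "mir i a x = (v (Suc i) - B * cnj (v (Suc i))) + B * cnj x"
      by (simp add: algebra_simps)
  qed
  ultimately show ?thesis unfolding plane_isometry_def by blast
qed

lemma rot_mir: "rot i a \<circ> mir i b = mir i (a + b)"
  by (rule ext) (simp add: rot_def mir_def flip: cis_mult)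

lemma mir_mir: "mir i a \<circ> mir i b = rot i (a - b)"
proof
  fix x
  define w where "w = (x - v (Suc i)) / d (Suc i)"
  have x: "x = v (Suc i) + w * d (Suc i)" using d_neq by (simp add: w_def)
  have "(mir i b x - v (Suc i)) / d (Suc i) = cis b * cnj w" using d_neq by (simp add: mir_def w_def)
  then have "mir i a (mir i b x) = v (Suc i) + cis a * d (Suc i) * (cis (- b) * w)"
    unfolding mir_def[of i a] by (simp add: cis_cnj)
  also have "\<dots> = v (Suc i) + cis (a - b) * (w * d (Suc i))"
  proof -
    have "cis (a - b) = cis a * cis (- b)" by (simp add: cis_mult)
    then show ?thesis by simp
  qed
  also have "\<dots> = rot i (a - b) x" unfolding rot_def by (simp add: x)
  finally show "(mir i a \<circ> mir i b) x = rot i (a - b) x" by simp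
qed

lemma d_corner: "d i = - ((norm (d i) / norm (d (Suc i))) *\<^sub>R cis (corner i) * d (Suc i))"
proof -
  have "cis (corner i) * cis (turn i) = -1" by (simp add: cis_mult corner_def)
  moreover define k where "k = norm (d (Suc i)) / norm (d i)"
  then have ds: "d (Suc i) = k *\<^sub>R cis (turn i) * d i" using d_Suc[of i] by simp
  have "cis (corner i) * d (Suc i) = k *\<^sub>R ((cis (corner i) * cis (turn i)) * d i)"
    unfolding ds by (simp add: mult.assoc)
  ultimately have "cis (corner i) * d (Suc i) = - ((norm (d (Suc i)) / norm (d i)) *\<^sub>R d i)"
    by (simp only: k_def mult_minus1 scaleR_minus_right)
  then show ?thesis using d_neq[of i] d_neq[of "Suc i"] by simp
qed

text \<open>The outgoing edge lies at angle 0 and the incoming edge at angle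
  \<open>corner i\<close>; the mirror at angle \<open>t\<close> sends \<open>b\<close> to
  \<open>2 * t - b\<close>.\<close>

lemma reflect_edges:
  "reflect (v (Suc i)) (v (Suc (Suc i))) = mir i 0"
  "reflect (v i) (v (Suc i)) = mir i (2 * corner i)"
proof -
  show "reflect (v (Suc i)) (v (Suc (Suc i))) = mir i 0"
    by (rule ext) (simp add: reflect_def mir_def)
  define m where "m = norm (d i) / norm (d (Suc i))"
  define b where "b = d (Suc i)"
  have m: "m \<noteq> 0" and b: "b \<noteq> 0" using d_neq by (simp_all add: m_def b_def)
  have di: "d i = - (m *\<^sub>R cis (corner i) * b)" unfolding m_def b_def by (rule d_corner)
  show "reflect (v i) (v (Suc i)) = mir i (2 * corner i)"
  proof
    fix x
    define w where "w = x - v (Suc i)"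
    have "x - v i = w + d i" by (simp add: w_def)
    then have "(x - v i) / d i = w / d i + 1" using d_neq[of i] by (metis add_divide_distrib divide_self)
    then have "reflect (v i) (v (Suc i)) x = v (Suc i) + d i * cnj (w / d i)"
      unfolding reflect_def by (simp add: algebra_simps)
    also have "d i * cnj (w / d i) = cis (2 * corner i) * b * cnj (w / b)"
    proof -
      have "w / d i = - (cis (- corner i) * (w / b) / m)"
        unfolding di by (simp add: scaleR_conv_of_real divide_inverse flip: cis_inverse)
      then have "cnj (w / d i) = - (cis (corner i) * cnj (w / b) / m)"
        by (simp add: cis_cnj)
      moreover have "d i = - (complex_of_real m * cis (corner i) * b)" using di by (simp add: scaleR_conv_of_real)
      ultimately have "d i * cnj (w / d i) = (complex_of_real m / complex_of_real m) * (cis (corner i) * cis (corner i)) * b * cnj (w / b)"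
        by simp
      then show ?thesis using m by (simp add: cis_mult)
    qed
    finally show "reflect (v i) (v (Suc i)) x = mir i (2 * corner i) x" by (simp add: mir_def w_def b_def)
  qed
qed

text \<open>Lying to the left of the outgoing edge means that the sine of the argument is
  nonnegative; lying to the left of the incoming edge means that the sine of the argument minus
  \<open>corner i\<close> is at most 0. The vertex itself gets angle 0.\<close>

lemma sector:
  assumes x: "x \<in> P"
  obtains r a where "0 \<le> r" "0 \<le> a" "a \<le> corner i" "x = pt i r a"
proof -
  define b where "b = d (Suc i)"
  define y where "y = (x - v (Suc i)) / b"
  have b: "b \<noteq> 0" using d_neq by (simp add: b_def)
  have x_eq: "x = pt i (norm y) (Arg y)" using polar[of y] b by (simp add: pt_def y_def b_def)
  show thesis
  proof (cases "y = 0")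
    case True
    then have "x = pt i 0 0" using b by (simp add: pt_def y_def)
    then show thesis using that[of 0 0] corner_bounds[of i] by simp
  next
    case False
    have "0 \<le> Im y" unfolding y_def Im_divide_wedge b_def using left[OF x, of "Suc i"] by simp
    also have "Im y = norm y * sin (Arg y)" by (subst polar) simp
    finally have "0 \<le> sin (Arg y)" using False by (simp add: zero_le_mult_iff)
    then have A: "0 \<le> Arg y" "Arg y \<le> pi"
      using sin_gt_zero[of "- Arg y"] Arg_bounded[of y] unfolding sin_minus by linarith+
    define m where "m = norm (d i) / norm b"
    have m: "0 < m" using d_neq b by (simp add: m_def)
    have di: "d i = ((- m) *\<^sub>R cis (corner i)) * b" unfolding m_def b_def using d_corner[of i] by simp
    have xb: "x - v (Suc i) = (norm y *\<^sub>R cis (Arg y)) * b"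
      using b by (simp add: polar[symmetric] y_def)
    have "0 \<le> wedge (d i) (x - v i)" using left[OF x] .
    also have "\<dots> = wedge (d i) (x - v (Suc i))"
      using wedge_linear(2)[of "d i" "x - v (Suc i)" "d i"] by simp
    also have "\<dots> = (norm b)\<^sup>2 * ((- m) * norm y * sin (Arg y - corner i))"
      unfolding di xb wedge_mult_right wedge_cis ..
    finally have "sin (Arg y - corner i) \<le> 0"
      using m False b by (simp add: zero_le_mult_iff mult_le_0_iff)
    then have "\<not> corner i < Arg y"
      using sin_gt_zero[of "Arg y - corner i"] A corner_bounds[of i] by auto
    then show thesis using that[of "norm y" "Arg y"] A x_eq by simp
  qed
qed

text \<open>A direction strictly between the two edges is a positive combination of them. Short
  steps in this direction are positive barycentric combinations of three consecutive vertices, hence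
  interior to their triangle.\<close>

lemma pt_interior:
  assumes a: "0 < a" "a < corner i"
  obtains e where "0 < e" "\<And>r. 0 < r \<Longrightarrow> r < e \<Longrightarrow> pt i r a \<in> interior P"
proof -
  define b where "b = d (Suc i)"
  define c where "c = corner i"
  define m where "m = norm (d i) / norm b"
  have m: "0 < m" using d_neq by (simp add: m_def b_def)
  have di: "cis c * b = (1 / m) *\<^sub>R (v i - v (Suc i))"
  proof -
    have "v i - v (Suc i) = m *\<^sub>R (cis c * b)" using d_corner[of i] by (simp add: m_def b_def c_def algebra_simps)
    then show ?thesis using m by simp
  qed
  have sc: "0 < sin c" "0 < sin a" "0 < sin (c - a)"
    using a corner_bounds[of i] by (auto intro!: sin_gt_zero simp: c_def)
  \<comment> \<open>The coefficients come from
    \<open>sin c * cis a = sin a * cis c + sin (c - a)\<close>; the division by \<open>m\<close>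
    accounts for the ratio of the two edge lengths.\<close>
  define A where "A = sin a / sin c / m"
  define B where "B = sin (c - a) / sin c"
  have AB: "0 < A" "0 < B" using sc m by (auto simp: A_def B_def)
  have "cis a = (sin a / sin c) *\<^sub>R cis c + complex_of_real B"
    using sc by (simp add: complex_eq_iff B_def sin_diff field_simps)
  then have "cis a * b = (sin a / sin c) *\<^sub>R (cis c * b) + B *\<^sub>R b"
    by (simp add: algebra_simps scaleR_conv_of_real)
  then have ca: "cis a * b = A *\<^sub>R (v i - v (Suc i)) + B *\<^sub>R b" by (simp add: di A_def)
  have "pt i r a \<in> interior P" if r: "0 < r" "r < 1 / (A + B)" for r
  proof -
    have lt: "r * (A + B) < 1" using r AB by (simp add: field_simps)
    have "pt i r a = (r * A) *\<^sub>R v i + (1 - r * (A + B)) *\<^sub>R v (Suc i) + (r * B) *\<^sub>R v (Suc (Suc i))"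
    proof -
      have "pt i r a = v (Suc i) + r *\<^sub>R (cis a * b)" by (simp add: pt_def b_def)
      then show ?thesis unfolding ca by (simp add: b_def algebra_simps)
    qed
    then have "\<exists>x y z. 0 < x \<and> 0 < y \<and> 0 < z \<and> x + y + z = 1 \<and>
        x *\<^sub>R v i + y *\<^sub>R v (Suc i) + z *\<^sub>R v (Suc (Suc i)) = pt i r a"
      using r AB lt
      by (intro exI[of _ "r * A"] exI[of _ "1 - r * (A + B)"] exI[of _ "r * B"])
        (simp add: distrib_left)
    moreover have "\<not> collinear {v i, v (Suc i), v (Suc (Suc i))}" using pv by (simp add: polygon_vertices_iff)
    ultimately have "pt i r a \<in> interior (convex hull {v i, v (Suc i), v (Suc (Suc i))})"
      by (simp add: interior_convex_hull_3_minimal)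
    moreover have "convex hull {v i, v (Suc i), v (Suc (Suc i))} \<subseteq> P"
      by (rule hull_minimal) (use v_in_P cvx in auto)
    ultimately show ?thesis using interior_mono by blast
  qed
  then show thesis using that[of "1 / (A + B)"] AB by simp
qed

text \<open>The isometry is kept together with the tile, because a second isometry onto the same
  tile reveals a symmetry of \<open>P\<close>.\<close>

definition tile_map :: "(complex \<Rightarrow> complex) \<Rightarrow> bool" where
  "tile_map f \<longleftrightarrow> plane_isometry f \<and> f ` P \<in> edge_tiles P"

lemma tile_map_reflect: "tile_map f \<Longrightarrow> tile_map (f \<circ> reflect (v i) (v (Suc i)))"
  unfolding tile_map_def
  by (intro conjI plane_isometry_comp plane_isometry_reflect edge_tiles_comp_reflect polygon_edge_vert v_neq) auto

text \<open>Composing alternately with the mirrors in the incoming and the outgoing edge turns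
  \<open>rot\<close> at \<open>2 j c\<close> into \<open>mir\<close> at \<open>2 (j + 1) c\<close>,
  and this into \<open>rot\<close> at \<open>2 (j + 1) c\<close>, with
  \<open>c = corner i\<close>.\<close>

lemma tile_map_rot_mir:
  "tile_map (rot i (2 * real j * corner i)) \<and> tile_map (mir i (2 * real (Suc j) * corner i))"
proof -
  define c where "c = corner i"
  have next_mir: "tile_map (mir i (2 * real (Suc j) * c))" if "tile_map (rot i (2 * real j * c))" for j
  proof -
    have "2 * real j * c + 2 * c = 2 * real (Suc j) * c" by (simp add: algebra_simps)
    then show ?thesis
      using tile_map_reflect[OF that, of i] unfolding reflect_edges rot_mir by (simp add: c_def)
  qed
  have "tile_map (rot i (2 * real j * c))"
  proof (induction j)
    case 0
    have "rot i 0 = (\<lambda>x. x)" by (rule ext) (simp add: rot_def)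
    then show ?case by (simp add: tile_map_def plane_isometry_id edge_tiles.base)
  next
    case (Suc j)
    from tile_map_reflect[OF next_mir[OF Suc], of "Suc i"] show ?case
      unfolding reflect_edges(1) mir_mir by simp
  qed
  then show ?thesis using next_mir by (simp add: c_def)
qed

text \<open>Reflecting the tile successively around the vertex puts the \<open>m\<close>-th copy in the sector between the
  angles \<open>m c\<close> and \<open>(m + 1) c\<close>, where \<open>c\<close> is the interior angle.\<close>

definition spin :: "nat \<Rightarrow> nat \<Rightarrow> complex \<Rightarrow> complex" where
  "spin i m = (if even m then rot i (real m * corner i) else mir i (real (Suc m) * corner i))"

lemma tile_map_spin: "tile_map (spin i m)"
proof (cases "even m")
  case True
  then obtain j where "m = 2 * j" by (elim evenE)
  then show ?thesis using tile_map_rot_mir[of i j] by (simp add: spin_def)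
next
  case False
  then obtain j where "m = 2 * j + 1" by (elim oddE)
  then show ?thesis using tile_map_rot_mir[of i j] by (simp add: spin_def algebra_simps)
qed

lemma spin_pt:
  fixes a :: real and m :: nat
  assumes "0 < a" "a < corner i"
  obtains b where "0 < b" "b < corner i" "\<And>r. spin i m (pt i r b) = pt i r (real m * corner i + a)"
proof (cases "even m")
  case True
  then show thesis using that[of a] assms by (simp add: spin_def rot_pt)
next
  case False
  \<comment> \<open>An odd copy is mirrored: its axis parameter is \<open>(m + 1) c\<close>, so the
    angle \<open>m c + a\<close> is the image of \<open>c - a\<close>, where
    \<open>c = corner i\<close>.\<close>
  then show thesis using that[of "corner i - a"] assms by (simp add: spin_def mir_pt algebra_simps)
qed

lemma overlap:
  assumes gen: "generates_edge_tessellation P" and f: "tile_map f"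
    and "x \<in> interior P" "f x \<in> interior P"
  shows "f ` P = P"
proof (rule ccontr)
  assume neq: "f ` P \<noteq> P"
  have "pairwise (\<lambda>A B. disjnt (interior A) (interior B)) (edge_tiles P)"
    using gen by (simp add: generates_edge_tessellation_def tessellation_def)
  moreover have "f ` P \<in> edge_tiles P" using f by (simp add: tile_map_def)
  ultimately have "disjnt (interior (f ` P)) (interior P)"
    using neq edge_tiles.base[of P] by (meson pairwiseD)
  moreover have "f x \<in> interior (f ` P)"
    using assms(3) f plane_isometry_interior by (simp add: tile_map_def)
  ultimately show False using assms(4) by (auto simp: disjnt_def)
qed

text \<open>The two angles denote the same ray, which near the vertex runs through the interior of
  \<open>P\<close> and through the interior of its \<open>m\<close>-th copy. The two tiles overlap
  and are therefore equal.\<close>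

lemma spin_overlap:
  assumes gen: "generates_edge_tessellation P"
    and a: "0 < a" "a < corner i" and e: "0 < e" "e < corner i"
    and eq: "\<And>r. pt i r (real m * corner i + a) = pt i r e"
  shows "spin i m ` P = P"
proof -
  obtain b where b: "0 < b" "b < corner i" "\<And>r. spin i m (pt i r b) = pt i r (real m * corner i + a)"
    by (rule spin_pt[where m = m, OF a]) blast
  obtain s where s: "0 < s" "\<And>r. 0 < r \<Longrightarrow> r < s \<Longrightarrow> pt i r b \<in> interior P"
    by (rule pt_interior[OF b(1,2)]) blast
  obtain t where t: "0 < t" "\<And>r. 0 < r \<Longrightarrow> r < t \<Longrightarrow> pt i r e \<in> interior P"
    by (rule pt_interior[OF e]) blast
  define r where "r = min s t / 2"
  have r: "0 < r" "r < s" "r < t" using s(1) t(1) by (auto simp: r_def)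
  show ?thesis
    by (rule overlap[OF gen tile_map_spin s(2)[OF r(1,2)]]) (use t(2)[OF r(1,3)] b(3) eq in simp)
qed

text \<open>Let \<open>m\<close> be the number of whole sectors that fit into a full turn. If a gap
  were left, the \<open>m\<close>-th copy would cover the gap and overlap \<open>P\<close> beyond
  it. It would then be equal to \<open>P\<close>, although \<open>P\<close> contains no points in
  the directions of the gap.\<close>

lemma corner_quantized:
  assumes gen: "generates_edge_tessellation P"
  obtains m :: nat where "3 \<le> m" "corner i = 2 * pi / m" "odd m \<Longrightarrow> mir i (corner i) ` P = P"
proof -
  define c where "c = corner i"
  have c: "0 < c" "c < pi" using corner_bounds by (auto simp: c_def)
  define m where "m = nat \<lfloor>2 * pi / c\<rfloor>"
  have m: "real m \<le> 2 * pi / c" "2 * pi / c < real m + 1" using c unfolding m_def by (auto; linarith)+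
  have m1: "real m * c \<le> 2 * pi" "2 * pi < (real m + 1) * c" using m c by (auto simp: field_simps)
  have "2 < 2 * pi / c" using c by (simp add: field_simps)
  then have m2: "2 \<le> m" using m(2) by linarith
  have per: "pt i r (2 * pi + a) = pt i r a" for r a by (simp add: pt_def flip: cis_mult)
  have mc: "real m * c = 2 * pi"
  proof (rule ccontr)
    assume "real m * c \<noteq> 2 * pi"
    then have lt: "real m * c < 2 * pi" using m1 by simp
    \<comment> \<open>An angle just past a full turn, inside \<open>P\<close> and still inside the
      \<open>m\<close>-th copy.\<close>
    define e where "e = min c ((real m + 1) * c - 2 * pi) / 2"
    have e: "0 < e" "e < c" "e < (real m + 1) * c - 2 * pi" using c m1 by (auto simp: e_def)
    define a where "a = 2 * pi + e - real m * c"
    have a: "0 < a" "a < c" using e lt by (auto simp: a_def algebra_simps)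
    have inv: "spin i m ` P = P"
      by (rule spin_overlap[OF gen, of a i e]) (use a e per in \<open>auto simp: c_def[symmetric] a_def\<close>)
    \<comment> \<open>The size of the gap. The angle \<open>m c + f\<close> lies in the gap and
      inside the \<open>m\<close>-th copy, which has just been identified with
      \<open>P\<close>.\<close>
    define g where "g = 2 * pi - real m * c"
    define f where "f = min c g / 2"
    have "0 < g" using lt by (simp add: g_def)
    then have f: "0 < f" "f < c" "f < g" using c by (auto simp: f_def min_def)
    have f2: "real m * c + f < 2 * pi" using f(3) by (simp add: g_def)
    obtain b where b: "0 < b" "b < corner i" "\<And>r. spin i m (pt i r b) = pt i r (real m * corner i + f)"
      by (rule spin_pt[of f i m]) (use f in \<open>auto simp: c_def\<close>)
    obtain s where s: "0 < s" "\<And>r. 0 < r \<Longrightarrow> r < s \<Longrightarrow> pt i r b \<in> interior P"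
      by (rule pt_interior[OF b(1,2)]) blast
    have "pt i (s / 2) b \<in> P" using s interior_subset by force
    then have "pt i (s / 2) (real m * c + f) \<in> P" using inv b(3) unfolding c_def by (metis imageI)
    then obtain r h where g: "0 \<le> r" "0 \<le> h" "h \<le> c" "pt i (s / 2) (real m * c + f) = pt i r h"
      unfolding c_def by (rule sector)
    have "1 * c \<le> real m * c" using m2 c by (intro mult_right_mono) auto
    then have "real m * c + f = h" using s(1) g f f2 c     proof (intro pt_eqD[OF g(4)])
      show "\<bar>real m * c + f - h\<bar> < 2 * pi"
        using g(1-3) f f2 c \<open>1 * c \<le> real m * c\<close> by linarith
    qed auto
    moreover have "2 * c \<le> real m * c" using m2 c by (intro mult_right_mono) auto
    ultimately show False using g f f2 c by linarith
  qed
  have "m \<noteq> 2" using mc c by auto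
  then have "3 \<le> m" using m2 by simp
  moreover have "corner i = 2 * pi / m" using mc m2 by (simp add: field_simps c_def)
  moreover have "mir i (corner i) ` P = P" if "odd m"
  proof -
    have "spin i m ` P = P"
      by (rule spin_overlap[OF gen, of "c / 2" i "c / 2"]) (use c mc per in \<open>auto simp: c_def[symmetric]\<close>)
    \<comment> \<open>For odd \<open>m\<close> the map \<open>spin i m\<close> is a reflection with
      parameter \<open>(m + 1) c\<close>; modulo a full turn this is \<open>c\<close>, the parameter
      of the bisector.\<close>
    moreover have "real (Suc m) * corner i = 2 * pi + c" using mc by (simp add: c_def algebra_simps)
    then have "spin i m = mir i (corner i)" using that
      by (intro ext) (simp add: spin_def mir_def c_def flip: cis_mult)
    ultimately show ?thesis by simp
  qed
  ultimately show thesis using that by blast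
qed

section \<open>Symmetry in the bisector of an angle\<close>

lemma mir_wedge:
  "wedge (mir i a x - mir i a y) (mir i a u - mir i a y) = - wedge (x - y) (u - y)"
proof -
  define B where "B = cis a * (d (Suc i) / cnj (d (Suc i)))"
  have B: "norm B = 1" unfolding B_def norm_mult norm_div_cnj[OF d_neq] by simp
  have "mir i a p - mir i a q = cnj (p - q) * B" for p q
    by (simp add: mir_def B_def algebra_simps diff_divide_distrib)
  then show ?thesis by (simp add: wedge_mult_right B) (simp add: wedge_def algebra_simps)
qed

text \<open>A symmetry and its inverse map segments in \<open>P\<close> to segments in
  \<open>P\<close>, so extreme points, that is, vertices, are preserved.\<close>

lemma symmetry_extreme:
  assumes "plane_isometry f" "f ` P = P" "x \<in> range v"
  shows "f x \<in> range v"
proof -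
  obtain g where g: "plane_isometry g" "\<And>x. g (f x) = x" "\<And>x. f (g x) = x"
    using plane_isometry_inverse[OF assms(1)] by metis
  have gP: "g y \<in> P" if "y \<in> P" for y using that assms(2) g(2) by (metis imageE)
  have x: "x extreme_point_of P" using assms(3) by (simp add: extreme_iff)
  have "f x \<notin> open_segment a b" if ab: "a \<in> P" "b \<in> P" for a b
  proof
    assume "f x \<in> open_segment a b"
    then have *: "f x \<in> closed_segment a b" "f x \<noteq> a" "f x \<noteq> b" by (auto simp: open_segment_def)
    then have "x \<in> closed_segment (g a) (g b)"
      using plane_isometry_closed_segment[OF g(1), of a b] g(2) by (metis imageI)
    moreover have "x \<noteq> g a" "x \<noteq> g b" using * g(3) by auto
    ultimately have "x \<in> open_segment (g a) (g b)" by (simp add: open_segment_def)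
    then show False using x gP ab by (auto simp: extreme_point_of_def)
  qed
  moreover have "f x \<in> P" using x assms(2) by (auto simp: extreme_point_of_def)
  ultimately have "f x extreme_point_of P" by (auto simp: extreme_point_of_def)
  then show ?thesis by (simp add: extreme_iff)
qed

text \<open>The successor of a vertex is characterised by \<open>P\<close> lying to the left of the edge, and a reflection
  exchanges left and right.\<close>

lemma mirror_step:
  assumes sym: "mir i a ` P = P" and ml: "mir i a (v m) = v l"
  shows "mir i a (v (Suc m)) = v (l + n - 1)"
proof (rule ccontr)
  assume neq: "mir i a (v (Suc m)) \<noteq> v (l + n - 1)"
  define f where "f = mir i a"
  have f: "plane_isometry f" unfolding f_def by (rule plane_isometry_mir)
  have fP: "f ` P = P" using sym by (simp add: f_def)
  obtain q where q: "f (v (Suc m)) = v q" using symmetry_extreme[OF f fP, of "v (Suc m)"] by auto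
  define p where "p = l + n - 1"
  have p: "v (Suc p) = v l" "Suc p mod n = l mod n" using vert_pred_Suc[of l] n0 by (simp_all add: p_def)
  \<comment> \<open>The preimage of \<open>v p\<close> lies to the left of edge \<open>m\<close>.
    The reflection reverses this, so \<open>v q\<close> is not strictly to the left of edge
    \<open>p\<close> and must be one of its end points.\<close>
  have "v p \<in> f ` P" using v_in_P fP by simp
  then obtain x where x: "x \<in> P" "f x = v p" by force
  have "0 \<le> wedge (v (Suc m) - v m) (x - v m)" using left[OF x(1)] .
  also have "\<dots> = - wedge (f (v (Suc m)) - f (v m)) (f x - f (v m))" by (simp add: f_def mir_wedge)
  finally have "wedge (v q - v l) (v p - v l) \<le> 0" using q x ml by (simp add: f_def)
  moreover have "wedge (d p) (v q - v p) = wedge (v q - v l) (v p - v l)"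
    unfolding p(1) by (simp add: wedge_def algebra_simps)
  ultimately have "\<not> 0 < wedge (d p) (v q - v p)" by simp
  then have "q mod n = p mod n \<or> q mod n = Suc p mod n" using strict_left by blast
  then have "v q = v p \<or> v q = v l" using vert_cong p(1) by metis
  moreover have "v q \<noteq> v l"
  proof
    assume "v q = v l"
    then have "f (v (Suc m)) = f (v m)" using q ml by (simp add: f_def)
    then show False using injD[OF plane_isometry_inj[OF f]] v_neq by metis
  qed
  ultimately show False using neq q by (simp add: f_def p_def)
qed

text \<open>The mirror fixes vertex \<open>i + 1\<close> and reverses the cyclic order;
  \<open>k * (n - 1)\<close> represents \<open>- k\<close> modulo \<open>n\<close>.\<close>

lemma mirror_vertices:
  assumes "mir i (corner i) ` P = P"
  shows "mir i (corner i) (v (Suc i + k)) = v (Suc i + k * (n - 1))"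
proof (induction k)
  case 0
  show ?case by (simp add: mir_def)
next
  case (Suc k)
  have e: "Suc i + k * (n - 1) + n - 1 = Suc i + Suc k * (n - 1)" using n0 by simp
  show ?case using mirror_step[OF assms Suc] unfolding e add_Suc_right .
qed

lemma mirror_vertices_12:
  assumes "mir i (corner i) ` P = P"
  shows "mir i (corner i) (v (Suc (Suc i))) = v i"
    "mir i (corner i) (v (Suc (Suc (Suc i)))) = v (i + n - 1)"
proof -
  have 1: "Suc i + 1 * (n - 1) = i + n" and 2: "Suc i + 2 * (n - 1) = (i + n - 1) + n"
    using n0 by linarith+
  show "mir i (corner i) (v (Suc (Suc i))) = v i"
    using mirror_vertices[OF assms, of 1] unfolding 1 by simp
  show "mir i (corner i) (v (Suc (Suc (Suc i)))) = v (i + n - 1)"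
    using mirror_vertices[OF assms, of 2] unfolding 2 by (simp del: add_diff_assoc)
qed

lemma mirror_center: "mir i a (v (Suc i)) = v (Suc i)"
  by (simp add: mir_def)

text \<open>The mirror exchanges the two edges at vertex \<open>i + 1\<close>, and also the angles
  at its neighbours: \<open>corner (Suc i)\<close> sits at vertex \<open>i + 2\<close> and
  \<open>corner (i + n - 1)\<close> at vertex \<open>i\<close>.\<close>

lemma mirror_consequences:
  assumes "mir i (corner i) ` P = P"
  shows "norm (d (Suc i)) = norm (d i)" "corner (Suc i) = corner (i + n - 1)"
proof -
  note iso = plane_isometry_mir[of i "corner i"]
  have "dist (v (Suc i)) (v (Suc (Suc i))) = dist (v (Suc i)) (v i)"
    using plane_isometry_dist[OF iso, of "v (Suc i)" "v (Suc (Suc i))"]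
    by (simp add: mirror_center mirror_vertices_12[OF assms])
  then show "norm (d (Suc i)) = norm (d i)" by (simp add: dist_norm norm_minus_commute)
  have "corner (Suc i) = angle (v (Suc i)) (v (Suc (Suc i))) (v (Suc (Suc (Suc i))))"
    by (simp add: angle_corner)
  also have "\<dots> = angle (v (Suc i)) (v i) (v (i + n - 1))"
    using plane_isometry_angle[OF iso, of "v (Suc i)" "v (Suc (Suc i))" "v (Suc (Suc (Suc i)))"]
    by (simp add: mirror_center mirror_vertices_12[OF assms])
  also have "\<dots> = angle (v (i + n - 1)) (v i) (v (Suc i))" by (rule angle_commute)
  also have "\<dots> = corner (i + n - 1)"
    using angle_corner[of "i + n - 1"] by (simp only: vert_pred_Suc)
  finally show "corner (Suc i) = corner (i + n - 1)" .
qed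

end

section \<open>Classification\<close>

text \<open>The interior angle with its three points and its region as arguments. It is symmetric in
  the outer points, which makes the effect of rotating or reversing the vertex list visible.\<close>

definition sector_angle :: "complex set \<Rightarrow> complex \<Rightarrow> complex \<Rightarrow> complex \<Rightarrow> real" where
  "sector_angle S u x w =
    (if \<exists>r>0. convex hull {x, x + r *\<^sub>R (u - x), x + r *\<^sub>R (w - x)} \<subseteq> S
     then angle u x w else 2 * pi - angle u x w)"

lemma sector_angle_commute: "sector_angle S u x w = sector_angle S w x u"
proof -
  have "{x, x + r *\<^sub>R (u - x), x + r *\<^sub>R (w - x)} = {x, x + r *\<^sub>R (w - x), x + r *\<^sub>R (u - x)}"
    for r :: real by auto
  then show ?thesis unfolding sector_angle_def angle_commute[of u x w] by simp
qed

lemma interior_angle_vert: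
  assumes "i < length vs"
  shows "interior_angle vs i =
    sector_angle (region vs) (vert vs (i + length vs - 1)) (vert vs i) (vert vs (Suc i))"
  using assms
  by (simp only: interior_angle_def sector_angle_def prev_vertex_vert next_vertex_vert nth_vert Let_def)

lemma interior_angles_rotate:
  assumes "polygon_vertices P vs"
  shows "interior_angles (rotate m vs) = rotate m (interior_angles vs)"
proof (rule nth_equalityI)
  let ?n = "length vs"
  have ne: "vs \<noteq> []" using assms by (auto simp: polygon_vertices_def)
  then have n: "0 < ?n" by simp
  have reg: "region (rotate m vs) = region vs"
    using assms polygon_vertices_rotate[OF assms, of m] by (simp add: polygon_vertices_def)
  fix i assume "i < length (interior_angles (rotate m vs))"
  then have i: "i < ?n" by (simp add: interior_angles_def)
  define j where "j = (m + i) mod ?n"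
  have j: "j < ?n" using n by (simp add: j_def)
  have "vert vs (j + ?n - 1) = vert vs (i + ?n - 1 + m)"
  proof -
    have "j + ?n - 1 = j + (?n - 1)" using n by linarith
    then have "(j + ?n - 1) mod ?n = (j + (?n - 1)) mod ?n" by simp
    also have "\<dots> = (m + i + (?n - 1)) mod ?n" by (simp only: j_def mod_add_left_eq)
    also have "m + i + (?n - 1) = i + ?n - 1 + m" using n by linarith
    finally show ?thesis by (metis vert_mod)
  qed
  moreover have "vert vs j = vert vs (i + m)" "vert vs (Suc j) = vert vs (Suc i + m)"
    by (simp_all add: j_def add.commute)
  ultimately have "interior_angle (rotate m vs) i = interior_angle vs j"
    using i j by (simp add: interior_angle_vert vert_rotate[OF ne] reg)
  then show "interior_angles (rotate m vs) ! i = rotate m (interior_angles vs) ! i"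
    using i j by (simp add: interior_angles_def nth_rotate j_def)
qed (simp add: interior_angles_def)

lemma interior_angles_rev:
  assumes "polygon_vertices P vs"
  shows "interior_angles (rev vs) = rev (interior_angles vs)"
proof (rule nth_equalityI)
  let ?n = "length vs"
  have ne: "vs \<noteq> []" using assms by (auto simp: polygon_vertices_def)
  have reg: "region (rev vs) = region vs"
    using assms polygon_vertices_rev[OF assms] by (simp add: polygon_vertices_def)
  fix i assume "i < length (interior_angles (rev vs))"
  then have i: "i < ?n" by (simp add: interior_angles_def)
  define j where "j = ?n - 1 - i"
  have j: "j < ?n" using i by (simp add: j_def)
  have "Suc (i + ?n - 1 + Suc j) = 2 * ?n" "Suc (i + j) = ?n" "Suc (Suc i + (j + ?n - 1)) = 2 * ?n"
    using i by (simp_all add: j_def)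
  then have "vert (rev vs) (i + ?n - 1) = vert vs (Suc j)" "vert (rev vs) i = vert vs j"
    "vert (rev vs) (Suc i) = vert vs (j + ?n - 1)"
    by (metis vert_rev[OF ne] dvd_refl dvd_triv_right)+
  then have "interior_angle (rev vs) i = interior_angle vs j"
    using i j by (simp add: interior_angle_vert reg sector_angle_commute)
  then show "interior_angles (rev vs) ! i = rev (interior_angles vs) ! i"
    using i j by (simp add: interior_angles_def rev_nth j_def)
qed (simp add: interior_angles_def)

section \<open>The equation for the orders of a triangle\<close>

lemma inverse_nat_bounds:
  assumes "a \<le> (k::nat)" "0 < a"
  shows "1 / real k \<le> 1 / real a" "0 < 1 / real k"
  using assms by (auto intro: divide_left_mono)

lemma one_div_nat_numeral: "1 / real a = 1 / numeral w \<Longrightarrow> a = numeral w"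
  by (metis div_by_1 divide_divide_eq_right mult_1 of_nat_eq_iff of_nat_numeral)

text \<open>The smallest order is at most 6, as the sum is at most \<open>3 / a\<close>. The
  equation has ten sorted solutions; the parity conditions remove (3, 7, 42), (3, 8, 24), (3, 9,
  18), (3, 10, 15), (4, 5, 20) and (5, 5, 10).\<close>

lemma triangle_orders:
  fixes a b c :: nat
  assumes ge: "3 \<le> a" "a \<le> b" "b \<le> c"
    and sum: "1 / real a + 1 / real b + 1 / real c = 1/2"
    and odd: "odd a \<longrightarrow> b = c" "odd b \<longrightarrow> a = c" "odd c \<longrightarrow> a = b"
  shows "(a, b, c) \<in> {(3, 12, 12), (4, 6, 12), (4, 8, 8), (6, 6, 6)}"
proof -
  have eq: "2 * (b * c + a * c + a * b) = a * b * c"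
  proof -
    have "2 * (real b * real c + real a * real c + real a * real b) = real a * real b * real c"
      using sum ge by (simp add: field_simps)
    then have "real (2 * (b * c + a * c + a * b)) = real (a * b * c)" by simp
    then show ?thesis by (simp only: of_nat_eq_iff)
  qed
  have "1 / real b \<le> 1 / real a" "1 / real c \<le> 1 / real a"
    using ge by (auto intro!: inverse_nat_bounds)
  then have "1/2 \<le> 3 / real a" using sum by (simp add: field_simps)
  then have "a \<le> 6" using ge by (simp add: field_simps)
  then consider "a = 3" | "a = 4" | "a = 5" | "a = 6" using ge by linarith
  then show ?thesis
  proof cases
    case 1
    then show ?thesis using eq odd(1) ge by auto
  next
    case 2
    have "1 / real c \<le> 1 / real b" using ge by (auto intro!: inverse_nat_bounds)
    then have "1/4 \<le> 2 / real b" using sum 2 by (simp add: field_simps)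
    then have "b \<le> 8" using ge by (simp add: field_simps)
    then consider "b = 4" | "b = 5" | "b = 6" | "b = 7" | "b = 8" using ge 2 by linarith
    then show ?thesis using eq odd ge 2 by cases auto
  next
    case 3
    \<comment> \<open>The odd order 5 forces \<open>b = c\<close>, and the equation becomes
      \<open>20 = 3 * b\<close>.\<close>
    then have "2 * (b * b + 10 * b) = 5 * b * b" using eq odd(1) by (simp add: algebra_simps)
    then have "b * 20 = b * (3 * b)" by (simp add: algebra_simps)
    then have "20 = 3 * b" using ge by simp
    then have False by presburger
    then show ?thesis ..
  next
    case 4
    have "1 / real b \<le> 1/6" "1 / real c \<le> 1/6" using ge 4 inverse_nat_bounds(1)[of 6] by auto
    moreover have "1/6 + 1 / real b + 1 / real c = 1/2" using sum unfolding 4 of_nat_numeral .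
    ultimately have "1 / real b = 1/6" "1 / real c = 1/6" by linarith+
    then have "b = 6" "c = 6" by (blast intro: one_div_nat_numeral)+
    then show ?thesis using 4 by simp
  qed
qed

lemma two_pi_div_inj:
  assumes "2 * pi / real a = 2 * pi / real b" "0 < a" "0 < b"
  shows "a = b"
  using assms by (simp add: field_simps)

text \<open>Fixing a second point determines the factor \<open>B\<close>, so the map is the
  reflection in the line through the two fixed points. This identifies the bisector symmetry of a
  kite with the reflection in its diagonal.\<close>

lemma fixed_mirror:
  assumes "p + B * cnj (q - p) = q" "p \<noteq> q"
  shows "reflect q p z = p + B * cnj (z - p)"
proof -
  have c: "cnj (q - p) \<noteq> 0" using assms(2) by simp
  have B: "B * cnj (q - p) = q - p" using assms(1) by (simp add: algebra_simps)
  then have "B = (q - p) / cnj (q - p)" using c by (simp add: field_simps)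
  also have "\<dots> = (p - q) / cnj (p - q)"
    by (metis complex_cnj_minus minus_diff_eq minus_divide_divide)
  finally have "reflect q p z = q + B * cnj (z - q)" by (simp only: reflect_eq)
  also have "cnj (z - q) = cnj (z - p) - cnj (q - p)" by simp
  finally show ?thesis using B by (simp only: right_diff_distrib) simp
qed

locale edge_tiling_polygon = ccw_polygon +
  assumes gen: "generates_edge_tessellation P"
begin

lemma corner_add_length: "corner (i + n) = corner i"
  using angle_corner[of i] angle_corner[of "i + n"]
  by (metis vert_add_length add_Suc)

lemma corner_cong: "i mod n = j mod n \<Longrightarrow> corner i = corner j"
  by (metis angle_corner mod_Suc_eq vert_mod)

text \<open>\<open>k i\<close> belongs to vertex \<open>i\<close>, whereas \<open>corner i\<close>
  and \<open>K i\<close> belong to vertex \<open>i + 1\<close>; hence the shift by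
  \<open>n - 1\<close>. The equation for the orders is the angle sum divided by
  \<open>2 * pi\<close>.\<close>

lemma vertex_orders:
  obtains k :: "nat \<Rightarrow> nat" where "\<And>i. 3 \<le> k i" "\<And>i. i < n \<Longrightarrow> interior_angle vs i = 2 * pi / k i"
    "\<And>i. k (i + n) = k i" "\<And>i. turn i = pi - 2 * pi / k (Suc i)"
    "(\<Sum>i<n. 1 / real (k i)) = (real n - 2) / 2"
    "\<And>i. odd (k (Suc i)) \<Longrightarrow> k (Suc (Suc i)) = k i \<and> norm (d (Suc i)) = norm (d i) \<and>
       mir i (corner i) ` P = P"
proof -
  have "\<forall>i. \<exists>m\<ge>3. corner i = 2 * pi / real m \<and> (odd m \<longrightarrow> mir i (corner i) ` P = P)"
    using corner_quantized[OF gen] by metis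
  then obtain K :: "nat \<Rightarrow> nat" where K: "\<And>i. 3 \<le> K i" "\<And>i. corner i = 2 * pi / real (K i)"
    "\<And>i. odd (K i) \<Longrightarrow> mir i (corner i) ` P = P" by metis
  have inj: "K i = K j" if "corner i = corner j" for i j
    by (rule two_pi_div_inj) (use that K(2)[of i] K(2)[of j] K(1)[of i] K(1)[of j] in linarith)+
  define k where "k i = K (i + n - 1)" for i
  have kS: "k (Suc i) = K i" for i unfolding k_def by (rule inj) (simp add: corner_add_length)
  have kn: "k (i + n) = k i" for i unfolding k_def
  proof (rule inj, rule corner_cong)
    have "i + n + n - 1 = (i + n - 1) + n" using n0 by linarith
    then show "(i + n + n - 1) mod n = (i + n - 1) mod n" by (simp only: mod_add_self2)
  qed
  have ia: "interior_angle vs i = 2 * pi / k i" if "i < n" for i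
    using interior_angle_corner[OF that] K(2) by (simp add: k_def)
  have sum: "(\<Sum>i<n. 1 / real (k i)) = (real n - 2) / 2"
  proof -
    obtain m where m: "n = Suc m" using n0 by (cases n) auto
    have "k 0 = K m" unfolding k_def using m by simp
    then have "(\<Sum>i<n. 1 / real (k i)) = (\<Sum>i<n. 1 / real (K i))"
      unfolding m by (subst sum.lessThan_Suc_shift) (simp add: kS add.commute)
    also have "(\<Sum>i<n. 1 / real (K i)) = (\<Sum>i<n. corner i) / (2 * pi)"
      by (simp add: sum_divide_distrib K(2))
    also have "\<dots> = (real n - 2) / 2" unfolding sum_corner by simp
    finally show ?thesis .
  qed
  have "k (Suc (Suc i)) = k i \<and> norm (d (Suc i)) = norm (d i) \<and> mir i (corner i) ` P = P"
    if "odd (k (Suc i))" for i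
  proof -
    have m: "mir i (corner i) ` P = P" using that K(3) by (simp add: kS)
    have "K (Suc i) = K (i + n - 1)" by (rule inj) (rule mirror_consequences(2)[OF m])
    then show ?thesis using m mirror_consequences(1)[OF m] by (simp only: kS) (simp add: k_def)
  qed
  moreover have "turn i = pi - 2 * pi / k (Suc i)" for i
    using K(2)[of i] by (simp add: kS corner_def)
  ultimately show thesis using that[of k] K(1) ia kn sum by (simp add: k_def)
qed

lemma interior_angles_eq: "interior_angles vs = map (interior_angle vs) [0..<n]"
  by (rule interior_angles_def)

lemma sum_d: "(\<Sum>i<n. d i) = 0"
  using vert_add_length[of vs 0] by (simp add: sum_lessThan_telescope)

lemma equilateral_iff: "equilateral vs \<longleftrightarrow> (\<forall>i<n. \<forall>j<n. norm (d i) = norm (d j))"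
  by (auto simp: equilateral_def nth_vert next_vertex_vert dist_norm norm_minus_commute)

lemma triangle_case:
  assumes n: "n = 3"
  shows "equilateral_triangle P \<or> right_triangle_60 P \<or> isosceles_right_triangle P \<or> isosceles_triangle_120 P"
proof -
  obtain k :: "nat \<Rightarrow> nat" where k: "\<And>i. 3 \<le> k i" "\<And>i. i < n \<Longrightarrow> interior_angle vs i = 2 * pi / k i"
    "\<And>i. k (i + n) = k i" "\<And>i. turn i = pi - 2 * pi / k (Suc i)"
    "(\<Sum>i<n. 1 / real (k i)) = (real n - 2) / 2"
    "\<And>i. odd (k (Suc i)) \<Longrightarrow> k (Suc (Suc i)) = k i"
    using vertex_orders by metis
  \<comment> \<open>Everything known about the three orders, in a form invariant under rotation and
    reversal of the vertex list, so that the orders may be sorted.\<close>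
  define Q where "Q a b c \<longleftrightarrow> {a, b, c} = {k 0, k 1, k 2} \<and>
      (\<exists>ws. polygon_vertices P ws \<and> interior_angles ws = [2*pi/a, 2*pi/b, 2*pi/c]) \<and>
      3 \<le> a \<and> 3 \<le> b \<and> 3 \<le> c \<and> 1 / real a + 1 / real b + 1 / real c = 1/2 \<and>
      (odd a \<longrightarrow> b = c) \<and> (odd b \<longrightarrow> a = c) \<and> (odd c \<longrightarrow> a = b)" for a b c :: nat
  have k3: "k 3 = k 0" "k 4 = k 1" using k(3)[of 0] k(3)[of 1] n by simp_all
  have Q0: "Q (k 0) (k 1) (k 2)"
    unfolding Q_def
  proof (intro conjI exI[of _ vs])
    show "interior_angles vs = [2*pi/k 0, 2*pi/k 1, 2*pi/k 2]"
      by (simp add: interior_angles_eq n upt_rec k(2) numeral_2_eq_2)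
    show "1 / real (k 0) + 1 / real (k 1) + 1 / real (k 2) = 1/2"
      using k(5) by (simp add: n numeral_eq_Suc lessThan_Suc)
    have S: "Suc 0 = 1" "Suc 1 = 2" "Suc 2 = 3" "Suc 3 = 4" by simp_all
    show "odd (k 0) \<longrightarrow> k 1 = k 2" "odd (k 1) \<longrightarrow> k 0 = k 2" "odd (k 2) \<longrightarrow> k 0 = k 1"
      using k(6)[of 0, unfolded S] k(6)[of 1, unfolded S] k(6)[of 2, unfolded S] k3 by metis+
  qed (use k(1) pv in auto)
  have rot: "Q b c a" if q: "Q a b c" for a b c
  proof -
    obtain ws where ws: "polygon_vertices P ws" "interior_angles ws = [2*pi/a, 2*pi/b, 2*pi/c]"
      using q unfolding Q_def by blast
    then have "interior_angles (rotate 1 ws) = [2*pi/b, 2*pi/c, 2*pi/a]"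
      using interior_angles_rotate[OF ws(1), of 1] by simp
    moreover have "polygon_vertices P (rotate 1 ws)" by (rule polygon_vertices_rotate[OF ws(1)])
    moreover have "{b, c, a} = {a, b, c}" by auto
    moreover have "1 / real b + 1 / real c + 1 / real a = 1 / real a + 1 / real b + 1 / real c" by simp
    ultimately show ?thesis using q unfolding Q_def by metis
  qed
  have rev: "Q c b a" if q: "Q a b c" for a b c
  proof -
    obtain ws where ws: "polygon_vertices P ws" "interior_angles ws = [2*pi/a, 2*pi/b, 2*pi/c]"
      using q unfolding Q_def by blast
    then have "interior_angles (rev ws) = [2*pi/c, 2*pi/b, 2*pi/a]"
      using interior_angles_rev[OF ws(1)] by simp
    moreover have "polygon_vertices P (rev ws)" by (rule polygon_vertices_rev[OF ws(1)])
    moreover have "{c, b, a} = {a, b, c}" by auto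
    moreover have "1 / real c + 1 / real b + 1 / real a = 1 / real a + 1 / real b + 1 / real c" by simp
    ultimately show ?thesis using q unfolding Q_def by metis
  qed
  \<comment> \<open>The shapes list their angles in increasing order, which is decreasing order for
    the orders; hence \<open>Q c b a\<close> with \<open>a\<close> the least.\<close>
  obtain a b c where abc: "Q c b a" "a \<le> b" "b \<le> c"
  proof -
    define x y z where xyz: "x = k 0" "y = k 1" "z = k 2"
    have p: "Q x y z" "Q y z x" "Q z x y" "Q z y x" "Q x z y" "Q y x z"
    proof -
      show p1: "Q x y z" unfolding xyz by (rule Q0)
      show p2: "Q y z x" by (rule rot[OF p1])
      show "Q z x y" by (rule rot[OF p2])
      show p4: "Q z y x" by (rule rev[OF p1])
      show "Q y x z" by (rule rot[OF p4])
      show "Q x z y" by (rule rev[OF p2])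
    qed
    consider "x \<le> y" "y \<le> z" | "x \<le> z" "z \<le> y" | "y \<le> x" "x \<le> z" | "y \<le> z" "z \<le> x"
      | "z \<le> x" "x \<le> y" | "z \<le> y" "y \<le> x" by linarith
    then show thesis by cases (use that p in blast)+
  qed
  have "(a, b, c) \<in> {(3, 12, 12), (4, 6, 12), (4, 8, 8), (6, 6, 6)}"
  proof (rule triangle_orders)
    show "3 \<le> a" "odd a \<longrightarrow> b = c" "odd b \<longrightarrow> a = c" "odd c \<longrightarrow> a = b"
      using abc(1) unfolding Q_def by metis+
    have "1 / real c + 1 / real b + 1 / real a = 1/2" using abc(1) unfolding Q_def by blast
    then show "1 / real a + 1 / real b + 1 / real c = 1/2" by linarith
  qed (rule abc)+
  then consider "a = 3" "b = 12" "c = 12" | "a = 4" "b = 6" "c = 12" | "a = 4" "b = 8" "c = 8"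
    | "a = 6" "b = 6" "c = 6" by auto
  then show ?thesis
  proof cases
    case 1
    then have "isosceles_triangle_120 P" using abc(1) unfolding isosceles_triangle_120_def Q_def by auto
    then show ?thesis by simp
  next
    case 2
    then have "right_triangle_60 P" using abc(1) unfolding right_triangle_60_def Q_def by auto
    then show ?thesis by simp
  next
    case 3
    then have "isosceles_right_triangle P" using abc(1) unfolding isosceles_right_triangle_def Q_def by auto
    then show ?thesis by simp
  next
    case 4
    then have "k 0 = 6" "k 1 = 6" "k 2 = 6" using abc(1) by (auto simp: Q_def)
    then have t: "turn 0 = 2 * pi / 3" "turn 1 = 2 * pi / 3" using k(4)[of 0] k(4)[of 1] by (simp_all add: numeral_eq_Suc)
    \<comment> \<open>All angles are equal. The equality of the sides follows from the vanishing sum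
      of the edge vectors: the imaginary part gives \<open>p = q\<close>, the real part then gives
      1.\<close>
    define p where "p = norm (d 1) / norm (d 0)"
    define q where "q = norm (d 2) / norm (d 0)"
    have "d 1 / d 0 = p *\<^sub>R cis (2 * pi / 3)" using d_direction[of 1] t by (simp add: p_def)
    moreover have "d 2 / d 0 = q *\<^sub>R cis (pi + pi / 3)"
    proof -
      have "(\<Sum>i<2. turn i) = turn 0 + turn 1" by (simp add: numeral_2_eq_2)
      then have "(\<Sum>i<2. turn i) = pi + pi / 3" unfolding t by simp
      then show ?thesis using d_direction[of 2] unfolding q_def by (simp only:)
    qed
    moreover have "(d 0 + d 1 + d 2) / d 0 = 0" using sum_d by (simp add: n numeral_eq_Suc lessThan_Suc)
    then have "1 + d 1 / d 0 + d 2 / d 0 = 0" 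
      by (simp only: add_divide_distrib divide_self[OF d_neq[of 0]])
    ultimately have z: "1 + p *\<^sub>R cis (2 * pi / 3) + q *\<^sub>R cis (pi + pi / 3) = 0" by simp
    have c: "cis (pi + pi / 3) = - cis (pi / 3)" by (subst cis_mult[symmetric]) simp
    have "p * (sqrt 3 / 2) = q * (sqrt 3 / 2)"
      using arg_cong[OF z[unfolded c], of Im] by (simp add: sin_60 sin_120)
    then have "p = q" by simp
    moreover have "1 - p / 2 - q / 2 = 0"
      using arg_cong[OF z[unfolded c], of Re] by (simp add: cos_60 cos_120)
    ultimately have "p = 1" "q = 1" by simp_all
    then have "norm (d 1) = norm (d 0)" "norm (d 2) = norm (d 0)" using d_neq[of 0] by (simp_all add: p_def q_def)
    then have "equilateral vs" unfolding equilateral_iff n by (simp add: numeral_eq_Suc All_less_Suc)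
    then show ?thesis using pv n unfolding equilateral_triangle_def by auto
  qed
qed

text \<open>The symmetry at vertex 0 gives \<open>k 1 = k 3\<close>, so
  \<open>2 / k 1 + 1 / k 2 = 2 / 3\<close>. The only solutions are 4 and 6, the kite, and 6 and 3,
  the rhombus.\<close>

lemma quadrilateral_3_case:
  assumes n: "n = 4" and "interior_angle vs 0 = 2 * pi / 3"
  shows "rhombus_120 P \<or> kite_60_90_120 P"
proof -
  obtain k :: "nat \<Rightarrow> nat" where k: "\<And>i. 3 \<le> k i" "\<And>i. i < n \<Longrightarrow> interior_angle vs i = 2 * pi / k i"
    "\<And>i. k (i + n) = k i" "\<And>i. turn i = pi - 2 * pi / k (Suc i)"
    "(\<Sum>i<n. 1 / real (k i)) = (real n - 2) / 2"
    "\<And>i. odd (k (Suc i)) \<Longrightarrow> k (Suc (Suc i)) = k i \<and> norm (d (Suc i)) = norm (d i) \<and>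
       mir i (corner i) ` P = P"
    by (rule vertex_orders) blast
  have "2 * pi / k 0 = 2 * pi / real 3" using assms k(2)[of 0] by simp
  then have k0: "k 0 = 3" by (rule two_pi_div_inj) (use k(1)[of 0] in linarith)+
  have k4: "k 4 = 3" "k 5 = k 1" using k(3)[of 0] k(3)[of 1] n k0 by simp_all
  \<comment> \<open>Vertex 0 is addressed as vertex \<open>4 = Suc 3\<close>, because the symmetry
    is stated for successor indices.\<close>
  have m4: "k 1 = k 3" "norm (d 4) = norm (d 3)" "mir 3 (corner 3) ` P = P"
  proof -
    have S: "Suc 3 = 4" "Suc 4 = 5" by simp_all
    have "odd (k (Suc 3))" unfolding S k4 by simp
    from k(6)[OF this] show "k 1 = k 3" "norm (d 4) = norm (d 3)" "mir 3 (corner 3) ` P = P"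
      unfolding S k4 by simp_all
  qed
  have v4: "v 4 = v 0" "v 5 = v 1" "v 6 = v 2" "v 10 = v 2"
    using vert_add_length[of vs 0] vert_add_length[of vs 1] vert_add_length[of vs 2] vert_add_length[of vs 6] n
    by simp_all
  have s: "1/3 + 2 / real (k 1) + 1 / real (k 2) = 1"
    using k(5) k0 m4(1) by (simp add: n numeral_eq_Suc lessThan_Suc)
  have angles: "interior_angles vs = [2*pi/3, 2*pi/k 1, 2*pi/k 2, 2*pi/k 1]"
    using m4(1) by (simp add: interior_angles_eq n upt_rec k(2) k0 numeral_2_eq_2 numeral_3_eq_3)
  have "3 \<le> k 1" "3 \<le> k 2" using k(1) by auto
  have ns: "3 * (k 2 * 2) + 3 * k 1 = 2 * (k 1 * k 2)"
  proof -
    have "3 * (real (k 2) * 2) + 3 * real (k 1) = 2 * (real (k 1) * real (k 2))"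
      using s \<open>3 \<le> k 1\<close> \<open>3 \<le> k 2\<close> by (simp add: field_simps)
    then have "real (3 * (k 2 * 2) + 3 * k 1) = real (2 * (k 1 * k 2))" by simp
    then show ?thesis by (simp only: of_nat_eq_iff)
  qed
  \<comment> \<open>From 7 on the sum would be at most
    \<open>1/3 + 2/7 + 1/3 = 20/21\<close>.\<close>
  have "k 1 < 7"
  proof (rule ccontr)
    assume "\<not> k 1 < 7"
    then have "1 / real (k 1) \<le> 1 / real 7" by (intro inverse_nat_bounds) auto
    moreover have "1 / real (k 2) \<le> 1 / real 3" using \<open>3 \<le> k 2\<close> by (intro inverse_nat_bounds) auto
    ultimately show False using s by simp
  qed
  then consider "k 1 = 3" | "k 1 = 4" | "k 1 = 5" | "k 1 = 6" using \<open>3 \<le> k 1\<close> by linarith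
  then consider "k 1 = 4" "k 2 = 6" | "k 1 = 6" "k 2 = 3"
    by cases (use ns in \<open>simp_all\<close>, presburger)
  then show ?thesis
  proof cases
    case 1
    \<comment> \<open>The angle of 120 degrees is at vertex 0; the list of a kite starts at the
      opposite vertex, with 60 degrees.\<close>
    define ws where "ws = rotate 2 vs"
    have ws: "polygon_vertices P ws" unfolding ws_def by (rule polygon_vertices_rotate[OF pv])
    have "interior_angles ws = [pi/3, pi/2, 2*pi/3, pi/2]"
      unfolding ws_def interior_angles_rotate[OF pv] angles using 1 by (simp add: numeral_2_eq_2)
    moreover have "ws ! 0 = v 2" "ws ! 2 = v 0"
      using n v4 ne by (simp_all add: ws_def nth_rotate vert_def)
    moreover have "reflect (v 2) (v 0) ` P = P"
    proof -
      have S4: "Suc 3 = 4" by simp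
      \<comment> \<open>Two steps away from vertex 4 in either direction lies the same vertex
        \<open>v 2\<close>, so the mirror fixes it and its axis is the diagonal from
        \<open>v 0\<close>.\<close>
      have "mir 3 (corner 3) (v 6) = v 10"
        using mirror_vertices[OF m4(3), of 2] n by (simp add: numeral_eq_Suc)
      then have fix2: "mir 3 (corner 3) (v 2) = v 2" using v4 by simp
      define B where "B = cis (corner 3) * (d 4 / cnj (d 4))"
      have f: "mir 3 (corner 3) z = v 0 + B * cnj (z - v 0)" for z
        unfolding mir_def B_def S4 using v4 by simp
      have "v 0 \<noteq> v 2" using vert_eq_iff[of 0 2] n by simp
      then have "reflect (v 2) (v 0) = mir 3 (corner 3)"
        using fixed_mirror[of "v 0" B "v 2"] fix2 unfolding f by (intro ext) auto
      then show ?thesis using m4(3) by simp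
    qed
    ultimately have "kite_60_90_120 P" unfolding kite_60_90_120_def using ws by metis
    then show ?thesis by simp
  next
    case 2
    have t: "turn 0 = 2 * pi / 3" "turn 1 = pi / 3" "turn 2 = 2 * pi / 3"
    proof -
      have S: "Suc 0 = 1" "Suc 1 = 2" "Suc 2 = 3" by simp_all
      have "k 3 = 6" using 2 m4(1) by simp
      then show "turn 0 = 2 * pi / 3" "turn 1 = pi / 3" "turn 2 = 2 * pi / 3"
        using k(4)[of 0, unfolded S] k(4)[of 1, unfolded S] k(4)[of 2, unfolded S] unfolding 2 by simp_all
    qed
    \<comment> \<open>Vertex 2 also has order 3, so the sides are equal in pairs at vertices 0 and
      2. The one remaining ratio \<open>p\<close> is found from the vanishing sum of the edge
      vectors.\<close>
    have S: "Suc 1 = 2" by simp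
    have "odd (k (Suc 1))" unfolding S 2 by simp
    from k(6)[OF this] have n21: "norm (d 2) = norm (d 1)" unfolding S by simp
    have n30: "norm (d 3) = norm (d 0)" using m4(2) v4 by simp
    define p where "p = norm (d 1) / norm (d 0)"
    have "d 1 / d 0 = p *\<^sub>R cis (2 * pi / 3)" using d_direction[of 1] t by (simp add: p_def)
    moreover have "d 2 / d 0 = p *\<^sub>R cis pi"
    proof -
      have "(\<Sum>i<2. turn i) = turn 0 + turn 1" by (simp add: numeral_2_eq_2)
      then have "(\<Sum>i<2. turn i) = pi" unfolding t by simp
      then show ?thesis using d_direction[of 2] n21 by (simp add: p_def)
    qed
    moreover have "d 3 / d 0 = cis (2 * pi / 3 + pi)"
    proof -
      have "(\<Sum>i<3. turn i) = 2 * pi / 3 + pi" using t by (simp add: numeral_eq_Suc)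
      moreover have "d 3 / d 0 = cis (\<Sum>i<3. turn i)" using d_direction[of 3] n30 d_neq[of 0] by simp
      ultimately show ?thesis by (simp only:)
    qed
    moreover have "(d 0 + d 1 + d 2 + d 3) / d 0 = 0" using sum_d by (simp add: n numeral_eq_Suc lessThan_Suc)
    then have "1 + d 1 / d 0 + d 2 / d 0 + d 3 / d 0 = 0" 
      by (simp only: add_divide_distrib divide_self[OF d_neq[of 0]])
    ultimately have z: "1 + p *\<^sub>R cis (2 * pi / 3) + p *\<^sub>R cis pi + cis (2 * pi / 3 + pi) = 0" by simp
    have c: "cis (2 * pi / 3 + pi) = - cis (2 * pi / 3)" by (subst cis_mult[symmetric]) simp
    have "p * (sqrt 3 / 2) = sqrt 3 / 2"
      using arg_cong[OF z[unfolded c], of Im] by (simp add: sin_120)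
    then have "p = 1" by simp
    then have "norm (d 1) = norm (d 0)" using d_neq[of 0] by (simp add: p_def)
    then have "equilateral vs" unfolding equilateral_iff n using n21 n30 by (simp add: numeral_eq_Suc All_less_Suc)
    moreover have "2 * pi / 3 \<in> set (interior_angles vs)" by (simp add: angles)
    ultimately have "rhombus_120 P" using pv n unfolding rhombus_120_def by auto
    then show ?thesis by simp
  qed
qed

text \<open>The symmetry at vertex 0 gives \<open>k 4 = k 1\<close>. If this order is 3, symmetry
  spreads 3 to all vertices and the sum is 5/3 instead of 3/2. If it is 4, vertices 2 and 3 must
  have order 3, and symmetry at vertex 2 gives \<open>k 3 = k 1\<close>. From 5 on the sum is too
  small.\<close>

lemma pentagon_3_case:
  assumes n: "n = 5" and "interior_angle vs 0 = 2 * pi / 3"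
  shows False
proof -
  obtain k :: "nat \<Rightarrow> nat" where k: "\<And>i. 3 \<le> k i" "\<And>i. i < n \<Longrightarrow> interior_angle vs i = 2 * pi / k i"
    "\<And>i. k (i + n) = k i" "(\<Sum>i<n. 1 / real (k i)) = (real n - 2) / 2"
    "\<And>i. odd (k (Suc i)) \<Longrightarrow> k (Suc (Suc i)) = k i"
    using vertex_orders by metis
  have "2 * pi / k 0 = 2 * pi / real 3" using assms k(2)[of 0] by simp
  then have k0: "k 0 = 3" by (rule two_pi_div_inj) (use k(1)[of 0] in linarith)+
  have k5: "k 5 = 3" "k 6 = k 1" using k(3)[of 0] k(3)[of 1] n k0 by simp_all
  have odd: "k (i + 2) = k i" if "k (i + 1) = 3" for i
    using k(5)[of i] that by simp
  have k14: "k 4 = k 1" using odd[of 4] k5 by simp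
  have s: "1/3 + 2 / real (k 1) + 1 / real (k 2) + 1 / real (k 3) = 3/2"
    using k(4) k0 k14 by (simp add: n numeral_eq_Suc lessThan_Suc)
  have b: "1 / real (k i) \<le> 1/3" for i using inverse_nat_bounds(1)[of 3 "k i"] k(1) by simp
  consider "k 1 = 3" | "k 1 = 4" | "5 \<le> k 1" using k(1)[of 1] by linarith
  then show False
  proof cases
    case 1
    then have "k 2 = 3" using odd[of 0] k0 by (simp add: numeral_2_eq_2)
    moreover have "k 3 = 3" using odd[of 3] k14 k5 1 by simp
    ultimately show False using s 1 by simp
  next
    case 2
    moreover have "2 / real (k 1) = 1/2" using 2 by simp
    ultimately have "1 / real (k 2) = 1/3" "1 / real (k 3) = 1/3"
      using s b[of 2] b[of 3] by linarith+
    then have k23: "k 2 = 3" "k 3 = 3" by (blast intro: one_div_nat_numeral)+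
    then show False using odd[of 1] 2 by (simp add: numeral_2_eq_2 numeral_3_eq_3)
  next
    case 3
    then have "1 / real (k 1) \<le> 1 / real 5" by (intro inverse_nat_bounds) auto
    then show False using s b[of 2] b[of 3] by simp
  qed
qed

lemma rotate_edge_tiling: "edge_tiling_polygon (rotate m vs) P"
proof
  show "polygon_vertices P (rotate m vs)" by (rule polygon_vertices_rotate[OF pv])
  show "convex P" by (rule cvx)
  show "generates_edge_tessellation P" by (rule gen)
  fix x i assume "x \<in> P"
  then show "0 \<le> wedge (vert (rotate m vs) (Suc i) - vert (rotate m vs) i) (x - vert (rotate m vs) i)"
    using left[of x "i + m"] by (simp add: vert_rotate[OF ne])
qed

text \<open>Orders of at least 4 throughout are possible only for \<open>n \<le> 4\<close>, and for
  \<open>n = 4\<close> they must all equal 4. Hence a pentagon has a vertex of order 3, which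
  rotation moves to index 0. For \<open>n = 6\<close> all orders are 3, and the symmetries at the
  vertices make all sides equal.\<close>

lemma classification:
  "rectangle P \<or> equilateral_triangle P \<or> right_triangle_60 P \<or> isosceles_right_triangle P \<or>
    isosceles_triangle_120 P \<or> rhombus_120 P \<or> kite_60_90_120 P \<or> regular_hexagon P"
proof -
  obtain k :: "nat \<Rightarrow> nat" where k: "\<And>i. 3 \<le> k i" "\<And>i. i < n \<Longrightarrow> interior_angle vs i = 2 * pi / k i"
    "(\<Sum>i<n. 1 / real (k i)) = (real n - 2) / 2"
    "\<And>i. odd (k (Suc i)) \<Longrightarrow> norm (d (Suc i)) = norm (d i)"
    using vertex_orders by metis
  have third: "1 / real (k i) \<le> 1/3" for i using inverse_nat_bounds(1)[of 3 "k i"] k(1) by simp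
  have "(\<Sum>i<n. 1 / real (k i)) \<le> (\<Sum>i<n. 1/3)" by (intro sum_mono third)
  then have "(real n - 2) / 2 \<le> real n / 3" unfolding k(3) by simp
  then have "n \<le> 6" by (simp add: field_simps)
  have no3: "(real n - 2) / 2 \<le> real n / 4" if "\<And>i. i < n \<Longrightarrow> k i \<noteq> 3"
  proof -
    have "1 / real (k i) \<le> 1/4" if "i < n" for i
      using inverse_nat_bounds(1)[of 4 "k i"] k(1)[of i] \<open>\<And>i. i < n \<Longrightarrow> k i \<noteq> 3\<close>[OF that] by simp
    then have "(\<Sum>i<n. 1 / real (k i)) \<le> (\<Sum>i<n. 1/4)" by (intro sum_mono) auto
    then show ?thesis unfolding k(3) by simp
  qed
  have rotated: "edge_tiling_polygon (rotate i vs) P \<and> interior_angle (rotate i vs) 0 = 2 * pi / 3"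
    if "i < n" "k i = 3" for i
  proof -
    have "interior_angles (rotate i vs) ! 0 = interior_angles vs ! i"
      unfolding interior_angles_rotate[OF pv] using that n0 by (simp add: nth_rotate interior_angles_def)
    then have "interior_angle (rotate i vs) 0 = interior_angle vs i"
      using that n0 by (simp add: interior_angles_def)
    then show ?thesis using rotate_edge_tiling k(2)[OF that(1)] that(2) by simp
  qed
  consider "n = 3" | "n = 4" | "n = 5" | "n = 6" using n3 \<open>n \<le> 6\<close> by linarith
  then show ?thesis
  proof cases
    case 1
    then show ?thesis using triangle_case by blast
  next
    case 2
    show ?thesis
    proof (cases "\<exists>i<n. k i = 3")
      case True
      then obtain i where i: "i < n" "k i = 3" by blast
      interpret r: edge_tiling_polygon "rotate i vs" P using rotated[OF i] by simp
      have "rhombus_120 P \<or> kite_60_90_120 P"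
        by (rule r.quadrilateral_3_case) (use rotated[OF i] 2 in auto)
      then show ?thesis by blast
    next
      case False
      then have q: "1 / real (k i) \<le> 1/4" if "i < n" for i
        using inverse_nat_bounds(1)[of 4 "k i"] k(1)[of i] that by fastforce
      have "1 / real (k 0) + 1 / real (k 1) + 1 / real (k 2) + 1 / real (k 3) = 1"
        using k(3) by (simp add: 2 numeral_eq_Suc lessThan_Suc)
      moreover have "1 / real (k 0) \<le> 1/4" "1 / real (k 1) \<le> 1/4" "1 / real (k 2) \<le> 1/4" "1 / real (k 3) \<le> 1/4"
        by (rule q, simp add: 2)+
      ultimately have "1 / real (k 0) = 1/4" "1 / real (k 1) = 1/4"
          "1 / real (k 2) = 1/4" "1 / real (k 3) = 1/4"
        by linarith+
      then have "k 0 = 4" "k 1 = 4" "k 2 = 4" "k 3 = 4" by (blast intro: one_div_nat_numeral)+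
      then have "interior_angles vs = [pi/2, pi/2, pi/2, pi/2]"
        by (simp add: interior_angles_eq 2 upt_rec k(2) numeral_2_eq_2 numeral_3_eq_3)
      then have "rectangle P" using pv unfolding rectangle_def by blast
      then show ?thesis by simp
    qed
  next
    case 3
    then obtain i where i: "i < n" "k i = 3" using no3 by fastforce
    interpret r: edge_tiling_polygon "rotate i vs" P using rotated[OF i] by simp
    have False by (rule r.pentagon_3_case) (use rotated[OF i] 3 in auto)
    then show ?thesis ..
  next
    case 4
    have k3: "k i = 3" if "i < n" for i
    proof (rule ccontr)
      assume "k i \<noteq> 3"
      then have "1 / real (k i) \<le> 1 / real 4" using k(1)[of i] by (intro inverse_nat_bounds) auto
      then have "1 / real (k i) < 1/3" by simp
      then have "(\<Sum>i<n. 1 / real (k i)) < (\<Sum>i<n. 1/3)"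
        using that third by (intro sum_strict_mono_ex1) auto
      then show False unfolding k(3) by (simp add: 4)
    qed
    then have "norm (d (Suc i)) = norm (d i)" if "Suc i < n" for i using that k(4) by simp
    then have "norm (d i) = norm (d 0)" if "i < n" for i
      using that by (induction i) auto
    then have "equilateral vs" unfolding equilateral_iff by simp
    moreover have "equiangular vs" unfolding equiangular_def using k(2) k3 by metis
    ultimately have "regular_hexagon P" using pv 4 unfolding regular_hexagon_def by blast
    then show ?thesis by simp
  qed
qed

end

theorem theorem1:
  fixes G :: "complex set"
  assumes "polygon G"
    and "generates_edge_tessellation G"
  shows "rectangle G \<or> equilateral_triangle G \<or> right_triangle_60 G \<or> isosceles_right_triangle G \<or>
    isosceles_triangle_120 G \<or> rhombus_120 G \<or> kite_60_90_120 G \<or> regular_hexagon G"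
proof -
  obtain vs where "polygon_vertices G vs" using assms(1) by (auto simp: polygon_def)
  then interpret jordan_polygon vs G by unfold_locales
  interpret convex_polygon vs G by unfold_locales (rule convex_P[OF assms(2)])
  obtain s where s: "s = 1 \<or> s = -1" "\<And>x i. x \<in> G \<Longrightarrow> 0 \<le> s * wedge (d i) (x - v i)"
    by (rule orientation) blast
  from s(1) show ?thesis
  proof
    assume "s = 1"
    then interpret edge_tiling_polygon vs G using s(2) assms(2) by unfold_locales auto
    show ?thesis by (rule classification)
  next
    assume s1: "s = -1"
    \<comment> \<open>Reversal traverses each edge backwards and so changes the sign of its
      functional, which turns the clockwise list into a counterclockwise one.\<close>
    have "0 \<le> wedge (vert (rev vs) (Suc i) - vert (rev vs) i) (x - vert (rev vs) i)" if "x \<in> G" for x i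
    proof -
      obtain j where j: "n dvd Suc (Suc i) + j" using ex_add_dvd n0 by blast
      then have r: "vert (rev vs) i = v (Suc j)" "vert (rev vs) (Suc i) = v j"
        by (simp_all add: vert_rev[OF ne])
      have "wedge (v j - v (Suc j)) (x - v (Suc j)) = - wedge (d j) (x - v j)"
        by (simp add: wedge_def algebra_simps)
      then show ?thesis using s(2)[OF that, of j] by (simp add: r s1)
    qed
    then interpret r: edge_tiling_polygon "rev vs" G
      using polygon_vertices_rev[OF pv] cvx assms(2) by unfold_locales auto
    show ?thesis by (rule r.classification)
  qed
qed

end
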